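(* Let $P$ be a polynomial endofunctor represented by a diagram of groupoids $I \leftarrow E \to B \to I$, let $\mathbf T$ be the groupoid of $P$-trees and $\mathbf F$ the groupoid of $P$-forests. There are equivalences of groupoids over $\mathbf F\times\mathbf T$: $$\int^{T\in\mathbf T}\operatorname{cut}(T)\;\simeq\;\int^{S\in\mathbf T}\mathbf F_{LS}\;\simeq\;\int^{N\in\widetilde I}\mathbf F_N\times{}_N\mathbf T .$$
   Context: Groupoids. A morphism of groupoids is a functor, and equivalence means equivalence of categories. For a functor $p:X\to Y$ of groupoids and $y\in Y$, the (homotopy) fibre over $y$ has as objects pairs $(x,\varphi:p(x)\xrightarrow{\sim}y)$ and as arrows the arrows $x\to x'$ of $X$ compatible with the $\varphi$'s; it depends functorially on $y$ by postcomposition. For a functor $F:Y\to\mathbf{Grpd}$, the homotopy sum $\int^{y\in Y}F(y)$ is the Grothendieck construction: objects are pairs $(y,x)$ with $y\in Y$, $x\in F(y)$; arrows $(y,x)\to(y',x')$ are pairs $(\sigma,\phi)$ with $\sigma:y\to y'$ in $Y$ and $\phi:F(\sigma)(x)\to x'$ in $F(y')$. An equivalence over a groupoid $Z$ is one that commutes with the functors to $Z$ up to natural isomorphism. For a groupoid $I$, $\widetilde I$ is the groupoid whose objects are functors $N:X\to I$ with $X$ a finite set (a discrete groupoid), and whose arrows from $N:X\to I$ to $N':X'\to I$ are pairs of a bijection $f:X\to X'$ and a natural isomorphism $N\cong N'\circ f$. Trees. A tree is a diagram of finite sets $A\xleftarrow{s}M\xrightarrow{p}N\xrightarrow{t}A$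 such that $t$ is injective; $s$ is injective with singleton complement $\{1\}$ (the root); and, with $\sigma:A\to A$ given by $\sigma(1)=1$ and $\sigma(s(e))=t(p(e))$, for every $x\in A$ there is $k\in\mathbb N$ with $\sigma^k(x)=1$. Elements of $A$ are edges, elements of $N$ are nodes, $t(n)$ is the output edge of the node $n$, $p^{-1}(n)$ its set of input edges, and the leaves are the elements of $A\setminus t(N)$. A tree embedding is a triple of (necessarily injective) maps $A'\to A$, $M'\to M$, $N'\to N$ commuting with the structure maps and such that the square over $p$ is a pullback; it is root-preserving if it sends root to root. $P$-trees. A $P$-tree is a tree together with functors $\alpha:A\to I$, $M\to E$, $N\to B$ and specified natural isomorphisms making the three squares to $I\leftarrow E\to B\to I$ commute (the same $\alpha$ at both ends), with the middle square a homotopy pullback. An embedding of $P$-trees is a tree embedding together with natural isomorphisms between the decorating functors compatible with all specified isomorphisms; $\mathbf T$ is the groupoid of $P$-trees and their isomorphisms. The groupoid of $P$-forests is $\mathbf F=\widetilde{\mathbf T}$ (finite families of $P$-trees). The leaf functor $L:\mathbf T\to\widetilde I$ sends a $P$-tree to its set of leaves with colouring restricted from $\alpha$; the root functor $R:\mathbf F\to\widetilde I$ sends a family $(T_x)_{x\in X}$ to the family of root colours $(\alpha_{T_x}(1))_{x\in X}$. $\mathbf F_N$ is the homotopy fibre of $R:\mathbf F\to\widetilde I$ over $N$, and ${}_N\mathbf T$ is the homotopy fibre of $L:\mathbf T\to\widetilde I$ over $N$. Cuts. A cut of a $P$-tree $T$ is a subtree $S\subset T$ containing the root, i.e. an isomorphism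 class (over $T$) of root-preserving embeddings $c:S\rightarrowtail T$, with the restricted decoration. The set of cuts, regarded as a discrete groupoid, is $\operatorname{cut}(T)$. For such a cut put $S_c:=S$, and let $P_c$ be the forest, indexed by the leaves $\ell$ of $S$, of the ideal subtrees $T_\ell\subset T$, where $T_\ell$ has root $\ell$ and consists of all edges $x$ of $T$ with $\sigma^k(x)=\ell$ for some $k\ge0$ and all nodes whose output edge is such an edge. Structure maps to $\mathbf F\times\mathbf T$. $(T,c)\mapsto(P_c,S_c)$ on the first homotopy sum; on the second, a pair consisting of $S$ and an object of $\mathbf F_{LS}$ with underlying forest $Q$ is sent to $(Q,S)$; on the third, $N$ together with objects of $\mathbf F_N$ and ${}_N\mathbf T$ with underlying forest $Q$ and underlying tree $S$ is sent to $(Q,S)$. *)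

theory Defs
  imports "HOL-Library.FuncSet" "HOL-Library.Infinite_Typeclass"
begin

text \<open>Throughout, a finite set is a finite subset of a fixed type \<^typ>\<open>'u\<close>, which the theorem
  requires to be infinite, so that every finite set has a copy. Maps between sets are
  extensional (\<^const>\<open>PiE\<close>), so that equality of maps is equality on the domain.\<close>


section \<open>Groupoids, functors, equivalences\<close>

record ('o, 'a) gpd =
  Obj :: "'o set"
  Arr :: "'a set"
  Dom :: "'a \<Rightarrow> 'o"
  Cod :: "'a \<Rightarrow> 'o"
  Ident :: "'o \<Rightarrow> 'a"
  Comp :: "'a \<Rightarrow> 'a \<Rightarrow> 'a"  (infixl \<open>\<cdot>\<index>\<close> 70)

locale groupoid =
  fixes G :: "('o, 'a) gpd" (structure)
  assumes Dom_in: "a \<in> Arr G \<Longrightarrow> Dom G a \<in> Obj G"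
    and Cod_in: "a \<in> Arr G \<Longrightarrow> Cod G a \<in> Obj G"
    and Ident_in: "x \<in> Obj G \<Longrightarrow> Ident G x \<in> Arr G"
    and Dom_Ident: "x \<in> Obj G \<Longrightarrow> Dom G (Ident G x) = x"
    and Cod_Ident: "x \<in> Obj G \<Longrightarrow> Cod G (Ident G x) = x"
    and Comp_in: "\<lbrakk>a \<in> Arr G; b \<in> Arr G; Cod G a = Dom G b\<rbrakk> \<Longrightarrow> b \<cdot> a \<in> Arr G"
    and Dom_Comp: "\<lbrakk>a \<in> Arr G; b \<in> Arr G; Cod G a = Dom G b\<rbrakk> \<Longrightarrow> Dom G (b \<cdot> a) = Dom G a"
    and Cod_Comp: "\<lbrakk>a \<in> Arr G; b \<in> Arr G; Cod G a = Dom G b\<rbrakk> \<Longrightarrow> Cod G (b \<cdot> a) = Cod G b"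
    and Comp_assoc: "\<lbrakk>a \<in> Arr G; b \<in> Arr G; c \<in> Arr G; Cod G a = Dom G b; Cod G b = Dom G c\<rbrakk>
      \<Longrightarrow> (c \<cdot> b) \<cdot> a = c \<cdot> (b \<cdot> a)"
    and Comp_Ident_right: "a \<in> Arr G \<Longrightarrow> a \<cdot> Ident G (Dom G a) = a"
    and Comp_Ident_left: "a \<in> Arr G \<Longrightarrow> Ident G (Cod G a) \<cdot> a = a"
    and inverse_ex: "a \<in> Arr G \<Longrightarrow> \<exists>b\<in>Arr G. Dom G b = Cod G a \<and> Cod G b = Dom G a \<and>
      b \<cdot> a = Ident G (Dom G a) \<and> a \<cdot> b = Ident G (Cod G a)"

definition Hom :: "('o, 'a) gpd \<Rightarrow> 'o \<Rightarrow> 'o \<Rightarrow> 'a set" where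
  "Hom G x y = {a \<in> Arr G. Dom G a = x \<and> Cod G a = y}"

record ('o, 'a, 'p, 'b) gfun =
  omap :: "'o \<Rightarrow> 'p"
  amap :: "'a \<Rightarrow> 'b"

locale gfunctor = X: groupoid X + Y: groupoid Y
  for X :: "('o, 'a) gpd" and Y :: "('p, 'b) gpd" +
  fixes F :: "('o, 'a, 'p, 'b) gfun"
  assumes omap_in: "x \<in> Obj X \<Longrightarrow> omap F x \<in> Obj Y"
    and amap_in: "a \<in> Arr X \<Longrightarrow> amap F a \<in> Hom Y (omap F (Dom X a)) (omap F (Cod X a))"
    and amap_Ident: "x \<in> Obj X \<Longrightarrow> amap F (Ident X x) = Ident Y (omap F x)"
    and amap_Comp: "\<lbrakk>a \<in> Arr X; b \<in> Arr X; Cod X a = Dom X b\<rbrakk>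
      \<Longrightarrow> amap F (b \<cdot>\<^bsub>X\<^esub> a) = amap F b \<cdot>\<^bsub>Y\<^esub> amap F a"

definition gid :: "('o, 'a, 'o, 'a) gfun" where
  "gid = \<lparr>omap = (\<lambda>x. x), amap = (\<lambda>a. a)\<rparr>"

definition gcomp :: "('p, 'b, 'q, 'c) gfun \<Rightarrow> ('o, 'a, 'p, 'b) gfun \<Rightarrow> ('o, 'a, 'q, 'c) gfun"
    (infixl \<open>\<circ>\<circ>\<close> 55) where
  "G \<circ>\<circ> F = \<lparr>omap = omap G \<circ> omap F, amap = amap G \<circ> amap F\<rparr>"

text \<open>In a groupoid every natural transformation is a natural isomorphism.\<close>

definition nat_iso :: "('o, 'a) gpd \<Rightarrow> ('p, 'b) gpd \<Rightarrow>
    ('o, 'a, 'p, 'b) gfun \<Rightarrow> ('o, 'a, 'p, 'b) gfun \<Rightarrow> ('o \<Rightarrow> 'b) \<Rightarrow> bool" where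
  "nat_iso X Y F G \<eta> \<longleftrightarrow> gfunctor X Y F \<and> gfunctor X Y G \<and>
    (\<forall>x\<in>Obj X. \<eta> x \<in> Hom Y (omap F x) (omap G x)) \<and>
    (\<forall>a\<in>Arr X. amap G a \<cdot>\<^bsub>Y\<^esub> \<eta> (Dom X a) = \<eta> (Cod X a) \<cdot>\<^bsub>Y\<^esub> amap F a)"

definition gequivalence :: "('o, 'a) gpd \<Rightarrow> ('p, 'b) gpd \<Rightarrow> ('o, 'a, 'p, 'b) gfun \<Rightarrow> bool" where
  "gequivalence X Y F \<longleftrightarrow> gfunctor X Y F \<and>
    (\<exists>G \<eta> \<epsilon>. gfunctor Y X G \<and> nat_iso X X (G \<circ>\<circ> F) gid \<eta> \<and> nat_iso Y Y (F \<circ>\<circ> G) gid \<epsilon>)"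

definition equivalent_over :: "('z, 'c) gpd \<Rightarrow> ('o, 'a) gpd \<Rightarrow> ('o, 'a, 'z, 'c) gfun \<Rightarrow>
    ('p, 'b) gpd \<Rightarrow> ('p, 'b, 'z, 'c) gfun \<Rightarrow> bool" where
  "equivalent_over Z X u Y v \<longleftrightarrow> gfunctor X Z u \<and> gfunctor Y Z v \<and>
    (\<exists>\<Phi> \<theta>. gequivalence X Y \<Phi> \<and> nat_iso X Z (v \<circ>\<circ> \<Phi>) u \<theta>)"


section \<open>Constructions on groupoids\<close>

text \<open>A groupoid presented by hom-sets. The hom-sets need not be disjoint, so an arrow is a
  triple of source, target and an element of the hom-set.\<close>

definition hom_gpd :: "'o set \<Rightarrow> ('o \<Rightarrow> 'o \<Rightarrow> 'h set) \<Rightarrow> ('o \<Rightarrow> 'h) \<Rightarrow>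
    ('o \<Rightarrow> 'o \<Rightarrow> 'o \<Rightarrow> 'h \<Rightarrow> 'h \<Rightarrow> 'h) \<Rightarrow> ('o, 'o \<times> 'o \<times> 'h) gpd" where
  "hom_gpd Ob hm idn cmp =
    \<lparr>Obj = Ob,
     Arr = {(x, y, h). x \<in> Ob \<and> y \<in> Ob \<and> h \<in> hm x y},
     Dom = (\<lambda>(x, y, h). x),
     Cod = (\<lambda>(x, y, h). y),
     Ident = (\<lambda>x. (x, x, idn x)),
     Comp = (\<lambda>(y', z, g) (x, y, f). (x, z, cmp x y z g f))\<rparr>"

definition disc_gpd :: "'o set \<Rightarrow> ('o, 'o) gpd" where
  "disc_gpd X = \<lparr>Obj = X, Arr = X, Dom = (\<lambda>x. x), Cod = (\<lambda>x. x), Ident = (\<lambda>x. x), Comp = (\<lambda>y x. x)\<rparr>"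

definition disc_fun :: "('p, 'b) gpd \<Rightarrow> ('o \<Rightarrow> 'p) \<Rightarrow> ('o, 'o, 'p, 'b) gfun" where
  "disc_fun Y f = \<lparr>omap = f, amap = (\<lambda>x. Ident Y (f x))\<rparr>"

definition prod_gpd :: "('o, 'a) gpd \<Rightarrow> ('p, 'b) gpd \<Rightarrow> ('o \<times> 'p, 'a \<times> 'b) gpd"
    (infixr \<open>\<times>\<^sub>G\<close> 80) where
  "X \<times>\<^sub>G Y =
    \<lparr>Obj = Obj X \<times> Obj Y,
     Arr = Arr X \<times> Arr Y,
     Dom = map_prod (Dom X) (Dom Y),
     Cod = map_prod (Cod X) (Cod Y),
     Ident = map_prod (Ident X) (Ident Y),
     Comp = (\<lambda>(b, b') (a, a'). (b \<cdot>\<^bsub>X\<^esub> a, b' \<cdot>\<^bsub>Y\<^esub> a'))\<rparr>"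

definition prod_fun :: "('o, 'a, 'p, 'b) gfun \<Rightarrow> ('o', 'a', 'p', 'b') gfun \<Rightarrow>
    ('o \<times> 'o', 'a \<times> 'a', 'p \<times> 'p', 'b \<times> 'b') gfun" where
  "prod_fun F G = \<lparr>omap = map_prod (omap F) (omap G), amap = map_prod (amap F) (amap G)\<rparr>"

definition hpullback :: "('o, 'a) gpd \<Rightarrow> ('p, 'b) gpd \<Rightarrow> ('z, 'c) gpd \<Rightarrow>
    ('o, 'a, 'z, 'c) gfun \<Rightarrow> ('p, 'b, 'z, 'c) gfun \<Rightarrow>
    ('o \<times> 'p \<times> 'c, ('o \<times> 'p \<times> 'c) \<times> ('o \<times> 'p \<times> 'c) \<times> ('a \<times> 'b)) gpd" where
  "hpullback X Y Z F G = hom_gpd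
    {(x, y, \<phi>). x \<in> Obj X \<and> y \<in> Obj Y \<and> \<phi> \<in> Hom Z (omap F x) (omap G y)}
    (\<lambda>(x, y, \<phi>) (x', y', \<phi>').
      {(a, b). a \<in> Hom X x x' \<and> b \<in> Hom Y y y' \<and> \<phi>' \<cdot>\<^bsub>Z\<^esub> amap F a = amap G b \<cdot>\<^bsub>Z\<^esub> \<phi>})
    (\<lambda>(x, y, \<phi>). (Ident X x, Ident Y y))
    (\<lambda>_ _ _ (a', b') (a, b). (a' \<cdot>\<^bsub>X\<^esub> a, b' \<cdot>\<^bsub>Y\<^esub> b))"

text \<open>The square with sides \<open>H : W \<rightarrow> X\<close>, \<open>K : W \<rightarrow> Y\<close>, \<open>F : X \<rightarrow> Z\<close>, \<open>G : Y \<rightarrow> Z\<close>, filled by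
  \<open>\<theta> : F H \<cong> G K\<close>, is a homotopy pullback.\<close>

definition is_hpullback :: "('w, 'd) gpd \<Rightarrow> ('o, 'a) gpd \<Rightarrow> ('p, 'b) gpd \<Rightarrow> ('z, 'c) gpd \<Rightarrow>
    ('w, 'd, 'o, 'a) gfun \<Rightarrow> ('w, 'd, 'p, 'b) gfun \<Rightarrow>
    ('o, 'a, 'z, 'c) gfun \<Rightarrow> ('p, 'b, 'z, 'c) gfun \<Rightarrow> ('w \<Rightarrow> 'c) \<Rightarrow> bool" where
  "is_hpullback W X Y Z H K F G \<theta> \<longleftrightarrow> nat_iso W Z (F \<circ>\<circ> H) (G \<circ>\<circ> K) \<theta> \<and>
    gequivalence W (hpullback X Y Z F G)
      \<lparr>omap = (\<lambda>w. (omap H w, omap K w, \<theta> w)),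
       amap = (\<lambda>d. ((omap H (Dom W d), omap K (Dom W d), \<theta> (Dom W d)),
                    (omap H (Cod W d), omap K (Cod W d), \<theta> (Cod W d)),
                    (amap H d, amap K d)))\<rparr>"

definition hfibre :: "('o, 'a) gpd \<Rightarrow> ('p, 'b) gpd \<Rightarrow> ('o, 'a, 'p, 'b) gfun \<Rightarrow> 'p \<Rightarrow>
    ('o \<times> 'b, ('o \<times> 'b) \<times> ('o \<times> 'b) \<times> 'a) gpd" where
  "hfibre X Y p y = hom_gpd
    {(x, \<phi>). x \<in> Obj X \<and> \<phi> \<in> Hom Y (omap p x) y}
    (\<lambda>(x, \<phi>) (x', \<phi>'). {a \<in> Hom X x x'. \<phi>' \<cdot>\<^bsub>Y\<^esub> amap p a = \<phi>})
    (\<lambda>(x, \<phi>). Ident X x)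
    (\<lambda>_ _ _ a' a. a' \<cdot>\<^bsub>X\<^esub> a)"

text \<open>Functors from a groupoid (with objects \<^typ>\<open>'y\<close> and arrows \<^typ>\<open>'ya\<close>) to groupoids.\<close>

record ('y, 'ya, 'o, 'a) gpd_family =
  fam :: "'y \<Rightarrow> ('o, 'a) gpd"
  tra :: "'ya \<Rightarrow> ('o, 'a, 'o, 'a) gfun"

definition hsum :: "('y, 'ya) gpd \<Rightarrow> ('y, 'ya, 'o, 'a) gpd_family \<Rightarrow>
    ('y \<times> 'o, ('y \<times> 'o) \<times> ('y \<times> 'o) \<times> ('ya \<times> 'a)) gpd" where
  "hsum Y F = hom_gpd
    {(y, x). y \<in> Obj Y \<and> x \<in> Obj (fam F y)}
    (\<lambda>(y, x) (y', x'). {(\<sigma>, \<phi>). \<sigma> \<in> Hom Y y y' \<and> \<phi> \<in> Hom (fam F y') (omap (tra F \<sigma>) x) x'})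
    (\<lambda>(y, x). (Ident Y y, Ident (fam F y) x))
    (\<lambda>_ _ (y'', x'') (\<sigma>', \<phi>') (\<sigma>, \<phi>). (\<sigma>' \<cdot>\<^bsub>Y\<^esub> \<sigma>, \<phi>' \<cdot>\<^bsub>fam F y''\<^esub> amap (tra F \<sigma>') \<phi>))"

definition fibre_family :: "('o, 'a) gpd \<Rightarrow> ('p, 'b) gpd \<Rightarrow> ('o, 'a, 'p, 'b) gfun \<Rightarrow>
    ('p, 'b, 'o \<times> 'b, ('o \<times> 'b) \<times> ('o \<times> 'b) \<times> 'a) gpd_family" where
  "fibre_family X Y p =
    \<lparr>fam = hfibre X Y p,
     tra = (\<lambda>\<omega>. \<lparr>omap = (\<lambda>(x, \<phi>). (x, \<omega> \<cdot>\<^bsub>Y\<^esub> \<phi>)),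
                 amap = (\<lambda>((x, \<phi>), (x', \<phi>'), a). ((x, \<omega> \<cdot>\<^bsub>Y\<^esub> \<phi>), (x', \<omega> \<cdot>\<^bsub>Y\<^esub> \<phi>'), a))\<rparr>)\<rparr>"

definition pullback_family :: "('y, 'ya, 'o, 'a) gpd_family \<Rightarrow> ('z, 'za, 'y, 'ya) gfun \<Rightarrow>
    ('z, 'za, 'o, 'a) gpd_family" where
  "pullback_family F L = \<lparr>fam = fam F \<circ> omap L, tra = tra F \<circ> amap L\<rparr>"

definition prod_family :: "('y, 'ya, 'o, 'a) gpd_family \<Rightarrow> ('y, 'ya, 'p, 'b) gpd_family \<Rightarrow>
    ('y, 'ya, 'o \<times> 'p, 'a \<times> 'b) gpd_family" where
  "prod_family F G =
    \<lparr>fam = (\<lambda>y. fam F y \<times>\<^sub>G fam G y), tra = (\<lambda>\<sigma>. prod_fun (tra F \<sigma>) (tra G \<sigma>))\<rparr>"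

text \<open>The groupoid of finite families of objects of \<^term>\<open>G\<close>. A functor \<open>N : X \<rightarrow> G\<close> from a finite
  (discrete) set is encoded as a pair \<open>(X, N)\<close>; an arrow is a bijection with a family of arrows
  \<open>N x \<rightarrow> N' (f x)\<close>.\<close>

definition tilde :: "('o, 'a) gpd \<Rightarrow> ('u set \<times> ('u \<Rightarrow> 'o),
    ('u set \<times> ('u \<Rightarrow> 'o)) \<times> ('u set \<times> ('u \<Rightarrow> 'o)) \<times> (('u \<Rightarrow> 'u) \<times> ('u \<Rightarrow> 'a))) gpd" where
  "tilde G = hom_gpd
    {(X, N). finite X \<and> N \<in> X \<rightarrow>\<^sub>E Obj G}
    (\<lambda>(X, N) (X', N'). {(f, \<eta>). f \<in> X \<rightarrow>\<^sub>E X' \<and> bij_betw f X X' \<and>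
      \<eta> \<in> (\<Pi>\<^sub>E x\<in>X. Hom G (N x) (N' (f x)))})
    (\<lambda>(X, N). (\<lambda>x\<in>X. x, \<lambda>x\<in>X. Ident G (N x)))
    (\<lambda>(X, N) _ _ (g, \<theta>) (f, \<eta>). (\<lambda>x\<in>X. g (f x), \<lambda>x\<in>X. \<theta> (f x) \<cdot>\<^bsub>G\<^esub> \<eta> x))"


section \<open>Trees\<close>

text \<open>The diagram \<open>A \<leftarrow>s\<midarrow> M \<midarrow>p\<rightarrow> N \<midarrow>t\<rightarrow> A\<close>. An element of \<open>M\<close> (\<open>marks\<close>) is a node together with one of
  its input edges.\<close>

record 'u tree =
  edges :: "'u set"
  marks :: "'u set"
  nodes :: "'u set"
  smap :: "'u \<Rightarrow> 'u"
  pmap :: "'u \<Rightarrow> 'u"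
  tmap :: "'u \<Rightarrow> 'u"

definition root :: "('u, 'z) tree_scheme \<Rightarrow> 'u" where
  "root T = the_elem (edges T - smap T ` marks T)"

definition walk :: "('u, 'z) tree_scheme \<Rightarrow> 'u \<Rightarrow> 'u" where
  "walk T x = (if x = root T then root T else tmap T (pmap T (the_inv_into (marks T) (smap T) x)))"

definition is_tree :: "('u, 'z) tree_scheme \<Rightarrow> bool" where
  "is_tree T \<longleftrightarrow> finite (edges T) \<and> finite (marks T) \<and> finite (nodes T) \<and>
    smap T \<in> marks T \<rightarrow>\<^sub>E edges T \<and> pmap T \<in> marks T \<rightarrow>\<^sub>E nodes T \<and> tmap T \<in> nodes T \<rightarrow>\<^sub>E edges T \<and>
    inj_on (tmap T) (nodes T) \<and> inj_on (smap T) (marks T) \<and>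
    is_singleton (edges T - smap T ` marks T) \<and>
    (\<forall>x\<in>edges T. \<exists>k. (walk T ^^ k) x = root T)"

definition leaves :: "('u, 'z) tree_scheme \<Rightarrow> 'u set" where
  "leaves T = edges T - tmap T ` nodes T"

record 'u tree_map =
  emap :: "'u \<Rightarrow> 'u"
  mmap :: "'u \<Rightarrow> 'u"
  nmap :: "'u \<Rightarrow> 'u"

definition tree_embedding ::
    "('u, 'z) tree_scheme \<Rightarrow> ('u, 'z) tree_scheme \<Rightarrow> ('u, 'y) tree_map_scheme \<Rightarrow> bool" where
  "tree_embedding S T f \<longleftrightarrow>
    emap f \<in> edges S \<rightarrow>\<^sub>E edges T \<and> mmap f \<in> marks S \<rightarrow>\<^sub>E marks T \<and> nmap f \<in> nodes S \<rightarrow>\<^sub>E nodes T \<and>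
    (\<forall>m\<in>marks S. emap f (smap S m) = smap T (mmap f m)) \<and>
    (\<forall>m\<in>marks S. nmap f (pmap S m) = pmap T (mmap f m)) \<and>
    (\<forall>n\<in>nodes S. emap f (tmap S n) = tmap T (nmap f n)) \<and>
    (\<forall>n\<in>nodes S. \<forall>m'\<in>marks T. nmap f n = pmap T m' \<longrightarrow>
      (\<exists>!m. m \<in> marks S \<and> pmap S m = n \<and> mmap f m = m'))"


section \<open>\<open>P\<close>-trees\<close>

text \<open>A polynomial endofunctor is given by its representing diagram \<open>I \<leftarrow> E \<rightarrow> B \<rightarrow> I\<close>.\<close>

record ('i, 'ia, 'e, 'ea, 'b, 'ba) poly =
  gpdI :: "('i, 'ia) gpd"
  gpdE :: "('e, 'ea) gpd"
  gpdB :: "('b, 'ba) gpd"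
  funS :: "('e, 'ea, 'i, 'ia) gfun"
  funP :: "('e, 'ea, 'b, 'ba) gfun"
  funT :: "('b, 'ba, 'i, 'ia) gfun"

definition is_poly :: "('i, 'ia, 'e, 'ea, 'b, 'ba) poly \<Rightarrow> bool" where
  "is_poly P \<longleftrightarrow> groupoid (gpdI P) \<and> groupoid (gpdE P) \<and> groupoid (gpdB P) \<and>
    gfunctor (gpdE P) (gpdI P) (funS P) \<and> gfunctor (gpdE P) (gpdB P) (funP P) \<and>
    gfunctor (gpdB P) (gpdI P) (funT P)"

text \<open>The functors \<open>\<alpha> : A \<rightarrow> I\<close>, \<open>M \<rightarrow> E\<close>, \<open>N \<rightarrow> B\<close> are \<open>ecol\<close>, \<open>mcol\<close>, \<open>ncol\<close>; the specified natural
  isomorphisms of the three squares are \<open>siso\<close>, \<open>piso\<close>, \<open>tiso\<close>.\<close>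

record ('u, 'i, 'ia, 'e, 'b, 'ba) ptree = "'u tree" +
  ecol :: "'u \<Rightarrow> 'i"
  mcol :: "'u \<Rightarrow> 'e"
  ncol :: "'u \<Rightarrow> 'b"
  siso :: "'u \<Rightarrow> 'ia"
  piso :: "'u \<Rightarrow> 'ba"
  tiso :: "'u \<Rightarrow> 'ia"

definition is_ptree :: "('i, 'ia, 'e, 'ea, 'b, 'ba) poly \<Rightarrow> ('u, 'i, 'ia, 'e, 'b, 'ba) ptree \<Rightarrow> bool"
  where
  "is_ptree P T \<longleftrightarrow> is_tree T \<and>
    ecol T \<in> edges T \<rightarrow>\<^sub>E Obj (gpdI P) \<and>
    mcol T \<in> marks T \<rightarrow>\<^sub>E Obj (gpdE P) \<and>
    ncol T \<in> nodes T \<rightarrow>\<^sub>E Obj (gpdB P) \<and>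
    siso T \<in> (\<Pi>\<^sub>E m\<in>marks T. Hom (gpdI P) (ecol T (smap T m)) (omap (funS P) (mcol T m))) \<and>
    piso T \<in> (\<Pi>\<^sub>E m\<in>marks T. Hom (gpdB P) (omap (funP P) (mcol T m)) (ncol T (pmap T m))) \<and>
    tiso T \<in> (\<Pi>\<^sub>E n\<in>nodes T. Hom (gpdI P) (omap (funT P) (ncol T n)) (ecol T (tmap T n))) \<and>
    is_hpullback (disc_gpd (marks T)) (gpdE P) (disc_gpd (nodes T)) (gpdB P)
      (disc_fun (gpdE P) (mcol T)) (disc_fun (disc_gpd (nodes T)) (pmap T))
      (funP P) (disc_fun (gpdB P) (ncol T)) (piso T)"

record ('u, 'ia, 'ea, 'ba) ptree_map = "'u tree_map" +
  eiso :: "'u \<Rightarrow> 'ia"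
  miso :: "'u \<Rightarrow> 'ea"
  niso :: "'u \<Rightarrow> 'ba"

definition ptree_embedding :: "('i, 'ia, 'e, 'ea, 'b, 'ba) poly \<Rightarrow>
    ('u, 'i, 'ia, 'e, 'b, 'ba) ptree \<Rightarrow> ('u, 'i, 'ia, 'e, 'b, 'ba) ptree \<Rightarrow>
    ('u, 'ia, 'ea, 'ba) ptree_map \<Rightarrow> bool" where
  "ptree_embedding P S T f \<longleftrightarrow> tree_embedding S T f \<and>
    eiso f \<in> (\<Pi>\<^sub>E x\<in>edges S. Hom (gpdI P) (ecol S x) (ecol T (emap f x))) \<and>
    miso f \<in> (\<Pi>\<^sub>E m\<in>marks S. Hom (gpdE P) (mcol S m) (mcol T (mmap f m))) \<and>
    niso f \<in> (\<Pi>\<^sub>E n\<in>nodes S. Hom (gpdB P) (ncol S n) (ncol T (nmap f n))) \<and>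
    (\<forall>m\<in>marks S. siso T (mmap f m) \<cdot>\<^bsub>gpdI P\<^esub> eiso f (smap S m)
      = amap (funS P) (miso f m) \<cdot>\<^bsub>gpdI P\<^esub> siso S m) \<and>
    (\<forall>m\<in>marks S. piso T (mmap f m) \<cdot>\<^bsub>gpdB P\<^esub> amap (funP P) (miso f m)
      = niso f (pmap S m) \<cdot>\<^bsub>gpdB P\<^esub> piso S m) \<and>
    (\<forall>n\<in>nodes S. tiso T (nmap f n) \<cdot>\<^bsub>gpdI P\<^esub> amap (funT P) (niso f n)
      = eiso f (tmap S n) \<cdot>\<^bsub>gpdI P\<^esub> tiso S n)"

definition ptree_iso :: "('i, 'ia, 'e, 'ea, 'b, 'ba) poly \<Rightarrow>
    ('u, 'i, 'ia, 'e, 'b, 'ba) ptree \<Rightarrow> ('u, 'i, 'ia, 'e, 'b, 'ba) ptree \<Rightarrow>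
    ('u, 'ia, 'ea, 'ba) ptree_map \<Rightarrow> bool" where
  "ptree_iso P S T f \<longleftrightarrow> ptree_embedding P S T f \<and>
    bij_betw (emap f) (edges S) (edges T) \<and> bij_betw (mmap f) (marks S) (marks T) \<and>
    bij_betw (nmap f) (nodes S) (nodes T)"

definition ptree_id :: "('i, 'ia, 'e, 'ea, 'b, 'ba) poly \<Rightarrow> ('u, 'i, 'ia, 'e, 'b, 'ba) ptree \<Rightarrow>
    ('u, 'ia, 'ea, 'ba) ptree_map" where
  "ptree_id P S =
    \<lparr>emap = (\<lambda>x\<in>edges S. x), mmap = (\<lambda>m\<in>marks S. m), nmap = (\<lambda>n\<in>nodes S. n),
     eiso = (\<lambda>x\<in>edges S. Ident (gpdI P) (ecol S x)),
     miso = (\<lambda>m\<in>marks S. Ident (gpdE P) (mcol S m)),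
     niso = (\<lambda>n\<in>nodes S. Ident (gpdB P) (ncol S n))\<rparr>"

text \<open>The composite \<open>g \<circ> f\<close>, where \<^term>\<open>S\<close> is the source of \<^term>\<open>f\<close>.\<close>

definition ptree_comp :: "('i, 'ia, 'e, 'ea, 'b, 'ba) poly \<Rightarrow> ('u, 'i, 'ia, 'e, 'b, 'ba) ptree \<Rightarrow>
    ('u, 'ia, 'ea, 'ba) ptree_map \<Rightarrow> ('u, 'ia, 'ea, 'ba) ptree_map \<Rightarrow>
    ('u, 'ia, 'ea, 'ba) ptree_map" where
  "ptree_comp P S g f =
    \<lparr>emap = (\<lambda>x\<in>edges S. emap g (emap f x)),
     mmap = (\<lambda>m\<in>marks S. mmap g (mmap f m)),
     nmap = (\<lambda>n\<in>nodes S. nmap g (nmap f n)),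
     eiso = (\<lambda>x\<in>edges S. eiso g (emap f x) \<cdot>\<^bsub>gpdI P\<^esub> eiso f x),
     miso = (\<lambda>m\<in>marks S. miso g (mmap f m) \<cdot>\<^bsub>gpdE P\<^esub> miso f m),
     niso = (\<lambda>n\<in>nodes S. niso g (nmap f n) \<cdot>\<^bsub>gpdB P\<^esub> niso f n)\<rparr>"

type_synonym ('u, 'i, 'ia, 'e, 'ea, 'b, 'ba) ptree_arr =
  "('u, 'i, 'ia, 'e, 'b, 'ba) ptree \<times> ('u, 'i, 'ia, 'e, 'b, 'ba) ptree \<times>
   ('u, 'ia, 'ea, 'ba) ptree_map"

type_synonym ('u, 'i, 'ia, 'e, 'ea, 'b, 'ba) ptree_gpd =
  "(('u, 'i, 'ia, 'e, 'b, 'ba) ptree, ('u, 'i, 'ia, 'e, 'ea, 'b, 'ba) ptree_arr) gpd"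

type_synonym ('u, 'o) tilde_obj = "'u set \<times> ('u \<Rightarrow> 'o)"

type_synonym ('u, 'o, 'a) tilde_arr =
  "('u, 'o) tilde_obj \<times> ('u, 'o) tilde_obj \<times> (('u \<Rightarrow> 'u) \<times> ('u \<Rightarrow> 'a))"

type_synonym ('u, 'i, 'ia, 'e, 'b, 'ba) pforest =
  "('u, ('u, 'i, 'ia, 'e, 'b, 'ba) ptree) tilde_obj"

type_synonym ('u, 'i, 'ia, 'e, 'ea, 'b, 'ba) pforest_arr =
  "('u, ('u, 'i, 'ia, 'e, 'b, 'ba) ptree, ('u, 'i, 'ia, 'e, 'ea, 'b, 'ba) ptree_arr) tilde_arr"

type_synonym ('u, 'i, 'ia, 'e, 'ea, 'b, 'ba) pforest_gpd =
  "(('u, 'i, 'ia, 'e, 'b, 'ba) pforest, ('u, 'i, 'ia, 'e, 'ea, 'b, 'ba) pforest_arr) gpd"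

definition ptrees :: "('i, 'ia, 'e, 'ea, 'b, 'ba) poly \<Rightarrow>
    ('u, 'i, 'ia, 'e, 'ea, 'b, 'ba) ptree_gpd" where
  "ptrees P = hom_gpd {T. is_ptree P T} (\<lambda>S T. {f. ptree_iso P S T f})
    (ptree_id P) (\<lambda>S _ _ g f. ptree_comp P S g f)"

definition pforests :: "('i, 'ia, 'e, 'ea, 'b, 'ba) poly \<Rightarrow>
    ('u, 'i, 'ia, 'e, 'ea, 'b, 'ba) pforest_gpd" where
  "pforests P = tilde (ptrees P)"

definition leaf_fun :: "(('u, 'i, 'ia, 'e, 'b, 'ba) ptree,
    ('u, 'i, 'ia, 'e, 'ea, 'b, 'ba) ptree_arr, ('u, 'i) tilde_obj, ('u, 'i, 'ia) tilde_arr) gfun" where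
  "leaf_fun =
    (let L = (\<lambda>T :: ('u, 'i, 'ia, 'e, 'b, 'ba) ptree. (leaves T, restrict (ecol T) (leaves T)))
     in \<lparr>omap = L,
         amap = (\<lambda>(S, T, f). (L S, L T, (restrict (emap f) (leaves S), restrict (eiso f) (leaves S))))\<rparr>)"

definition root_fun :: "(('u, 'i, 'ia, 'e, 'b, 'ba) pforest,
    ('u, 'i, 'ia, 'e, 'ea, 'b, 'ba) pforest_arr, ('u, 'i) tilde_obj, ('u, 'i, 'ia) tilde_arr) gfun" where
  "root_fun =
    (let R = (\<lambda>(X, Q :: 'u \<Rightarrow> ('u, 'i, 'ia, 'e, 'b, 'ba) ptree). (X, \<lambda>x\<in>X. ecol (Q x) (root (Q x))))
     in \<lparr>omap = R,
         amap = (\<lambda>((X, Q), (X', Q'), (f, \<eta>)). (R (X, Q), R (X', Q'),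
           (f, \<lambda>x\<in>X. (case \<eta> x of (_, _, g) \<Rightarrow> eiso g (root (Q x))))))\<rparr>)"


section \<open>Cuts\<close>

definition rp_embeddings :: "('i, 'ia, 'e, 'ea, 'b, 'ba) poly \<Rightarrow>
    ('u, 'i, 'ia, 'e, 'b, 'ba) ptree \<Rightarrow>
    (('u, 'i, 'ia, 'e, 'b, 'ba) ptree \<times> ('u, 'ia, 'ea, 'ba) ptree_map) set" where
  "rp_embeddings P T =
    {(S, c). is_ptree P S \<and> ptree_embedding P S T c \<and> emap c (root S) = root T}"

definition iso_over :: "('i, 'ia, 'e, 'ea, 'b, 'ba) poly \<Rightarrow>
    ('u, 'i, 'ia, 'e, 'b, 'ba) ptree \<Rightarrow>
    (('u, 'i, 'ia, 'e, 'b, 'ba) ptree \<times> ('u, 'ia, 'ea, 'ba) ptree_map) rel" where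
  "iso_over P T = {((S, c), (S', c')). (S, c) \<in> rp_embeddings P T \<and> (S', c') \<in> rp_embeddings P T \<and>
    (\<exists>g. ptree_iso P S S' g \<and> ptree_comp P S c' g = c)}"

type_synonym ('u, 'i, 'ia, 'e, 'ea, 'b, 'ba) ptree_cut =
  "(('u, 'i, 'ia, 'e, 'b, 'ba) ptree \<times> ('u, 'ia, 'ea, 'ba) ptree_map) set"

definition cuts :: "('i, 'ia, 'e, 'ea, 'b, 'ba) poly \<Rightarrow> ('u, 'i, 'ia, 'e, 'b, 'ba) ptree \<Rightarrow>
    ('u, 'i, 'ia, 'e, 'ea, 'b, 'ba) ptree_cut set" where
  "cuts P T = rp_embeddings P T // iso_over P T"

text \<open>An isomorphism \<open>T \<rightarrow> T'\<close> acts on cuts by postcomposition.\<close>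

definition cut_family :: "('i, 'ia, 'e, 'ea, 'b, 'ba) poly \<Rightarrow>
    (('u, 'i, 'ia, 'e, 'b, 'ba) ptree, ('u, 'i, 'ia, 'e, 'ea, 'b, 'ba) ptree_arr,
     ('u, 'i, 'ia, 'e, 'ea, 'b, 'ba) ptree_cut, ('u, 'i, 'ia, 'e, 'ea, 'b, 'ba) ptree_cut) gpd_family"
  where
  "cut_family P =
    \<lparr>fam = (\<lambda>T. disc_gpd (cuts P T)),
     tra = (\<lambda>(T, T', f). let push = (\<lambda>C. (\<lambda>(S, c). (S, ptree_comp P S f c)) ` C)
                         in \<lparr>omap = push, amap = push\<rparr>)\<rparr>"

definition restrict_ptree :: "('u, 'i, 'ia, 'e, 'b, 'ba) ptree \<Rightarrow> 'u set \<Rightarrow> 'u set \<Rightarrow> 'u set \<Rightarrow>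
    ('u, 'i, 'ia, 'e, 'b, 'ba) ptree" where
  "restrict_ptree T A M N =
    \<lparr>edges = A, marks = M, nodes = N,
     smap = restrict (smap T) M, pmap = restrict (pmap T) M, tmap = restrict (tmap T) N,
     ecol = restrict (ecol T) A, mcol = restrict (mcol T) M, ncol = restrict (ncol T) N,
     siso = restrict (siso T) M, piso = restrict (piso T) M, tiso = restrict (tiso T) N\<rparr>"

definition restrict_ptree_map :: "('u, 'i, 'ia, 'e, 'b, 'ba) ptree \<Rightarrow>
    ('u, 'ia, 'ea, 'ba) ptree_map \<Rightarrow> ('u, 'ia, 'ea, 'ba) ptree_map" where
  "restrict_ptree_map S f =
    \<lparr>emap = restrict (emap f) (edges S), mmap = restrict (mmap f) (marks S),
     nmap = restrict (nmap f) (nodes S), eiso = restrict (eiso f) (edges S),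
     miso = restrict (miso f) (marks S), niso = restrict (niso f) (nodes S)\<rparr>"

text \<open>The subtree \<open>S\<^sub>c\<close> of \<^term>\<open>T\<close>, with the restricted decoration, defined by a cut. All embeddings
  in the isomorphism class \<^term>\<open>C\<close> have the same image, so the unions are the images of any one of
  them; the inclusion of \<open>S\<^sub>c\<close> is the member of \<^term>\<open>C\<close> singled out as representative.\<close>

definition cut_tree :: "('u, 'i, 'ia, 'e, 'b, 'ba) ptree \<Rightarrow>
    ('u, 'i, 'ia, 'e, 'ea, 'b, 'ba) ptree_cut \<Rightarrow> ('u, 'i, 'ia, 'e, 'b, 'ba) ptree" where
  "cut_tree T C = restrict_ptree T
    (\<Union>(S, c)\<in>C. emap c ` edges S) (\<Union>(S, c)\<in>C. mmap c ` marks S) (\<Union>(S, c)\<in>C. nmap c ` nodes S)"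

definition ideal_tree :: "('u, 'i, 'ia, 'e, 'b, 'ba) ptree \<Rightarrow> 'u \<Rightarrow>
    ('u, 'i, 'ia, 'e, 'b, 'ba) ptree" where
  "ideal_tree T l =
    (let A = {x \<in> edges T. \<exists>k. (walk T ^^ k) x = l};
         N = {n \<in> nodes T. tmap T n \<in> A};
         M = {m \<in> marks T. pmap T m \<in> N}
     in restrict_ptree T A M N)"

definition cut_forest :: "('u, 'i, 'ia, 'e, 'b, 'ba) ptree \<Rightarrow>
    ('u, 'i, 'ia, 'e, 'ea, 'b, 'ba) ptree_cut \<Rightarrow> ('u, 'i, 'ia, 'e, 'b, 'ba) pforest" where
  "cut_forest T C = (leaves (cut_tree T C), \<lambda>l\<in>leaves (cut_tree T C). ideal_tree T l)"


section \<open>The structure maps to \<open>F \<times> T\<close>\<close>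

text \<open>On arrows, an isomorphism \<open>T \<rightarrow> T'\<close> taking the cut \<open>C\<close> to \<open>C'\<close> is restricted to the subtrees.\<close>

definition cut_proj :: "(('u, 'i, 'ia, 'e, 'b, 'ba) ptree \<times> ('u, 'i, 'ia, 'e, 'ea, 'b, 'ba) ptree_cut,
    (('u, 'i, 'ia, 'e, 'b, 'ba) ptree \<times> ('u, 'i, 'ia, 'e, 'ea, 'b, 'ba) ptree_cut) \<times>
    (('u, 'i, 'ia, 'e, 'b, 'ba) ptree \<times> ('u, 'i, 'ia, 'e, 'ea, 'b, 'ba) ptree_cut) \<times>
    (('u, 'i, 'ia, 'e, 'ea, 'b, 'ba) ptree_arr \<times> ('u, 'i, 'ia, 'e, 'ea, 'b, 'ba) ptree_cut),
    ('u, 'i, 'ia, 'e, 'b, 'ba) pforest \<times> ('u, 'i, 'ia, 'e, 'b, 'ba) ptree,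
    ('u, 'i, 'ia, 'e, 'ea, 'b, 'ba) pforest_arr \<times> ('u, 'i, 'ia, 'e, 'ea, 'b, 'ba) ptree_arr) gfun" where
  "cut_proj =
    \<lparr>omap = (\<lambda>(T, C). (cut_forest T C, cut_tree T C)),
     amap = (\<lambda>((T, C), (T', C'), ((_, _, f), _)).
       ((cut_forest T C, cut_forest T' C',
         (restrict (emap f) (leaves (cut_tree T C)),
          \<lambda>l\<in>leaves (cut_tree T C).
            (ideal_tree T l, ideal_tree T' (emap f l), restrict_ptree_map (ideal_tree T l) f))),
        (cut_tree T C, cut_tree T' C', restrict_ptree_map (cut_tree T C) f)))\<rparr>"

text \<open>Two forgetful functors, from \<open>\<integral>\<^sup>y\<^sup>\<in>\<^sup>Y X\<^sub>f\<^sub>y\<close> to \<open>X \<times> Y\<close> and from \<open>\<integral>\<^sup>y\<^sup>\<in>\<^sup>Y (X\<^sub>y \<times> W\<^sub>y)\<close> to \<open>X \<times> W\<close>, where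
  subscripts denote homotopy fibres.\<close>

definition fibre_sum_proj :: "('y \<times> ('o \<times> 'b),
    ('y \<times> ('o \<times> 'b)) \<times> ('y \<times> ('o \<times> 'b)) \<times> ('ya \<times> (('o \<times> 'b) \<times> ('o \<times> 'b) \<times> 'a)),
    'o \<times> 'y, 'a \<times> 'ya) gfun" where
  "fibre_sum_proj =
    \<lparr>omap = (\<lambda>(y, (x, \<phi>)). (x, y)),
     amap = (\<lambda>(_, _, (\<sigma>, (_, _, a))). (a, \<sigma>))\<rparr>"

definition fibre_prod_proj :: "('y \<times> (('o \<times> 'b) \<times> ('p \<times> 'b)),
    ('y \<times> (('o \<times> 'b) \<times> ('p \<times> 'b))) \<times> ('y \<times> (('o \<times> 'b) \<times> ('p \<times> 'b))) \<times>
    ('ya \<times> ((('o \<times> 'b) \<times> ('o \<times> 'b) \<times> 'a) \<times> (('p \<times> 'b) \<times> ('p \<times> 'b) \<times> 'c))),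
    'o \<times> 'p, 'a \<times> 'c) gfun" where
  "fibre_prod_proj =
    \<lparr>omap = (\<lambda>(y, ((x, \<phi>), (w, \<psi>))). (x, w)),
     amap = (\<lambda>(_, _, (\<sigma>, ((_, _, a), (_, _, c)))). (a, c))\<rparr>"

end

theory Submission
  imports Defs
begin

text \<open>A cut of \<open>T\<close> is determined by the set of nodes of its subtree \<open>S\<close>, and \<open>T\<close> is the union of \<open>S\<close> and the
  ideal subtrees \<open>T\<^sub>l\<close> at the leaves \<open>l\<close> of \<open>S\<close>, which meet \<open>S\<close> only in \<open>l\<close> and are pairwise disjoint. Hence an
  isomorphism of trees with cuts is the same thing as an isomorphism of the subtrees together with
  isomorphisms of the ideal subtrees that agree with it on the leaves, and every tree \<open>S\<close> with trees on
  its leaves arises by grafting. So \<open>(T, c) \<mapsto> (S\<^sub>c, (P\<^sub>c, id))\<close> is fully faithful and essentially surjective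
  onto the second homotopy sum. The second equivalence, \<open>(S, (Q, \<phi>)) \<mapsto> (L S, (Q, \<phi>), (S, id))\<close>, is formal
  and holds for any cospan of groupoids.\<close>

section \<open>Groupoids\<close>

text \<open>Gluing is literal: an assembled tree is the union of its pieces inside
  \<open>'u\<close>, and the tree on a leaf \<open>l\<close> must have \<open>l\<close> itself as
  root, with equal colour. An object of the second sum only offers trees whose root colours are
  isomorphic to leaf colours and whose elements may collide, so essential surjectivity starts by
  passing to copies. In the other direction, cutting gives roots that are equal to the leaves, hence
  the comparison isomorphism of colours is an identity.

  The global homotopy pullback condition on a decoration does not suit cutting and gluing. As the
  nodes form a discrete groupoid, it is equivalent to a condition at each node about the marks of
  this node alone, and this passes to subtrees, unions and copies. Likewise reachability of the root
  is replaced by a function to the natural numbers that strictly decreases from every input edge of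
  a node to its output edge: such functions restrict to subtrees and combine on unions, whereas
  iterates of \<open>walk\<close> depend on the whole tree.\<close>

definition ginv :: "('o, 'a) gpd \<Rightarrow> 'a \<Rightarrow> 'a" where
  "ginv G a = (SOME b. b \<in> Arr G \<and> Dom G b = Cod G a \<and> Cod G b = Dom G a \<and>
      b \<cdot>\<^bsub>G\<^esub> a = Ident G (Dom G a) \<and> a \<cdot>\<^bsub>G\<^esub> b = Ident G (Cod G a))"

context groupoid
begin

lemma Hom_Obj: "a \<in> Hom G x y \<Longrightarrow> x \<in> Obj G \<and> y \<in> Obj G"
  by (auto simp: Hom_def Dom_in Cod_in)

lemma comp_Hom: "\<lbrakk>a \<in> Hom G x y; b \<in> Hom G y z\<rbrakk> \<Longrightarrow> b \<cdot> a \<in> Hom G x z"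
  by (simp add: Hom_def Comp_in Dom_Comp Cod_Comp)

lemma Ident_Hom: "x \<in> Obj G \<Longrightarrow> Ident G x \<in> Hom G x x"
  by (simp add: Hom_def Ident_in Dom_Ident Cod_Ident)

lemma assoc_Hom: "\<lbrakk>a \<in> Hom G w x; b \<in> Hom G x y; c \<in> Hom G y z\<rbrakk> \<Longrightarrow> (c \<cdot> b) \<cdot> a = c \<cdot> (b \<cdot> a)"
  by (simp add: Hom_def Comp_assoc)

lemma Ident_left: "a \<in> Hom G x y \<Longrightarrow> Ident G y \<cdot> a = a"
  by (auto simp: Hom_def Comp_Ident_left)

lemma Ident_right: "a \<in> Hom G x y \<Longrightarrow> a \<cdot> Ident G x = a"
  by (auto simp: Hom_def Comp_Ident_right)

lemma ginv_props:
  assumes "a \<in> Hom G x y"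
  shows ginv_Hom: "ginv G a \<in> Hom G y x"
    and ginv_left: "ginv G a \<cdot> a = Ident G x"
    and ginv_right: "a \<cdot> ginv G a = Ident G y"
proof -
  have "a \<in> Arr G" "Dom G a = x" "Cod G a = y"
    using assms by (auto simp: Hom_def)
  moreover from this(1) have "\<exists>b. b \<in> Arr G \<and> Dom G b = Cod G a \<and> Cod G b = Dom G a \<and>
      b \<cdot> a = Ident G (Dom G a) \<and> a \<cdot> b = Ident G (Cod G a)"
    using inverse_ex by blast
  from someI_ex[OF this]
  have "ginv G a \<in> Arr G \<and> Dom G (ginv G a) = Cod G a \<and> Cod G (ginv G a) = Dom G a \<and>
      ginv G a \<cdot> a = Ident G (Dom G a) \<and> a \<cdot> ginv G a = Ident G (Cod G a)"
    unfolding ginv_def by simp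
  ultimately show "ginv G a \<in> Hom G y x" "ginv G a \<cdot> a = Ident G x" "a \<cdot> ginv G a = Ident G y"
    by (auto simp: Hom_def)
qed

lemma cancel_left:
  assumes "a \<in> Hom G x y" "b \<in> Hom G x y" "c \<in> Hom G y z" "c \<cdot> a = c \<cdot> b"
  shows "a = b"
proof -
  have "(ginv G c \<cdot> c) \<cdot> a = (ginv G c \<cdot> c) \<cdot> b"
    using assms(4) assoc_Hom[OF assms(1,3) ginv_Hom[OF assms(3)]]
      assoc_Hom[OF assms(2,3) ginv_Hom[OF assms(3)]] by simp
  then show ?thesis
    using assms by (simp add: ginv_left Ident_left)
qed

lemma cancel_right:
  assumes "a \<in> Hom G y z" "b \<in> Hom G y z" "c \<in> Hom G x y" "a \<cdot> c = b \<cdot> c"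
  shows "a = b"
proof -
  have "a \<cdot> (c \<cdot> ginv G c) = b \<cdot> (c \<cdot> ginv G c)"
    using assms(4) assoc_Hom[OF ginv_Hom[OF assms(3)] assms(3) assms(1)]
      assoc_Hom[OF ginv_Hom[OF assms(3)] assms(3) assms(2)] by simp
  then show ?thesis
    using assms by (simp add: ginv_right Ident_right)
qed

lemma ginv_cancel_left':
  assumes "a \<in> Hom G x z" "b \<in> Hom G y z"
  shows "b \<cdot> (ginv G b \<cdot> a) = a"
  using assoc_Hom[OF assms(1) ginv_Hom[OF assms(2)] assms(2)] assms by (simp add: ginv_right Ident_left)

lemma ginv_cancel_right:
  assumes "a \<in> Hom G x y" "b \<in> Hom G y z"
  shows "(b \<cdot> a) \<cdot> ginv G a = b"
  using assoc_Hom[OF ginv_Hom[OF assms(1)] assms] assms by (simp add: ginv_right Ident_right)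

lemma ginv_cancel_right':
  assumes "a \<in> Hom G x y" "b \<in> Hom G x z"
  shows "(b \<cdot> ginv G a) \<cdot> a = b"
  using assoc_Hom[OF assms(1) ginv_Hom[OF assms(1)] assms(2)] assms by (simp add: ginv_left Ident_right)

lemma ginv_unique:
  assumes "a \<in> Hom G x y" "b \<in> Hom G y x" "b \<cdot> a = Ident G x"
  shows "b = ginv G a"
  using assms by (metis cancel_right ginv_Hom ginv_left)

text \<open>Turns a commuting square around. This makes inverse arrows compatible with the fillings
  in homotopy pullbacks and with the decorations of trees.\<close>

lemma ginv_square:
  assumes "a \<in> Hom G w x" "b \<in> Hom G x z" "c \<in> Hom G w y" "d \<in> Hom G y z" "b \<cdot> a = d \<cdot> c"
  shows "c \<cdot> ginv G a = ginv G d \<cdot> b"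
proof (rule cancel_left)
  have "d \<cdot> (c \<cdot> ginv G a) = (b \<cdot> a) \<cdot> ginv G a"
    using assoc_Hom[OF ginv_Hom[OF assms(1)] assms(3,4)] assms(5) by simp
  then show "d \<cdot> (c \<cdot> ginv G a) = d \<cdot> (ginv G d \<cdot> b)"
    by (simp add: ginv_cancel_right[OF assms(1,2)] ginv_cancel_left'[OF assms(2,4)])
  show "c \<cdot> ginv G a \<in> Hom G x y" "ginv G d \<cdot> b \<in> Hom G x y" "d \<in> Hom G y z"
    using assms by (auto intro: comp_Hom ginv_Hom)
qed

text \<open>The horizontal sides are \<open>a\<close>, \<open>a'\<close> and \<open>b\<close>,
  \<open>b'\<close>, the vertical ones \<open>u\<close>, \<open>v\<close>, \<open>w\<close>.
  Composites in homotopy pullbacks and composites of decorated embeddings are compatible by such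
  pastings.\<close>

lemma paste_squares:
  assumes "a \<in> Hom G x y" "a' \<in> Hom G y z" "b \<in> Hom G x' y'" "b' \<in> Hom G y' z'"
    "u \<in> Hom G x x'" "v \<in> Hom G y y'" "w \<in> Hom G z z'"
    "v \<cdot> a = b \<cdot> u" "w \<cdot> a' = b' \<cdot> v"
  shows "w \<cdot> (a' \<cdot> a) = (b' \<cdot> b) \<cdot> u"
  using assoc_Hom[OF assms(1,2,7)] assoc_Hom[OF assms(1,6,4)] assoc_Hom[OF assms(5,3,4)] assms(8,9)
  by simp

end

context gfunctor
begin

lemma amap_Hom: "a \<in> Hom X x y \<Longrightarrow> amap F a \<in> Hom Y (omap F x) (omap F y)"
  using amap_in by (auto simp: Hom_def)

lemma amap_comp_Hom:
  "\<lbrakk>a \<in> Hom X x y; b \<in> Hom X y z\<rbrakk> \<Longrightarrow> amap F (b \<cdot>\<^bsub>X\<^esub> a) = amap F b \<cdot>\<^bsub>Y\<^esub> amap F a"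
  using amap_Comp by (auto simp: Hom_def)

lemma amap_ginv: "a \<in> Hom X x y \<Longrightarrow> amap F (ginv X a) = ginv Y (amap F a)"
  using amap_comp_Hom[of a x y "ginv X a" x] X.Hom_Obj[of a x y]
  by (intro Y.ginv_unique[OF amap_Hom amap_Hom])
    (auto simp: X.ginv_Hom X.ginv_left amap_Ident)

end

lemma gfunctorI:
  assumes "groupoid X" "groupoid Y"
    and "\<And>x. x \<in> Obj X \<Longrightarrow> omap F x \<in> Obj Y"
    and "\<And>a x y. a \<in> Hom X x y \<Longrightarrow> amap F a \<in> Hom Y (omap F x) (omap F y)"
    and "\<And>x. x \<in> Obj X \<Longrightarrow> amap F (Ident X x) = Ident Y (omap F x)"
    and "\<And>a b x y z. \<lbrakk>a \<in> Hom X x y; b \<in> Hom X y z\<rbrakk> \<Longrightarrow> amap F (b \<cdot>\<^bsub>X\<^esub> a) = amap F b \<cdot>\<^bsub>Y\<^esub> amap F a"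
  shows "gfunctor X Y F"
proof -
  interpret X: groupoid X by fact
  interpret Y: groupoid Y by fact
  show ?thesis
    by unfold_locales (use assms(3-) in \<open>auto simp: Hom_def\<close>)
qed

lemma gfunctor_gid: "groupoid X \<Longrightarrow> gfunctor X X gid"
  by (rule gfunctorI) (auto simp: gid_def)

lemma gfunctor_gcomp:
  assumes "gfunctor X Y F" "gfunctor Y Z G"
  shows "gfunctor X Z (G \<circ>\<circ> F)"
proof -
  interpret F: gfunctor X Y F by fact
  interpret G: gfunctor Y Z G by fact
  show ?thesis
    by (rule gfunctorI)
      (auto simp: gcomp_def F.X.groupoid_axioms G.Y.groupoid_axioms F.omap_in G.omap_in
        F.amap_Ident G.amap_Ident F.amap_comp_Hom intro: F.amap_Hom G.amap_Hom G.amap_comp_Hom)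
qed

lemma nat_isoI:
  assumes "gfunctor X Y F" "gfunctor X Y G"
    "\<And>x. x \<in> Obj X \<Longrightarrow> \<eta> x \<in> Hom Y (omap F x) (omap G x)"
    "\<And>a x y. a \<in> Hom X x y \<Longrightarrow> amap G a \<cdot>\<^bsub>Y\<^esub> \<eta> x = \<eta> y \<cdot>\<^bsub>Y\<^esub> amap F a"
  shows "nat_iso X Y F G \<eta>"
  using assms by (auto simp: nat_iso_def Hom_def)

lemma nat_isoD:
  assumes "nat_iso X Y F G \<eta>"
  shows "x \<in> Obj X \<Longrightarrow> \<eta> x \<in> Hom Y (omap F x) (omap G x)"
    "a \<in> Hom X x y \<Longrightarrow> amap G a \<cdot>\<^bsub>Y\<^esub> \<eta> x = \<eta> y \<cdot>\<^bsub>Y\<^esub> amap F a"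
  using assms by (auto simp: nat_iso_def Hom_def)

text \<open>The quasi-inverse picks for every \<open>y\<close> an object \<open>g y\<close> and an
  isomorphism \<open>e y\<close> from its image to \<open>y\<close>, and sends an arrow to the
  unique lift of its conjugate by these isomorphisms. Its laws are checked after applying
  \<open>F\<close>, which is faithful.\<close>

lemma gequivalenceI:
  assumes "gfunctor X Y F"
    and ff: "\<And>x x' b. \<lbrakk>x \<in> Obj X; x' \<in> Obj X; b \<in> Hom Y (omap F x) (omap F x')\<rbrakk>
      \<Longrightarrow> \<exists>!a. a \<in> Hom X x x' \<and> amap F a = b"
    and es: "\<And>y. y \<in> Obj Y \<Longrightarrow> \<exists>x\<in>Obj X. \<exists>b. b \<in> Hom Y (omap F x) y"
  shows "gequivalence X Y F"
proof -
  interpret F: gfunctor X Y F by fact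
  have "\<forall>y\<in>Obj Y. \<exists>p. fst p \<in> Obj X \<and> snd p \<in> Hom Y (omap F (fst p)) y"
    using es by (metis fst_conv snd_conv)
  then obtain p where p: "\<And>y. y \<in> Obj Y \<Longrightarrow> fst (p y) \<in> Obj X \<and> snd (p y) \<in> Hom Y (omap F (fst (p y))) y"
    by metis
  define g where "g = fst \<circ> p"
  define e where "e = snd \<circ> p"
  have g: "g y \<in> Obj X" and e: "e y \<in> Hom Y (omap F (g y)) y" if "y \<in> Obj Y" for y
    using p[OF that] by (auto simp: g_def e_def)
  define l where "l x x' b = (THE a. a \<in> Hom X x x' \<and> amap F a = b)" for x x' b
  have l: "l x x' b \<in> Hom X x x'" "amap F (l x x' b) = b"
    if "x \<in> Obj X" "x' \<in> Obj X" "b \<in> Hom Y (omap F x) (omap F x')" for x x' b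
    using theI'[OF ff[OF that]] by (auto simp: l_def)
  have faithful: "a = b" if "a \<in> Hom X x x'" "b \<in> Hom X x x'" "amap F a = amap F b" for a b x x'
    using ff[of x x' "amap F b"] that F.amap_Hom[of b x x'] F.X.Hom_Obj[of b x x'] by blast
  define G where "G = \<lparr>omap = g,
    amap = (\<lambda>b. l (g (Dom Y b)) (g (Cod Y b)) (ginv Y (e (Cod Y b)) \<cdot>\<^bsub>Y\<^esub> (b \<cdot>\<^bsub>Y\<^esub> e (Dom Y b))))\<rparr>"
  have Gmap: "ginv Y (e y') \<cdot>\<^bsub>Y\<^esub> (b \<cdot>\<^bsub>Y\<^esub> e y) \<in> Hom Y (omap F (g y)) (omap F (g y'))"
    if "b \<in> Hom Y y y'" for b y y'
    using that F.Y.Hom_Obj[OF that] e[of y] e[of y'] by (auto intro: F.Y.comp_Hom F.Y.ginv_Hom)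
  have G1: "amap G b \<in> Hom X (g y) (g y')"
      and G2: "amap F (amap G b) = ginv Y (e y') \<cdot>\<^bsub>Y\<^esub> (b \<cdot>\<^bsub>Y\<^esub> e y)"
    if "b \<in> Hom Y y y'" for b y y'
  proof -
    have "amap G b = l (g y) (g y') (ginv Y (e y') \<cdot>\<^bsub>Y\<^esub> (b \<cdot>\<^bsub>Y\<^esub> e y))"
      using that by (auto simp: G_def Hom_def)
    then show "amap G b \<in> Hom X (g y) (g y')" "amap F (amap G b) = ginv Y (e y') \<cdot>\<^bsub>Y\<^esub> (b \<cdot>\<^bsub>Y\<^esub> e y)"
      using l Gmap[OF that] g F.Y.Hom_Obj[OF that] by auto
  qed
  have G3: "e y' \<cdot>\<^bsub>Y\<^esub> amap F (amap G b) = b \<cdot>\<^bsub>Y\<^esub> e y" if "b \<in> Hom Y y y'" for b y y'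
    unfolding G2[OF that]
    using that F.Y.Hom_Obj[OF that] e[of y] e[of y'] by (meson F.Y.comp_Hom F.Y.ginv_cancel_left')
  have oG: "omap G = g"
    by (simp add: G_def)
  have G: "gfunctor Y X G"
  proof (rule gfunctorI)
    show "amap G (Ident Y y) = Ident X (omap G y)" if "y \<in> Obj Y" for y
    proof (rule faithful)
      show "amap G (Ident Y y) \<in> Hom X (g y) (g y)" "Ident X (omap G y) \<in> Hom X (g y) (g y)"
        using G1 g oG that by (auto intro: F.Y.Ident_Hom F.X.Ident_Hom)
      show "amap F (amap G (Ident Y y)) = amap F (Ident X (omap G y))"
        using that e[OF that] g[OF that] G2[OF F.Y.Ident_Hom[OF that]] oG
        by (simp add: F.amap_Ident F.Y.Ident_left F.Y.ginv_left)
    qed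
    show "amap G (b' \<cdot>\<^bsub>Y\<^esub> b) = amap G b' \<cdot>\<^bsub>X\<^esub> amap G b"
      if b: "b \<in> Hom Y x y" "b' \<in> Hom Y y z" for b b' x y z
    proof (rule faithful)
      have o: "x \<in> Obj Y" "y \<in> Obj Y" "z \<in> Obj Y"
        using b F.Y.Hom_Obj by blast+
      show 1: "amap G (b' \<cdot>\<^bsub>Y\<^esub> b) \<in> Hom X (g x) (g z)"
        using b G1 by (metis F.Y.comp_Hom)
      show 2: "amap G b' \<cdot>\<^bsub>X\<^esub> amap G b \<in> Hom X (g x) (g z)"
        using b G1 by (metis F.X.comp_Hom)
      note h = F.amap_Hom[OF G1[OF b(1)]] F.amap_Hom[OF G1[OF b(2)]]
      have "e z \<cdot>\<^bsub>Y\<^esub> amap F (amap G b' \<cdot>\<^bsub>X\<^esub> amap G b) = e z \<cdot>\<^bsub>Y\<^esub> (amap F (amap G b') \<cdot>\<^bsub>Y\<^esub> amap F (amap G b))"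
        using F.amap_comp_Hom G1 b by metis
      also have "\<dots> = (b' \<cdot>\<^bsub>Y\<^esub> b) \<cdot>\<^bsub>Y\<^esub> e x"
        by (rule F.Y.paste_squares[OF h b e e e]) (simp_all add: o G3[OF b(1)] G3[OF b(2)])
      also have "\<dots> = e z \<cdot>\<^bsub>Y\<^esub> amap F (amap G (b' \<cdot>\<^bsub>Y\<^esub> b))"
        using G3 b by (metis F.Y.comp_Hom)
      finally show "amap F (amap G (b' \<cdot>\<^bsub>Y\<^esub> b)) = amap F (amap G b' \<cdot>\<^bsub>X\<^esub> amap G b)"
        using F.Y.cancel_left[OF F.amap_Hom[OF 1] F.amap_Hom[OF 2] e[OF o(3)]] by simp
    qed
  qed (use g G1 oG in \<open>auto simp: F.X.groupoid_axioms F.Y.groupoid_axioms\<close>)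
  have eps: "nat_iso Y Y (F \<circ>\<circ> G) gid e"
    by (rule nat_isoI[OF gfunctor_gcomp[OF G assms(1)] gfunctor_gid[OF F.Y.groupoid_axioms]])
      (use e G3 in \<open>auto simp: gcomp_def gid_def oG\<close>)
  \<comment> \<open>The second natural isomorphism is no new choice: it is the lift of
    \<open>e\<close> along \<open>F\<close>, so that its naturality reduces to \<open>G3\<close>,
    the naturality of \<open>e\<close>.\<close>
  define h where "h x = l (g (omap F x)) x (e (omap F x))" for x
  have h: "h x \<in> Hom X (g (omap F x)) x" "amap F (h x) = e (omap F x)" if "x \<in> Obj X" for x
    using l[of "g (omap F x)" x] that F.omap_in[OF that] g e by (auto simp: h_def)
  have eta: "nat_iso X X (G \<circ>\<circ> F) gid h"
  proof (rule nat_isoI[OF gfunctor_gcomp[OF assms(1) G] gfunctor_gid[OF F.X.groupoid_axioms]])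
    fix a x y assume a: "a \<in> Hom X x y"
    then have o: "x \<in> Obj X" "y \<in> Obj X"
      using F.X.Hom_Obj by auto
    have b: "amap F a \<in> Hom Y (omap F x) (omap F y)"
      using a F.amap_Hom by blast
    show "amap gid a \<cdot>\<^bsub>X\<^esub> h x = h y \<cdot>\<^bsub>X\<^esub> amap (G \<circ>\<circ> F) a"
    proof (rule faithful)
      show "amap gid a \<cdot>\<^bsub>X\<^esub> h x \<in> Hom X (g (omap F x)) y"
        using F.X.comp_Hom[OF h(1)[OF o(1)] a] by (simp add: gid_def)
      show "h y \<cdot>\<^bsub>X\<^esub> amap (G \<circ>\<circ> F) a \<in> Hom X (g (omap F x)) y"
        using F.X.comp_Hom[OF G1[OF b] h(1)[OF o(2)]] by (simp add: gcomp_def)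
      show "amap F (amap gid a \<cdot>\<^bsub>X\<^esub> h x) = amap F (h y \<cdot>\<^bsub>X\<^esub> amap (G \<circ>\<circ> F) a)"
        using F.amap_comp_Hom[OF G1[OF b] h(1)[OF o(2)]] F.amap_comp_Hom[OF h(1)[OF o(1)] a]
          G3[OF b] h(2) o by (simp add: gid_def gcomp_def)
    qed
  qed (use h in \<open>auto simp: gcomp_def gid_def oG\<close>)
  show ?thesis
    unfolding gequivalence_def using assms(1) G eps eta by blast
qed

text \<open>Naturality of \<open>\<epsilon>\<close> shows that \<open>G\<close> is faithful.
  Conjugating \<open>amap G b\<close> by \<open>\<eta>\<close> gives an arrow \<open>a\<close> for
  which \<open>amap F a\<close> and \<open>b\<close> have the same image under \<open>G\<close>,
  hence coincide.\<close>

lemma gequivalenceD: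
  assumes "gequivalence X Y F"
  shows gequivalence_full: "\<lbrakk>x \<in> Obj X; x' \<in> Obj X; b \<in> Hom Y (omap F x) (omap F x')\<rbrakk>
      \<Longrightarrow> \<exists>a. a \<in> Hom X x x' \<and> amap F a = b"
    and gequivalence_ess_surj: "y \<in> Obj Y \<Longrightarrow> \<exists>x\<in>Obj X. \<exists>b. b \<in> Hom Y (omap F x) y"
proof -
  obtain G \<eta> \<epsilon> where F: "gfunctor X Y F" and G: "gfunctor Y X G"
    and \<eta>: "nat_iso X X (G \<circ>\<circ> F) gid \<eta>" and \<epsilon>: "nat_iso Y Y (F \<circ>\<circ> G) gid \<epsilon>"
    using assms unfolding gequivalence_def by blast
  interpret F: gfunctor X Y F by fact
  interpret G: gfunctor Y X G by fact
  have hX: "\<eta> x \<in> Hom X (omap G (omap F x)) x" if "x \<in> Obj X" for x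
    using nat_isoD(1)[OF \<eta> that] by (simp add: gcomp_def gid_def)
  have nX: "a \<cdot>\<^bsub>X\<^esub> \<eta> x = \<eta> y \<cdot>\<^bsub>X\<^esub> amap G (amap F a)" if "a \<in> Hom X x y" for a x y
    using nat_isoD(2)[OF \<eta> that] by (simp add: gcomp_def gid_def)
  have hY: "\<epsilon> y \<in> Hom Y (omap F (omap G y)) y" if "y \<in> Obj Y" for y
    using nat_isoD(1)[OF \<epsilon> that] by (simp add: gcomp_def gid_def)
  have nY: "b \<cdot>\<^bsub>Y\<^esub> \<epsilon> x = \<epsilon> y \<cdot>\<^bsub>Y\<^esub> amap F (amap G b)" if "b \<in> Hom Y x y" for b x y
    using nat_isoD(2)[OF \<epsilon> that] by (simp add: gcomp_def gid_def)
  show "\<exists>x\<in>Obj X. \<exists>b. b \<in> Hom Y (omap F x) y" if "y \<in> Obj Y"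
    using that hY G.omap_in by blast
  have G_faithful: "b = b'" if "b \<in> Hom Y x y" "b' \<in> Hom Y x y" "amap G b = amap G b'" for b b' x y
    using that nY by (metis F.Y.cancel_right F.Y.Hom_Obj hY)
  show "\<exists>a. a \<in> Hom X x x' \<and> amap F a = b" if x: "x \<in> Obj X" "x' \<in> Obj X" and b: "b \<in> Hom Y (omap F x) (omap F x')"
  proof -
    let ?a = "(\<eta> x' \<cdot>\<^bsub>X\<^esub> amap G b) \<cdot>\<^bsub>X\<^esub> ginv X (\<eta> x)"
    have Gb: "amap G b \<in> Hom X (omap G (omap F x)) (omap G (omap F x'))"
      using b G.amap_Hom by blast
    have c: "\<eta> x' \<cdot>\<^bsub>X\<^esub> amap G b \<in> Hom X (omap G (omap F x)) x'"
      using F.X.comp_Hom Gb hX x by blast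
    have a: "?a \<in> Hom X x x'"
      using F.X.comp_Hom F.X.ginv_Hom c hX x by blast
    then have "\<eta> x' \<cdot>\<^bsub>X\<^esub> amap G (amap F ?a) = ?a \<cdot>\<^bsub>X\<^esub> \<eta> x"
      using nX by simp
    also have "\<dots> = \<eta> x' \<cdot>\<^bsub>X\<^esub> amap G b"
      using F.X.ginv_cancel_right' c hX x by blast
    finally have "amap G (amap F ?a) = amap G b"
      using F.X.cancel_left Gb F.amap_Hom G.amap_Hom a hX x by meson
    then have "amap F ?a = b"
      using G_faithful F.amap_Hom a b by blast
    then show ?thesis using a by blast
  qed
qed

section \<open>Constructions on groupoids\<close>

lemma Hom_hom_gpd:
  "Hom (hom_gpd Ob hm idn cmp) x y = (if x \<in> Ob \<and> y \<in> Ob then (\<lambda>h. (x, y, h)) ` hm x y else {})"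
  by (auto simp: Hom_def hom_gpd_def)

lemma hom_gpd_simps:
  "Obj (hom_gpd Ob hm idn cmp) = Ob"
  "Ident (hom_gpd Ob hm idn cmp) x = (x, x, idn x)"
  "(y', z, g) \<cdot>\<^bsub>hom_gpd Ob hm idn cmp\<^esub> (x, y, f) = (x, z, cmp x y z g f)"
  by (auto simp: hom_gpd_def)

text \<open>Sources and targets are stored in the triples, so their bookkeeping is automatic and
  only the laws inside the hom-sets remain to be verified for each construction.\<close>

lemma groupoid_hom_gpd:
  assumes "\<And>x. x \<in> Ob \<Longrightarrow> idn x \<in> hm x x"
    "\<And>x y z f g. \<lbrakk>x \<in> Ob; y \<in> Ob; z \<in> Ob; f \<in> hm x y; g \<in> hm y z\<rbrakk> \<Longrightarrow> cmp x y z g f \<in> hm x z"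
    "\<And>x y z w f g h. \<lbrakk>x \<in> Ob; y \<in> Ob; z \<in> Ob; w \<in> Ob; f \<in> hm x y; g \<in> hm y z; h \<in> hm z w\<rbrakk>
      \<Longrightarrow> cmp x y w (cmp y z w h g) f = cmp x z w h (cmp x y z g f)"
    "\<And>x y f. \<lbrakk>x \<in> Ob; y \<in> Ob; f \<in> hm x y\<rbrakk> \<Longrightarrow> cmp x x y f (idn x) = f"
    "\<And>x y f. \<lbrakk>x \<in> Ob; y \<in> Ob; f \<in> hm x y\<rbrakk> \<Longrightarrow> cmp x y y (idn y) f = f"
    "\<And>x y f. \<lbrakk>x \<in> Ob; y \<in> Ob; f \<in> hm x y\<rbrakk> \<Longrightarrow>
      \<exists>g\<in>hm y x. cmp x y x g f = idn x \<and> cmp y x y f g = idn y"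
  shows "groupoid (hom_gpd Ob hm idn cmp)"
proof (unfold_locales, goal_cases)
  case (12 a)
  then obtain x y f where a: "a = (x, y, f)" "x \<in> Ob" "y \<in> Ob" "f \<in> hm x y"
    by (auto simp: hom_gpd_def)
  from assms(6)[OF a(2-)] obtain g where
    "g \<in> hm y x" "cmp x y x g f = idn x" "cmp y x y f g = idn y" by blast
  with a show ?case
    by (intro bexI[of _ "(y, x, g)"]) (auto simp: hom_gpd_def)
qed (use assms(1-5) in \<open>auto simp: hom_gpd_def\<close>)

lemma groupoid_disc: "groupoid (disc_gpd X)"
  by unfold_locales (auto simp: disc_gpd_def)

lemma Hom_disc: "Hom (disc_gpd X) x y = {z. z = x \<and> z = y \<and> z \<in> X}"
  by (auto simp: Hom_def disc_gpd_def)

lemma gfunctor_disc_fun: "\<lbrakk>groupoid Y; \<And>x. x \<in> X \<Longrightarrow> f x \<in> Obj Y\<rbrakk> \<Longrightarrow> gfunctor (disc_gpd X) Y (disc_fun Y f)"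
  by (rule gfunctorI)
    (auto simp: groupoid_disc Hom_disc disc_fun_def groupoid.Ident_Hom[of Y] groupoid.Ident_left[of Y, OF _ groupoid.Ident_Hom[of Y]],
     auto simp: disc_gpd_def groupoid.Ident_left[of Y, OF _ groupoid.Ident_Hom[of Y]])

lemma Hom_prod: "Hom (X \<times>\<^sub>G Y) p q = Hom X (fst p) (fst q) \<times> Hom Y (snd p) (snd q)"
  by (auto simp: Hom_def prod_gpd_def)

lemma prod_gpd_simps:
  "Obj (X \<times>\<^sub>G Y) = Obj X \<times> Obj Y"
  "Ident (X \<times>\<^sub>G Y) p = (Ident X (fst p), Ident Y (snd p))"
  "b \<cdot>\<^bsub>X \<times>\<^sub>G Y\<^esub> a = (fst b \<cdot>\<^bsub>X\<^esub> fst a, snd b \<cdot>\<^bsub>Y\<^esub> snd a)"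
  by (auto simp: prod_gpd_def map_prod_def split: prod.split)

lemma groupoid_prod:
  assumes "groupoid X" "groupoid Y"
  shows "groupoid (X \<times>\<^sub>G Y)"
proof -
  interpret X: groupoid X by fact
  interpret Y: groupoid Y by fact
  show ?thesis
  proof (unfold_locales, goal_cases)
    case (12 a)
    then obtain b c where b: "b \<in> Arr X \<and> Dom X b = Cod X (fst a) \<and> Cod X b = Dom X (fst a) \<and>
        b \<cdot>\<^bsub>X\<^esub> fst a = Ident X (Dom X (fst a)) \<and> fst a \<cdot>\<^bsub>X\<^esub> b = Ident X (Cod X (fst a))"
      and c: "c \<in> Arr Y \<and> Dom Y c = Cod Y (snd a) \<and> Cod Y c = Dom Y (snd a) \<and>
        c \<cdot>\<^bsub>Y\<^esub> snd a = Ident Y (Dom Y (snd a)) \<and> snd a \<cdot>\<^bsub>Y\<^esub> c = Ident Y (Cod Y (snd a))"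
      using X.inverse_ex[of "fst a"] Y.inverse_ex[of "snd a"] by (auto simp: prod_gpd_def)
    then show ?case
      by (intro bexI[of _ "(b, c)"]) (auto simp: prod_gpd_def split: prod.split)
  qed (auto simp: prod_gpd_def X.Dom_in Y.Dom_in X.Cod_in Y.Cod_in X.Ident_in Y.Ident_in X.Dom_Ident
    Y.Dom_Ident X.Cod_Ident Y.Cod_Ident X.Comp_in Y.Comp_in X.Dom_Comp Y.Dom_Comp X.Cod_Comp
    Y.Cod_Comp X.Comp_assoc Y.Comp_assoc X.Comp_Ident_left Y.Comp_Ident_left X.Comp_Ident_right
    Y.Comp_Ident_right)
qed

lemma groupoid_tilde:
  assumes "groupoid G"
  shows "groupoid (tilde G)"
proof -
  interpret groupoid G by fact
  show ?thesis
    unfolding tilde_def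
  proof (rule groupoid_hom_gpd, goal_cases)
    case (1 x)
    then show ?case
      by (auto simp: PiE_iff Ident_Hom bij_betw_def inj_on_def)
  next
    case (2 x y z f g)
    obtain X N Y M Z L where [simp]: "x = (X, N)" "y = (Y, M)" "z = (Z, L)" by (metis surj_pair)
    obtain b \<eta> c \<theta> where [simp]: "f = (b, \<eta>)" "g = (c, \<theta>)" by (metis surj_pair)
    have "bij_betw (c \<circ> b) X Z"
      using 2 bij_betw_trans by auto
    then have "bij_betw (\<lambda>x\<in>X. c (b x)) X Z"
      by (rule bij_betw_cong[THEN iffD1, rotated]) auto
    then show ?case
      using 2 by (auto simp: PiE_iff intro!: comp_Hom)
  next
    case (3 x y z w f g h)
    obtain X N Y M Z L W K where [simp]: "x = (X, N)" "y = (Y, M)" "z = (Z, L)" "w = (W, K)"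
      by (metis surj_pair)
    obtain b \<eta> c \<theta> d \<kappa> where [simp]: "f = (b, \<eta>)" "g = (c, \<theta>)" "h = (d, \<kappa>)" by (metis surj_pair)
    show ?case
      using 3 by (auto simp: PiE_iff fun_eq_iff restrict_def intro!: assoc_Hom)
  next
    case (4 x y f)
    obtain X N Y M where [simp]: "x = (X, N)" "y = (Y, M)" by (metis surj_pair)
    obtain b \<eta> where [simp]: "f = (b, \<eta>)" by (metis surj_pair)
    show ?case
      using 4 by (auto simp: PiE_iff fun_eq_iff restrict_def extensional_def intro!: Ident_right)
  next
    case (5 x y f)
    obtain X N Y M where [simp]: "x = (X, N)" "y = (Y, M)" by (metis surj_pair)
    obtain b \<eta> where [simp]: "f = (b, \<eta>)" by (metis surj_pair)
    show ?case
      using 5 by (auto simp: PiE_iff fun_eq_iff restrict_def extensional_def intro!: Ident_left)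
  next
    case (6 x y f)
    obtain X N Y M where [simp]: "x = (X, N)" "y = (Y, M)" by (metis surj_pair)
    obtain b \<eta> where [simp]: "f = (b, \<eta>)" by (metis surj_pair)
    have b: "bij_betw b X Y" and \<eta>: "\<And>x. x \<in> X \<Longrightarrow> \<eta> x \<in> Hom G (N x) (M (b x))" "b \<in> extensional X"
      using 6 by (auto simp: PiE_iff)
    define c where "c = (\<lambda>y\<in>Y. the_inv_into X b y)"
    have c: "c y \<in> X" "b (c y) = y" if "y \<in> Y" for y
      using that b by (auto simp: c_def bij_betw_def f_the_inv_into_f intro: the_inv_into_into)
    have c': "c (b x) = x" "b x \<in> Y" if "x \<in> X" for x
      using that b by (auto simp: c_def bij_betw_def the_inv_into_f_f)
    have "bij_betw c Y X"
      by (rule bij_betwI[where g = b]) (use c c' in auto)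
    moreover have "c \<in> Y \<rightarrow>\<^sub>E X"
      using c by (auto simp: c_def)
    moreover have "ginv G (\<eta> (c y)) \<in> Hom G (M y) (N (c y))" if "y \<in> Y" for y
      using ginv_Hom[OF \<eta>(1)[OF c(1)[OF that]]] c(2)[OF that] by simp
    moreover have "\<eta> (c y) \<cdot>\<^bsub>G\<^esub> ginv G (\<eta> (c y)) = Ident G (M y)" if "y \<in> Y" for y
      using ginv_right[OF \<eta>(1)[OF c(1)[OF that]]] c(2)[OF that] by simp
    moreover have "ginv G (\<eta> x) \<cdot>\<^bsub>G\<^esub> \<eta> x = Ident G (N x)" if "x \<in> X" for x
      using ginv_left[OF \<eta>(1)[OF that]] .
    ultimately show ?case
      using c c' by (intro bexI[of _ "(c, \<lambda>y\<in>Y. ginv G (\<eta> (c y)))"]) (simp_all cong: restrict_cong)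
  qed
qed

context gfunctor
begin

lemma Obj_hfibre: "Obj (hfibre X Y F y) = {(x, \<phi>). x \<in> Obj X \<and> \<phi> \<in> Hom Y (omap F x) y}"
  by (simp add: hfibre_def hom_gpd_simps)

lemma Hom_hfibre: "Hom (hfibre X Y F y) (x, \<phi>) (x', \<phi>') =
  {((x, \<phi>), (x', \<phi>'), a) | a. a \<in> Hom X x x' \<and> \<phi> \<in> Hom Y (omap F x) y \<and> \<phi>' \<in> Hom Y (omap F x') y \<and>
    \<phi>' \<cdot>\<^bsub>Y\<^esub> amap F a = \<phi>}"
  using X.Hom_Obj by (auto simp: hfibre_def Hom_hom_gpd)

lemma Ident_hfibre: "Ident (hfibre X Y F y) (x, \<phi>) = ((x, \<phi>), (x, \<phi>), Ident X x)"
  by (simp add: hfibre_def hom_gpd_simps)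

lemma Comp_hfibre: "(v, w, b) \<cdot>\<^bsub>hfibre X Y F y\<^esub> (u, v', a) = (u, w, b \<cdot>\<^bsub>X\<^esub> a)"
  by (simp add: hfibre_def hom_gpd_simps)

lemma groupoid_hfibre: "groupoid (hfibre X Y F y)"
  unfolding hfibre_def
proof (rule groupoid_hom_gpd, goal_cases)
  case (1 x)
  then show ?case
    by (auto simp: X.Ident_Hom amap_Ident Y.Ident_right)
next
  case (2 x y z f g)
  then show ?case
    using Y.assoc_Hom by (auto simp: amap_comp_Hom Y.assoc_Hom[symmetric, OF amap_Hom amap_Hom] intro: X.comp_Hom)
next
  case (6 x y f)
  then obtain x1 \<phi> y1 \<psi> where [simp]: "x = (x1, \<phi>)" "y = (y1, \<psi>)" by (metis surj_pair)
  show ?case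
    using 6 by (intro bexI[of _ "ginv X f"])
      (auto simp: X.ginv_left X.ginv_right X.ginv_Hom amap_ginv Y.ginv_cancel_right[OF amap_Hom])
qed (auto simp: X.assoc_Hom X.Ident_left X.Ident_right)

end

text \<open>A strict functor from \<open>Y\<close> to groupoids. The functoriality laws are imposed
  on objects and arrows of the fibres only, because functors that agree there may still differ as
  records of total functions.\<close>

definition is_family :: "('y, 'ya) gpd \<Rightarrow> ('y, 'ya, 'o, 'a) gpd_family \<Rightarrow> bool" where
  "is_family Y F \<longleftrightarrow> groupoid Y \<and>
    (\<forall>y\<in>Obj Y. groupoid (fam F y)) \<and>
    (\<forall>y y'. \<forall>\<sigma>\<in>Hom Y y y'. gfunctor (fam F y) (fam F y') (tra F \<sigma>)) \<and>
    (\<forall>y\<in>Obj Y. (\<forall>x\<in>Obj (fam F y). omap (tra F (Ident Y y)) x = x) \<and>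
      (\<forall>x x'. \<forall>a\<in>Hom (fam F y) x x'. amap (tra F (Ident Y y)) a = a)) \<and>
    (\<forall>y y' y''. \<forall>\<sigma>\<in>Hom Y y y'. \<forall>\<tau>\<in>Hom Y y' y''.
      (\<forall>x\<in>Obj (fam F y). omap (tra F (\<tau> \<cdot>\<^bsub>Y\<^esub> \<sigma>)) x = omap (tra F \<tau>) (omap (tra F \<sigma>) x)) \<and>
      (\<forall>x x'. \<forall>a\<in>Hom (fam F y) x x'. amap (tra F (\<tau> \<cdot>\<^bsub>Y\<^esub> \<sigma>)) a = amap (tra F \<tau>) (amap (tra F \<sigma>) a)))"

lemma groupoid_hsum:
  assumes "is_family Y F"
  shows "groupoid (hsum Y F)"
proof -
  interpret Y: groupoid Y using assms by (simp add: is_family_def)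
  have gp: "groupoid (fam F y)" if "y \<in> Obj Y" for y
    using assms that by (simp add: is_family_def)
  have tr: "gfunctor (fam F y) (fam F y') (tra F \<sigma>)" if "\<sigma> \<in> Hom Y y y'" for y y' \<sigma>
    using assms that unfolding is_family_def by blast
  have tid: "omap (tra F (Ident Y y)) x = x" if "y \<in> Obj Y" "x \<in> Obj (fam F y)" for x y
    using assms that unfolding is_family_def by blast
  have tid': "amap (tra F (Ident Y y)) a = a" if "y \<in> Obj Y" "a \<in> Hom (fam F y) x x'" for a x x' y
    using assms that unfolding is_family_def by blast
  have tc: "omap (tra F (\<tau> \<cdot>\<^bsub>Y\<^esub> \<sigma>)) x = omap (tra F \<tau>) (omap (tra F \<sigma>) x)"
    if "\<sigma> \<in> Hom Y y y'" "\<tau> \<in> Hom Y y' y''" "x \<in> Obj (fam F y)" for \<sigma> \<tau> x y y' y''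
    using assms that unfolding is_family_def by blast
  have tc': "amap (tra F (\<tau> \<cdot>\<^bsub>Y\<^esub> \<sigma>)) a = amap (tra F \<tau>) (amap (tra F \<sigma>) a)"
    if "\<sigma> \<in> Hom Y y y'" "\<tau> \<in> Hom Y y' y''" "a \<in> Hom (fam F y) x x'" for \<sigma> \<tau> a x x' y y' y''
    using assms that unfolding is_family_def by blast
  show ?thesis
    unfolding hsum_def
  proof (rule groupoid_hom_gpd, goal_cases)
    case (1 u)
    then show ?case
      by (auto simp: Y.Ident_Hom tid intro: groupoid.Ident_Hom[OF gp])
  next
    case (2 u v w f g)
    obtain y1 x1 y2 x2 y3 x3 where [simp]: "u = (y1, x1)" "v = (y2, x2)" "w = (y3, x3)"
      by (metis surj_pair)
    obtain \<sigma> \<phi> \<tau> \<psi> where [simp]: "f = (\<sigma>, \<phi>)" "g = (\<tau>, \<psi>)" by (metis surj_pair)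
    from 2 have h: "y3 \<in> Obj Y" "x1 \<in> Obj (fam F y1)" "\<sigma> \<in> Hom Y y1 y2" "\<tau> \<in> Hom Y y2 y3"
        "\<phi> \<in> Hom (fam F y2) (omap (tra F \<sigma>) x1) x2"
        "\<psi> \<in> Hom (fam F y3) (omap (tra F \<tau>) x2) x3" by auto
    then show ?case
      using groupoid.comp_Hom[OF gp[OF h(1)] gfunctor.amap_Hom[OF tr[OF h(4)] h(5)] h(6)]
      by (auto simp: tc[OF h(3,4,2)] intro: Y.comp_Hom)
  next
    case (3 u v w t f g h)
    obtain y1 x1 y2 x2 y3 x3 y4 x4 where [simp]: "u = (y1, x1)" "v = (y2, x2)" "w = (y3, x3)" "t = (y4, x4)"
      by (metis surj_pair)
    obtain \<sigma> \<phi> \<tau> \<psi> \<rho> \<chi> where [simp]: "f = (\<sigma>, \<phi>)" "g = (\<tau>, \<psi>)" "h = (\<rho>, \<chi>)" by (metis surj_pair)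
    from 3 have h: "y3 \<in> Obj Y" "y4 \<in> Obj Y" "x1 \<in> Obj (fam F y1)" "\<sigma> \<in> Hom Y y1 y2" "\<tau> \<in> Hom Y y2 y3" "\<rho> \<in> Hom Y y3 y4"
        "\<phi> \<in> Hom (fam F y2) (omap (tra F \<sigma>) x1) x2"
        "\<psi> \<in> Hom (fam F y3) (omap (tra F \<tau>) x2) x3"
        "\<chi> \<in> Hom (fam F y4) (omap (tra F \<rho>) x3) x4" by auto
    note a = gfunctor.amap_Hom[OF tr[OF h(5)] h(7)]
    have "(\<chi> \<cdot>\<^bsub>fam F y4\<^esub> amap (tra F \<rho>) \<psi>) \<cdot>\<^bsub>fam F y4\<^esub> amap (tra F (\<rho> \<cdot>\<^bsub>Y\<^esub> \<tau>)) \<phi> =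
      \<chi> \<cdot>\<^bsub>fam F y4\<^esub> amap (tra F \<rho>) (\<psi> \<cdot>\<^bsub>fam F y3\<^esub> amap (tra F \<tau>) \<phi>)"
      unfolding gfunctor.amap_comp_Hom[OF tr[OF h(6)] a h(8)] tc'[OF h(5,6,7)]
      by (rule groupoid.assoc_Hom[OF gp[OF h(2)] gfunctor.amap_Hom[OF tr[OF h(6)] a]
            gfunctor.amap_Hom[OF tr[OF h(6)] h(8)] h(9)])
    then show ?case
      using Y.assoc_Hom[OF h(4-6)] by simp
  next
    case (4 u v f)
    obtain y1 x1 y2 x2 \<sigma> \<phi> where [simp]: "u = (y1, x1)" "v = (y2, x2)" "f = (\<sigma>, \<phi>)" by (metis surj_pair)
    from 4 have h: "y2 \<in> Obj Y" "y1 \<in> Obj Y" "x1 \<in> Obj (fam F y1)" "\<sigma> \<in> Hom Y y1 y2"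
        "\<phi> \<in> Hom (fam F y2) (omap (tra F \<sigma>) x1) x2" by auto
    then show ?case
      using groupoid.Ident_right[OF gp[OF h(1)] h(5)]
      by (simp add: Y.Ident_right gfunctor.amap_Ident[OF tr[OF h(4)]])
  next
    case (5 u v f)
    obtain y1 x1 y2 x2 \<sigma> \<phi> where [simp]: "u = (y1, x1)" "v = (y2, x2)" "f = (\<sigma>, \<phi>)" by (metis surj_pair)
    from 5 have h: "y2 \<in> Obj Y" "x1 \<in> Obj (fam F y1)" "\<sigma> \<in> Hom Y y1 y2"
        "\<phi> \<in> Hom (fam F y2) (omap (tra F \<sigma>) x1) x2" by auto
    then show ?case
      using groupoid.Ident_left[OF gp[OF h(1)] h(4)]
      by (simp add: Y.Ident_left tid'[OF h(1,4)])
  next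
    case (6 u v f)
    obtain y1 x1 y2 x2 \<sigma> \<phi> where [simp]: "u = (y1, x1)" "v = (y2, x2)" "f = (\<sigma>, \<phi>)" by (metis surj_pair)
    from 6 have h: "y1 \<in> Obj Y" "y2 \<in> Obj Y" "x1 \<in> Obj (fam F y1)" "\<sigma> \<in> Hom Y y1 y2"
        "\<phi> \<in> Hom (fam F y2) (omap (tra F \<sigma>) x1) x2" by auto
    \<comment> \<open>The inverse of \<open>(\<sigma>, \<phi>)\<close> must have as second component
      an arrow from the transport of \<open>x2\<close> along the inverse of \<open>\<sigma>\<close>
      to \<open>x1\<close>: transport \<open>\<phi>\<close> along that inverse, then invert.
      Transporting back along \<open>\<sigma>\<close> gives the inverse of \<open>\<phi>\<close>
      again.\<close>
    let ?i = "ginv Y \<sigma>" let ?f = "amap (tra F ?i) \<phi>"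
    have i: "?i \<in> Hom Y y2 y1" using h Y.ginv_Hom by blast
    have "omap (tra F ?i) (omap (tra F \<sigma>) x1) = x1"
      using tc[OF h(4) i h(3)] h by (simp add: Y.ginv_left tid)
    then have f: "?f \<in> Hom (fam F y1) x1 (omap (tra F ?i) x2)"
      using gfunctor.amap_Hom[OF tr[OF i] h(5)] by simp
    note f' = groupoid.ginv_Hom[OF gp[OF h(1)] f]
    have "amap (tra F \<sigma>) (ginv (fam F y1) ?f) = ginv (fam F y2) (amap (tra F \<sigma>) ?f)"
      using gfunctor.amap_ginv[OF tr[OF h(4)] f] by simp
    also have "amap (tra F \<sigma>) ?f = \<phi>"
      using tc'[OF i h(4,5)] h by (simp add: Y.ginv_right tid'[OF h(2,5)])
    finally have "amap (tra F \<sigma>) (ginv (fam F y1) ?f) = ginv (fam F y2) \<phi>" .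
    then show ?case
      using i f' groupoid.ginv_left[OF gp[OF h(1)] f] groupoid.ginv_right[OF gp[OF h(2)] h(5)] h(4)
      by (intro bexI[of _ "(?i, ginv (fam F y1) ?f)"]) (auto simp: Y.ginv_left Y.ginv_right)
  qed
qed

lemma is_family_fibre:
  assumes "gfunctor X Z p"
  shows "is_family Z (fibre_family X Z p)"
proof -
  interpret p: gfunctor X Z p by fact
  have f: "gfunctor (hfibre X Z p y) (hfibre X Z p y') (tra (fibre_family X Z p) \<sigma>)" if s: "\<sigma> \<in> Hom Z y y'" for y y' \<sigma>
  proof (rule gfunctorI[OF p.groupoid_hfibre p.groupoid_hfibre])
    show "omap (tra (fibre_family X Z p) \<sigma>) x \<in> Obj (hfibre X Z p y')" if "x \<in> Obj (hfibre X Z p y)" for x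
      using that s by (auto simp: p.Obj_hfibre fibre_family_def intro: p.Y.comp_Hom)
    show "amap (tra (fibre_family X Z p) \<sigma>) a \<in> Hom (hfibre X Z p y')
      (omap (tra (fibre_family X Z p) \<sigma>) u) (omap (tra (fibre_family X Z p) \<sigma>) v)"
      if "a \<in> Hom (hfibre X Z p y) u v" for a u v
    proof -
      obtain u1 u2 v1 v2 where [simp]: "u = (u1, u2)" "v = (v1, v2)" by (metis surj_pair)
      from that show ?thesis
        using p.Y.assoc_Hom[OF p.amap_Hom _ s] s
        by (auto simp: p.Hom_hfibre fibre_family_def intro: p.Y.comp_Hom)
    qed
    show "amap (tra (fibre_family X Z p) \<sigma>) (Ident (hfibre X Z p y) u) =
       Ident (hfibre X Z p y') (omap (tra (fibre_family X Z p) \<sigma>) u)" for u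
      by (cases u) (auto simp: p.Ident_hfibre fibre_family_def)
    show "amap (tra (fibre_family X Z p) \<sigma>) (b \<cdot>\<^bsub>hfibre X Z p y\<^esub> a) =
       amap (tra (fibre_family X Z p) \<sigma>) b \<cdot>\<^bsub>hfibre X Z p y'\<^esub> amap (tra (fibre_family X Z p) \<sigma>) a" for a b
      by (cases a; cases b) (auto simp: p.Comp_hfibre fibre_family_def split: prod.split)
  qed
  show ?thesis
    unfolding is_family_def
  proof (intro conjI ballI allI, goal_cases)
    case 3 then show ?case using f by (simp add: fibre_family_def)
  next
    case (4 y u)
    then show ?case
      using p.Y.Ident_left by (auto simp: fibre_family_def p.Obj_hfibre)
  next
    case (5 y u v a)
    then show ?case
      using p.Y.Ident_left by (cases u; cases v) (auto simp: fibre_family_def p.Hom_hfibre)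
  next
    case (6 y y' y'' \<sigma> \<tau> u)
    then show ?case
      using p.Y.assoc_Hom by (cases u) (auto simp: fibre_family_def p.Obj_hfibre)
  next
    case (7 y y' y'' \<sigma> \<tau> u v a)
    then show ?case
      using p.Y.assoc_Hom by (cases u; cases v) (auto simp: fibre_family_def p.Hom_hfibre)
  qed (auto simp: p.Y.groupoid_axioms fibre_family_def p.groupoid_hfibre)
qed

lemma is_family_pullback:
  assumes "is_family Z F" "gfunctor W Z q"
  shows "is_family W (pullback_family F q)"
proof -
  interpret q: gfunctor W Z q by fact
  show ?thesis
    using assms(1) q.omap_in q.X.groupoid_axioms q.amap_Hom
    by (simp add: is_family_def pullback_family_def q.amap_Ident q.amap_comp_Hom) blast
qed

lemma gfunctor_prod_fun:
  assumes "gfunctor X X' F" "gfunctor Y Y' G"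
  shows "gfunctor (X \<times>\<^sub>G Y) (X' \<times>\<^sub>G Y') (prod_fun F G)"
proof -
  interpret F: gfunctor X X' F by fact
  interpret G: gfunctor Y Y' G by fact
  show ?thesis
    by (rule gfunctorI)
      (auto simp: groupoid_prod F.X.groupoid_axioms F.Y.groupoid_axioms G.X.groupoid_axioms
        G.Y.groupoid_axioms prod_fun_def prod_gpd_simps Hom_prod F.omap_in G.omap_in F.amap_Ident
        G.amap_Ident F.amap_comp_Hom G.amap_comp_Hom intro: F.amap_Hom G.amap_Hom)
qed

lemma is_family_prod:
  assumes "is_family Z F" "is_family Z G"
  shows "is_family Z (prod_family F G)"
  using assms unfolding is_family_def
  by (auto simp: prod_family_def groupoid_prod prod_gpd_simps Hom_prod intro!: gfunctor_prod_fun)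
    (auto simp: prod_fun_def)

text \<open>Both comparison functors commute with the projections to the base on the nose, so
  identities serve as the natural isomorphism. Agreement is asked for on the carriers only.\<close>

lemma nat_iso_Ident:
  assumes "gfunctor X Y F" "gfunctor X Y G"
    "\<And>x. x \<in> Obj X \<Longrightarrow> omap F x = omap G x"
    "\<And>a x y. a \<in> Hom X x y \<Longrightarrow> amap F a = amap G a"
  shows "nat_iso X Y F G (\<lambda>x. Ident Y (omap G x))"
proof -
  interpret F: gfunctor X Y F by fact
  interpret G: gfunctor X Y G by fact
  show ?thesis
  proof (rule nat_isoI[OF assms(1,2)])
    show "Ident Y (omap G x) \<in> Hom Y (omap F x) (omap G x)" if "x \<in> Obj X" for x
      using that by (simp add: assms(3) F.Y.Ident_Hom G.omap_in)
    show "amap G a \<cdot>\<^bsub>Y\<^esub> Ident Y (omap G x) = Ident Y (omap G y) \<cdot>\<^bsub>Y\<^esub> amap F a"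
      if "a \<in> Hom X x y" for a x y
      using G.amap_Hom[OF that] assms(4)[OF that] by (simp add: F.Y.Ident_left F.Y.Ident_right)
  qed
qed

section \<open>Homotopy sums of homotopy fibres over a cospan of groupoids\<close>

locale cospan = p: gfunctor X Z p + q: gfunctor W Z q
  for X :: "('x, 'xa) gpd" and Z :: "('z, 'za) gpd" and W :: "('w, 'wa) gpd" and p and q
begin

text \<open>\<open>tsum\<close> is the homotopy pullback of \<open>p\<close> and \<open>q\<close>:
  its objects are \<open>w\<close> and \<open>x\<close> with an isomorphism from
  \<open>omap p x\<close> to \<open>omap q w\<close>. In \<open>csum\<close> this isomorphism is
  split into two legs that meet in a third object of \<open>Z\<close>. In the application
  \<open>p\<close> is the root functor on forests and \<open>q\<close> the leaf functor on
  trees.\<close>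

abbreviation tsum where "tsum \<equiv> hsum W (pullback_family (fibre_family X Z p) q)"
abbreviation csum where "csum \<equiv> hsum Z (prod_family (fibre_family X Z p) (fibre_family W Z q))"

lemma groupoid_tsum: "groupoid tsum"
  by (rule groupoid_hsum[OF is_family_pullback[OF is_family_fibre[OF p.gfunctor_axioms] q.gfunctor_axioms]])

lemma groupoid_csum: "groupoid csum"
  by (intro groupoid_hsum is_family_prod is_family_fibre p.gfunctor_axioms q.gfunctor_axioms)

lemma Obj_tsum:
  "(w, (x, \<phi>)) \<in> Obj tsum \<longleftrightarrow> w \<in> Obj W \<and> x \<in> Obj X \<and> \<phi> \<in> Hom Z (omap p x) (omap q w)"
  by (simp add: hsum_def hom_gpd_simps pullback_family_def fibre_family_def p.Obj_hfibre)

text \<open>The source of the fibre component is forced to be the transported object, so the free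
  data are \<open>\<sigma>\<close> and \<open>a\<close>, subject to one commuting square in
  \<open>Z\<close>.\<close>

lemma Hom_tsum:
  "d \<in> Hom tsum (w, (x, \<phi>)) (w', (x', \<phi>')) \<longleftrightarrow>
    (\<exists>\<sigma> a. d = ((w, (x, \<phi>)), (w', (x', \<phi>')), (\<sigma>, ((x, amap q \<sigma> \<cdot>\<^bsub>Z\<^esub> \<phi>), (x', \<phi>'), a))) \<and>
      \<sigma> \<in> Hom W w w' \<and> a \<in> Hom X x x' \<and> \<phi> \<in> Hom Z (omap p x) (omap q w) \<and>
      \<phi>' \<in> Hom Z (omap p x') (omap q w') \<and> \<phi>' \<cdot>\<^bsub>Z\<^esub> amap p a = amap q \<sigma> \<cdot>\<^bsub>Z\<^esub> \<phi>)"
  using p.X.Hom_Obj[of _ x x'] q.X.Hom_Obj[of _ w w']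
  by (auto simp: hsum_def Hom_hom_gpd pullback_family_def fibre_family_def p.Obj_hfibre p.Hom_hfibre
      image_iff intro: p.Y.comp_Hom[OF _ q.amap_Hom[of _ w w']])

lemma Ident_tsum:
  "Ident tsum (w, (x, \<phi>)) = ((w, (x, \<phi>)), (w, (x, \<phi>)), (Ident W w, ((x, \<phi>), (x, \<phi>), Ident X x)))"
  by (simp add: hsum_def hom_gpd_simps pullback_family_def fibre_family_def p.Ident_hfibre)

lemma Comp_tsum:
  "((w', x'), (w'', x''), (\<tau>, (v1, v2, b))) \<cdot>\<^bsub>tsum\<^esub> ((w, x), v, (\<sigma>, (((u1, \<phi>), (u2, \<psi>), a)))) =
    ((w, x), (w'', x''), (\<tau> \<cdot>\<^bsub>W\<^esub> \<sigma>, ((u1, amap q \<tau> \<cdot>\<^bsub>Z\<^esub> \<phi>), v2, b \<cdot>\<^bsub>X\<^esub> a)))"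
  by (simp add: hsum_def hom_gpd_simps pullback_family_def fibre_family_def p.Comp_hfibre)

lemma Obj_csum:
  "(z, ((x, \<phi>), (w, \<psi>))) \<in> Obj csum \<longleftrightarrow> z \<in> Obj Z \<and> x \<in> Obj X \<and> w \<in> Obj W \<and>
    \<phi> \<in> Hom Z (omap p x) z \<and> \<psi> \<in> Hom Z (omap q w) z"
  by (auto simp: hsum_def hom_gpd_simps prod_family_def prod_gpd_simps fibre_family_def p.Obj_hfibre
      q.Obj_hfibre)

lemma Hom_csum:
  "d \<in> Hom csum (z, ((x, \<phi>), (w, \<psi>))) (z', ((x', \<phi>'), (w', \<psi>'))) \<longleftrightarrow>
    (\<exists>\<zeta> a c. d = ((z, ((x, \<phi>), (w, \<psi>))), (z', ((x', \<phi>'), (w', \<psi>'))),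
        (\<zeta>, (((x, \<zeta> \<cdot>\<^bsub>Z\<^esub> \<phi>), (x', \<phi>'), a), ((w, \<zeta> \<cdot>\<^bsub>Z\<^esub> \<psi>), (w', \<psi>'), c)))) \<and>
      \<zeta> \<in> Hom Z z z' \<and> a \<in> Hom X x x' \<and> c \<in> Hom W w w' \<and>
      \<phi> \<in> Hom Z (omap p x) z \<and> \<psi> \<in> Hom Z (omap q w) z \<and>
      \<phi>' \<in> Hom Z (omap p x') z' \<and> \<psi>' \<in> Hom Z (omap q w') z' \<and>
      \<phi>' \<cdot>\<^bsub>Z\<^esub> amap p a = \<zeta> \<cdot>\<^bsub>Z\<^esub> \<phi> \<and> \<psi>' \<cdot>\<^bsub>Z\<^esub> amap q c = \<zeta> \<cdot>\<^bsub>Z\<^esub> \<psi>)"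
  using p.X.Hom_Obj[of _ x x'] q.X.Hom_Obj[of _ w w'] p.Y.Hom_Obj[of _ z z']
  by (auto simp: hsum_def Hom_hom_gpd prod_family_def fibre_family_def p.Obj_hfibre p.Hom_hfibre
      q.Obj_hfibre q.Hom_hfibre prod_fun_def Hom_prod prod_gpd_simps image_iff intro: p.Y.comp_Hom)

lemma Ident_csum:
  "Ident csum (z, ((x, \<phi>), (w, \<psi>))) = ((z, ((x, \<phi>), (w, \<psi>))), (z, ((x, \<phi>), (w, \<psi>))),
    (Ident Z z, (((x, \<phi>), (x, \<phi>), Ident X x), ((w, \<psi>), (w, \<psi>), Ident W w))))"
  by (simp add: hsum_def hom_gpd_simps prod_family_def prod_gpd_simps fibre_family_def
      p.Ident_hfibre q.Ident_hfibre)

lemma Comp_csum: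
  "((z', x'), (z'', x''), (\<xi>, ((v1, v2, b), (v3, v4, d)))) \<cdot>\<^bsub>csum\<^esub>
    ((z, x), v, (\<zeta>, (((u1, \<phi>), (u2, \<psi>), a), ((u3, \<phi>'), (u4, \<psi>'), c)))) =
    ((z, x), (z'', x''), (\<xi> \<cdot>\<^bsub>Z\<^esub> \<zeta>, (((u1, \<xi> \<cdot>\<^bsub>Z\<^esub> \<phi>), v2, b \<cdot>\<^bsub>X\<^esub> a), ((u3, \<xi> \<cdot>\<^bsub>Z\<^esub> \<phi>'), v4, d \<cdot>\<^bsub>W\<^esub> c))))"
  by (simp add: hsum_def hom_gpd_simps prod_family_def prod_gpd_simps fibre_family_def prod_fun_def
      p.Comp_hfibre q.Comp_hfibre)

lemma gfunctor_tproj: "gfunctor tsum (X \<times>\<^sub>G W) fibre_sum_proj"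
proof (rule gfunctorI[OF groupoid_tsum groupoid_prod[OF p.X.groupoid_axioms q.X.groupoid_axioms]], goal_cases)
  case (1 u)
  then show ?case
    by (cases u) (auto simp: Obj_tsum prod_gpd_simps fibre_sum_proj_def)
next
  case (2 d u v)
  then show ?case
    by (cases u; cases v) (auto simp: Hom_tsum Hom_prod fibre_sum_proj_def)
next
  case (3 u)
  then show ?case
    by (cases u) (auto simp: Ident_tsum prod_gpd_simps fibre_sum_proj_def)
next
  case (4 d e u v w)
  then show ?case
    by (cases u; cases v; cases w) (auto simp: Hom_tsum Comp_tsum prod_gpd_simps fibre_sum_proj_def)
qed

lemma gfunctor_cproj: "gfunctor csum (X \<times>\<^sub>G W) fibre_prod_proj"
proof (rule gfunctorI[OF groupoid_csum groupoid_prod[OF p.X.groupoid_axioms q.X.groupoid_axioms]], goal_cases)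
  case (1 u)
  then show ?case
    by (cases u) (auto simp: Obj_csum prod_gpd_simps fibre_prod_proj_def)
next
  case (2 d u v)
  then show ?case
    by (cases u; cases v) (auto simp: Hom_csum Hom_prod fibre_prod_proj_def)
next
  case (3 u)
  then show ?case
    by (cases u) (auto simp: Ident_csum prod_gpd_simps fibre_prod_proj_def)
next
  case (4 d e u v w)
  then show ?case
    by (cases u; cases v; cases w) (auto simp: Hom_csum Comp_csum prod_gpd_simps fibre_prod_proj_def)
qed

text \<open>The universal property of the homotopy pullback: a functor \<open>u\<close> to
  \<open>X\<close> and \<open>W\<close> with a natural filling \<open>\<psi>\<close> of the square
  induces a functor to \<open>tsum\<close>. The hypotheses \<open>ff\<close> and \<open>es\<close>
  say that the induced functor is fully faithful and essentially surjective, in terms of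
  \<open>u\<close> and \<open>\<psi>\<close> alone.\<close>

theorem equivalent_over_tsum:
  assumes "gfunctor C (X \<times>\<^sub>G W) u"
    and psi: "\<And>c. c \<in> Obj C \<Longrightarrow> \<psi> c \<in> Hom Z (omap p (fst (omap u c))) (omap q (snd (omap u c)))"
    and nat: "\<And>d c c'. d \<in> Hom C c c' \<Longrightarrow>
      \<psi> c' \<cdot>\<^bsub>Z\<^esub> amap p (fst (amap u d)) = amap q (snd (amap u d)) \<cdot>\<^bsub>Z\<^esub> \<psi> c"
    and ff: "\<And>c c' a \<sigma>. \<lbrakk>c \<in> Obj C; c' \<in> Obj C; a \<in> Hom X (fst (omap u c)) (fst (omap u c'));
      \<sigma> \<in> Hom W (snd (omap u c)) (snd (omap u c')); \<psi> c' \<cdot>\<^bsub>Z\<^esub> amap p a = amap q \<sigma> \<cdot>\<^bsub>Z\<^esub> \<psi> c\<rbrakk>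
      \<Longrightarrow> \<exists>!d. d \<in> Hom C c c' \<and> amap u d = (a, \<sigma>)"
    and es: "\<And>x w \<phi>. \<lbrakk>x \<in> Obj X; w \<in> Obj W; \<phi> \<in> Hom Z (omap p x) (omap q w)\<rbrakk> \<Longrightarrow>
      \<exists>c\<in>Obj C. \<exists>a\<in>Hom X (fst (omap u c)) x. \<exists>\<sigma>\<in>Hom W (snd (omap u c)) w.
        \<phi> \<cdot>\<^bsub>Z\<^esub> amap p a = amap q \<sigma> \<cdot>\<^bsub>Z\<^esub> \<psi> c"
  shows "equivalent_over (X \<times>\<^sub>G W) C u tsum fibre_sum_proj"
proof -
  interpret u: gfunctor C "X \<times>\<^sub>G W" u by fact
  define O' where "O' c = (snd (omap u c), (fst (omap u c), \<psi> c))" for c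
  define \<Phi> where "\<Phi> = \<lparr>omap = O',
    amap = (\<lambda>d. (O' (Dom C d), O' (Cod C d), (snd (amap u d),
      ((fst (omap u (Dom C d)), amap q (snd (amap u d)) \<cdot>\<^bsub>Z\<^esub> \<psi> (Dom C d)),
       (fst (omap u (Cod C d)), \<psi> (Cod C d)), fst (amap u d)))))\<rparr>"
  have \<Phi>o: "omap \<Phi> = O'"
    by (simp add: \<Phi>_def)
  have \<Phi>a: "amap \<Phi> d = (O' c, O' c', (snd (amap u d),
      ((fst (omap u c), amap q (snd (amap u d)) \<cdot>\<^bsub>Z\<^esub> \<psi> c),
       (fst (omap u c'), \<psi> c'), fst (amap u d))))" if "d \<in> Hom C c c'" for d c c'
    using that by (simp add: \<Phi>_def Hom_def)
  have u1: "fst (omap u c) \<in> Obj X" "snd (omap u c) \<in> Obj W" if "c \<in> Obj C" for c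
    using u.omap_in[OF that] by (auto simp: prod_gpd_simps)
  have u2: "fst (amap u d) \<in> Hom X (fst (omap u c)) (fst (omap u c'))"
    "snd (amap u d) \<in> Hom W (snd (omap u c)) (snd (omap u c'))" if "d \<in> Hom C c c'" for c c' d
    using u.amap_Hom[OF that] by (auto simp: Hom_prod)
  have F: "gfunctor C tsum \<Phi>"
  proof (rule gfunctorI[OF u.X.groupoid_axioms groupoid_tsum], goal_cases)
    case (1 c)
    then show ?case
      by (simp add: \<Phi>o O'_def Obj_tsum psi u1)
  next
    case (2 d c c')
    then show ?case
      using psi nat[OF 2] u2[OF 2] u.X.Hom_Obj[OF 2] by (auto simp: \<Phi>a[OF 2] \<Phi>o O'_def Hom_tsum)
  next
    case (3 c)
    have "amap q (Ident W (snd (omap u c))) \<cdot>\<^bsub>Z\<^esub> \<psi> c = \<psi> c"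
      using u1[OF 3] psi[OF 3] by (simp add: q.amap_Ident p.Y.Ident_left)
    then show ?case
      by (simp add: \<Phi>a[OF u.X.Ident_Hom[OF 3]] \<Phi>o O'_def Ident_tsum u.amap_Ident[OF 3] prod_gpd_simps)
  next
    case (4 d e b c c')
    have o: "b \<in> Obj C" using u.X.Hom_Obj[OF 4(1)] by simp
    have "amap q (snd (amap u e) \<cdot>\<^bsub>W\<^esub> snd (amap u d)) \<cdot>\<^bsub>Z\<^esub> \<psi> b =
        amap q (snd (amap u e)) \<cdot>\<^bsub>Z\<^esub> (amap q (snd (amap u d)) \<cdot>\<^bsub>Z\<^esub> \<psi> b)"
      unfolding q.amap_comp_Hom[OF u2(2)[OF 4(1)] u2(2)[OF 4(2)]]
      by (rule p.Y.assoc_Hom[OF psi[OF o] q.amap_Hom[OF u2(2)[OF 4(1)]] q.amap_Hom[OF u2(2)[OF 4(2)]]])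
    then show ?case
      by (simp add: \<Phi>a[OF 4(1)] \<Phi>a[OF 4(2)] \<Phi>a[OF u.X.comp_Hom[OF 4]] O'_def Comp_tsum
          u.amap_comp_Hom[OF 4] prod_gpd_simps)
  qed
  have "gequivalence C tsum \<Phi>"
  proof (rule gequivalenceI[OF F])
    fix c c' b assume h: "c \<in> Obj C" "c' \<in> Obj C" "b \<in> Hom tsum (omap \<Phi> c) (omap \<Phi> c')"
    then obtain \<sigma> a where b: "b = (O' c, O' c', (\<sigma>, ((fst (omap u c), amap q \<sigma> \<cdot>\<^bsub>Z\<^esub> \<psi> c), (fst (omap u c'), \<psi> c'), a)))"
      "\<sigma> \<in> Hom W (snd (omap u c)) (snd (omap u c'))" "a \<in> Hom X (fst (omap u c)) (fst (omap u c'))"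
      "\<psi> c' \<cdot>\<^bsub>Z\<^esub> amap p a = amap q \<sigma> \<cdot>\<^bsub>Z\<^esub> \<psi> c"
      by (auto simp: \<Phi>o O'_def Hom_tsum)
    have "amap \<Phi> d = b \<longleftrightarrow> amap u d = (a, \<sigma>)" if "d \<in> Hom C c c'" for d
      unfolding \<Phi>a[OF that] b(1) by (auto simp: prod_eq_iff)
    then show "\<exists>!d. d \<in> Hom C c c' \<and> amap \<Phi> d = b"
      using ff[OF h(1,2) b(3,2,4)] by metis
  next
    fix y assume y: "y \<in> Obj tsum"
    obtain w x \<phi> where [simp]: "y = (w, (x, \<phi>))" by (metis surj_pair)
    have y': "x \<in> Obj X" "w \<in> Obj W" "\<phi> \<in> Hom Z (omap p x) (omap q w)"
      using y by (auto simp: Obj_tsum)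
    from es[OF this] obtain c a \<sigma> where c: "c \<in> Obj C" "a \<in> Hom X (fst (omap u c)) x" "\<sigma> \<in> Hom W (snd (omap u c)) w"
      "\<phi> \<cdot>\<^bsub>Z\<^esub> amap p a = amap q \<sigma> \<cdot>\<^bsub>Z\<^esub> \<psi> c" by blast
    then have "(O' c, y, (\<sigma>, ((fst (omap u c), amap q \<sigma> \<cdot>\<^bsub>Z\<^esub> \<psi> c), (x, \<phi>), a))) \<in> Hom tsum (omap \<Phi> c) y"
      using y' psi by (auto simp: \<Phi>o O'_def Hom_tsum)
    then show "\<exists>c\<in>Obj C. \<exists>b. b \<in> Hom tsum (omap \<Phi> c) y"
      using c(1) by blast
  qed
  moreover have "nat_iso C (X \<times>\<^sub>G W) (fibre_sum_proj \<circ>\<circ> \<Phi>) u (\<lambda>c. Ident (X \<times>\<^sub>G W) (omap u c))"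
    by (rule nat_iso_Ident[OF gfunctor_gcomp[OF F gfunctor_tproj] assms(1)])
      (auto simp: gcomp_def fibre_sum_proj_def \<Phi>o \<Phi>a O'_def)
  ultimately show ?thesis
    unfolding equivalent_over_def using assms(1) gfunctor_tproj by blast
qed

text \<open>The functor puts the meeting point at \<open>omap q w\<close> and makes the second leg
  an identity. Every object of \<open>csum\<close> is isomorphic to one of this kind, since its
  second leg identifies the meeting point with \<open>omap q w\<close>.\<close>

theorem equivalent_over_tsum_csum:
  "equivalent_over (X \<times>\<^sub>G W) tsum fibre_sum_proj csum fibre_prod_proj"
proof -
  define O' where "O' u = (case u of (w, (x, \<phi>)) \<Rightarrow> (omap q w, ((x, \<phi>), (w, Ident Z (omap q w)))))"
    for u :: "'w \<times> 'x \<times> 'za"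
  define \<Phi> where "\<Phi> = \<lparr>omap = O', amap = (\<lambda>(u, v, (\<sigma>, (y :: 'x \<times> 'za, y' :: 'x \<times> 'za, a :: 'xa))).
    (O' u, O' v, (amap q \<sigma>, ((y, y', a),
      ((fst u, amap q \<sigma> \<cdot>\<^bsub>Z\<^esub> Ident Z (omap q (fst u))), (fst v, Ident Z (omap q (fst v))), \<sigma>)))))\<rparr>"
  have F: "gfunctor tsum csum \<Phi>"
  proof (rule gfunctorI[OF groupoid_tsum groupoid_csum], goal_cases)
    case (1 u)
    then show ?case
      by (cases u) (auto simp: \<Phi>_def O'_def Obj_tsum Obj_csum q.omap_in p.Y.Ident_Hom)
  next
    case (2 d u v)
    then show ?case
      using q.X.Hom_Obj[of _ "fst u" "fst v"] q.amap_Hom[of _ "fst u" "fst v"]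
    by (cases u; cases v) (auto simp: \<Phi>_def O'_def Hom_tsum Hom_csum p.Y.Ident_left[OF q.amap_Hom]
          p.Y.Ident_right[OF q.amap_Hom] q.omap_in p.Y.Ident_Hom)
  next
    case (3 u)
    then show ?case
      by (cases u) (auto simp: \<Phi>_def O'_def Obj_tsum Ident_tsum Ident_csum q.amap_Ident
          p.Y.Ident_left[OF p.Y.Ident_Hom] q.omap_in)
  next
    case (4 d e u v w)
    then obtain u1 x1 \<phi>1 u2 x2 \<phi>2 u3 x3 \<phi>3 where uvw: "u = (u1, (x1, \<phi>1))" "v = (u2, (x2, \<phi>2))" "w = (u3, (x3, \<phi>3))"
      by (metis surj_pair)
    from 4 obtain \<sigma> a \<tau> b where
      d: "d = (u, v, (\<sigma>, ((x1, amap q \<sigma> \<cdot>\<^bsub>Z\<^esub> \<phi>1), (x2, \<phi>2), a)))" "\<sigma> \<in> Hom W u1 u2" and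
      e: "e = (v, w, (\<tau>, ((x2, amap q \<tau> \<cdot>\<^bsub>Z\<^esub> \<phi>2), (x3, \<phi>3), b)))" "\<tau> \<in> Hom W u2 u3"
      by (auto simp: uvw Hom_tsum)
    have "Ident Z (omap q u1) \<in> Hom Z (omap q u1) (omap q u1)"
      using q.X.Hom_Obj[OF d(2)] p.Y.Ident_Hom q.omap_in by blast
    from p.Y.assoc_Hom[OF this q.amap_Hom[OF d(2)] q.amap_Hom[OF e(2)]] d e
    show ?case
      by (simp add: uvw \<Phi>_def O'_def Comp_tsum Comp_csum q.amap_comp_Hom[OF d(2) e(2)])
  qed
  have "gequivalence tsum csum \<Phi>"
  proof (rule gequivalenceI[OF F])
    fix u v b assume h: "u \<in> Obj tsum" "v \<in> Obj tsum" "b \<in> Hom csum (omap \<Phi> u) (omap \<Phi> v)"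
    obtain w x \<phi> w' x' \<phi>' where uv: "u = (w, (x, \<phi>))" "v = (w', (x', \<phi>'))" by (metis surj_pair)
    let ?i = "Ident Z (omap q w)" let ?j = "Ident Z (omap q w')"
    from h(3) obtain \<zeta> a \<sigma> where b: "b = (O' u, O' v, (\<zeta>, (((x, \<zeta> \<cdot>\<^bsub>Z\<^esub> \<phi>), (x', \<phi>'), a), ((w, \<zeta> \<cdot>\<^bsub>Z\<^esub> ?i), (w', ?j), \<sigma>))))"
      "\<zeta> \<in> Hom Z (omap q w) (omap q w')" "a \<in> Hom X x x'" "\<sigma> \<in> Hom W w w'"
      "\<phi>' \<cdot>\<^bsub>Z\<^esub> amap p a = \<zeta> \<cdot>\<^bsub>Z\<^esub> \<phi>" "?j \<cdot>\<^bsub>Z\<^esub> amap q \<sigma> = \<zeta> \<cdot>\<^bsub>Z\<^esub> ?i"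
      by (auto simp: uv \<Phi>_def O'_def Hom_csum)
    \<comment> \<open>Compatibility with the two identity legs leaves no freedom in the base
      component, which gives fullness and faithfulness.\<close>
    have z: "\<zeta> = amap q \<sigma>"
      using b(6) by (simp add: p.Y.Ident_left[OF q.amap_Hom[OF b(4)]] p.Y.Ident_right[OF b(2)])
    let ?d = "(u, v, (\<sigma>, ((x, amap q \<sigma> \<cdot>\<^bsub>Z\<^esub> \<phi>), (x', \<phi>'), a)))"
    have d: "?d \<in> Hom tsum u v"
      using b h by (auto simp: uv Hom_tsum Obj_tsum z)
    show "\<exists>!d. d \<in> Hom tsum u v \<and> amap \<Phi> d = b"
    proof (rule ex1I[of _ ?d], use d in \<open>simp add: \<Phi>_def b(1) z uv\<close>)
      fix d' assume "d' \<in> Hom tsum u v \<and> amap \<Phi> d' = b"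
      then show "d' = ?d"
        by (auto simp: \<Phi>_def b(1) uv Hom_tsum)
    qed
  next
    fix y assume "y \<in> Obj csum"
    moreover obtain z x \<phi> w \<psi> where y: "y = (z, ((x, \<phi>), (w, \<psi>)))" by (metis surj_pair)
    ultimately have h: "z \<in> Obj Z" "x \<in> Obj X" "w \<in> Obj W" "\<phi> \<in> Hom Z (omap p x) z" "\<psi> \<in> Hom Z (omap q w) z"
      by (auto simp: Obj_csum)
    \<comment> \<open>The first leg is pulled back along the second, so that the meeting point can
      be moved from \<open>z\<close> to \<open>omap q w\<close>.\<close>
    let ?\<phi> = "ginv Z \<psi> \<cdot>\<^bsub>Z\<^esub> \<phi>"
    have phi: "?\<phi> \<in> Hom Z (omap p x) (omap q w)"
      using h by (auto intro: p.Y.comp_Hom p.Y.ginv_Hom)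
    have "(O' (w, (x, ?\<phi>)), y, (\<psi>, (((x, \<psi> \<cdot>\<^bsub>Z\<^esub> ?\<phi>), (x, \<phi>), Ident X x),
        ((w, \<psi> \<cdot>\<^bsub>Z\<^esub> Ident Z (omap q w)), (w, \<psi>), Ident W w)))) \<in> Hom csum (omap \<Phi> (w, (x, ?\<phi>))) y"
      using h phi by (simp add: \<Phi>_def O'_def y Hom_csum p.amap_Ident q.amap_Ident p.X.Ident_Hom q.X.Ident_Hom
          p.Y.Ident_Hom q.omap_in p.Y.Ident_right p.Y.ginv_cancel_left'[OF h(4,5)])
    moreover have "(w, (x, ?\<phi>)) \<in> Obj tsum"
      using h phi by (simp add: Obj_tsum)
    ultimately show "\<exists>x\<in>Obj tsum. \<exists>b. b \<in> Hom csum (omap \<Phi> x) y" by blast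
  qed
  moreover have "\<exists>\<theta>. nat_iso tsum (X \<times>\<^sub>G W) (fibre_prod_proj \<circ>\<circ> \<Phi>) fibre_sum_proj \<theta>"
    by (rule exI, rule nat_iso_Ident[OF gfunctor_gcomp[OF F gfunctor_cproj] gfunctor_tproj])
      (auto simp: gcomp_def fibre_sum_proj_def fibre_prod_proj_def \<Phi>_def O'_def split: prod.split)
  ultimately show ?thesis
    unfolding equivalent_over_def using gfunctor_tproj gfunctor_cproj by blast
qed

end

section \<open>Homotopy pullbacks, in general and over a discrete groupoid\<close>

lemma Hom_hpullback:
  "d \<in> Hom (hpullback X Y Z F G) (x, y, \<phi>) (x', y', \<phi>') \<longleftrightarrow>
    (\<exists>a b. d = ((x, y, \<phi>), (x', y', \<phi>'), (a, b)) \<and>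
      x \<in> Obj X \<and> y \<in> Obj Y \<and> \<phi> \<in> Hom Z (omap F x) (omap G y) \<and>
      x' \<in> Obj X \<and> y' \<in> Obj Y \<and> \<phi>' \<in> Hom Z (omap F x') (omap G y') \<and>
      a \<in> Hom X x x' \<and> b \<in> Hom Y y y' \<and> \<phi>' \<cdot>\<^bsub>Z\<^esub> amap F a = amap G b \<cdot>\<^bsub>Z\<^esub> \<phi>)"
  by (auto simp: hpullback_def Hom_hom_gpd)

lemma groupoid_hpullback:
  assumes "gfunctor X Z F" "gfunctor Y Z G"
  shows "groupoid (hpullback X Y Z F G)"
proof -
  interpret F: gfunctor X Z F by fact
  interpret G: gfunctor Y Z G by fact
  show ?thesis
    unfolding hpullback_def
  proof (rule groupoid_hom_gpd, goal_cases)
    case (1 u)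
    then show ?case
      by (auto simp: F.X.Ident_Hom G.X.Ident_Hom F.amap_Ident G.amap_Ident F.Y.Ident_left F.Y.Ident_right)
  next
    case (2 u v w f g)
    then show ?case
      by (auto simp: F.amap_comp_Hom G.amap_comp_Hom intro!: F.X.comp_Hom G.X.comp_Hom
          F.Y.paste_squares[OF F.amap_Hom F.amap_Hom G.amap_Hom G.amap_Hom])
  next
    case (6 u v f)
    then obtain x y \<phi> x' y' \<phi>' a b where [simp]: "u = (x, y, \<phi>)" "v = (x', y', \<phi>')" "f = (a, b)"
      by (metis surj_pair)
    show ?case
      using 6 by (intro bexI[of _ "(ginv X a, ginv Y b)"])
        (auto simp: F.X.ginv_left F.X.ginv_right G.X.ginv_left G.X.ginv_right F.X.ginv_Hom G.X.ginv_Hom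
          F.amap_ginv G.amap_ginv F.Y.ginv_square[OF F.amap_Hom _ _ G.amap_Hom])
  qed (auto simp: F.X.assoc_Hom G.X.assoc_Hom F.X.Ident_left F.X.Ident_right G.X.Ident_left G.X.Ident_right)
qed

text \<open>Over a discrete base, the homotopy pullback condition is local at each node: the marks of a node
  \<open>n\<close> represent the homotopy fibre of \<open>E \<rightarrow> B\<close> over its colour up to unique isomorphism.\<close>

lemma is_hpullback_disc_iff:
  assumes F: "gfunctor E B F"
    and m: "\<And>m. m \<in> M \<Longrightarrow> mc m \<in> Obj E" and pm: "\<And>m. m \<in> M \<Longrightarrow> pm m \<in> N"
    and n: "\<And>n. n \<in> N \<Longrightarrow> nc n \<in> Obj B"
    and th: "\<And>m. m \<in> M \<Longrightarrow> \<theta> m \<in> Hom B (omap F (mc m)) (nc (pm m))"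
  shows "is_hpullback (disc_gpd M) E (disc_gpd N) B (disc_fun E mc) (disc_fun (disc_gpd N) pm)
      F (disc_fun B nc) \<theta> \<longleftrightarrow>
    (\<forall>n\<in>N. \<forall>e\<in>Obj E. \<forall>\<phi>\<in>Hom B (omap F e) (nc n).
      \<exists>!(m, a). m \<in> M \<and> pm m = n \<and> a \<in> Hom E (mc m) e \<and> \<phi> \<cdot>\<^bsub>B\<^esub> amap F a = \<theta> m)" (is "?L \<longleftrightarrow> ?R")
proof -
  interpret F: gfunctor E B F by fact
  let ?H = "hpullback E (disc_gpd N) B F (disc_fun B nc)"
  define K where "K = \<lparr>omap = (\<lambda>w. (omap (disc_fun E mc) w, omap (disc_fun (disc_gpd N) pm) w, \<theta> w)),
     amap = (\<lambda>d. ((omap (disc_fun E mc) (Dom (disc_gpd M) d), omap (disc_fun (disc_gpd N) pm) (Dom (disc_gpd M) d), \<theta> (Dom (disc_gpd M) d)),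
                  (omap (disc_fun E mc) (Cod (disc_gpd M) d), omap (disc_fun (disc_gpd N) pm) (Cod (disc_gpd M) d), \<theta> (Cod (disc_gpd M) d)),
                  (amap (disc_fun E mc) d, amap (disc_fun (disc_gpd N) pm) d)))\<rparr>"
  have Ko: "omap K = (\<lambda>m. (mc m, pm m, \<theta> m))"
    by (simp add: K_def disc_fun_def)
  have Ka: "amap K = (\<lambda>m. ((mc m, pm m, \<theta> m), (mc m, pm m, \<theta> m), (Ident E (mc m), pm m)))"
    by (simp add: K_def disc_fun_def) (simp add: disc_gpd_def)
  have nf: "gfunctor (disc_gpd N) B (disc_fun B nc)"
    by (rule gfunctor_disc_fun) (use n F.Y.groupoid_axioms in auto)
  have mf: "gfunctor (disc_gpd M) E (disc_fun E mc)"
    by (rule gfunctor_disc_fun) (use m F.X.groupoid_axioms in auto)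
  have pf: "gfunctor (disc_gpd M) (disc_gpd N) (disc_fun (disc_gpd N) pm)"
    by (rule gfunctor_disc_fun) (use pm in \<open>auto simp: groupoid_disc, auto simp: disc_gpd_def\<close>)
  note H = groupoid_hpullback[OF F nf]
  have HH: "d \<in> Hom ?H (x, k, \<phi>) (x', k', \<phi>') \<longleftrightarrow>
    (\<exists>a. d = ((x, k, \<phi>), (x', k', \<phi>'), (a, k)) \<and> k = k' \<and> k \<in> N \<and>
      \<phi> \<in> Hom B (omap F x) (nc k) \<and> \<phi>' \<in> Hom B (omap F x') (nc k) \<and>
      a \<in> Hom E x x' \<and> \<phi>' \<cdot>\<^bsub>B\<^esub> amap F a = \<phi>)" for d x k \<phi> x' k' \<phi>'
    using F.X.Hom_Obj[of _ x x'] F.Y.Ident_left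
    by (auto simp: Hom_hpullback Hom_disc disc_fun_def) (auto simp: disc_gpd_def)
  have OH: "Obj ?H = {(x, k, \<phi>). x \<in> Obj E \<and> k \<in> N \<and> \<phi> \<in> Hom B (omap F x) (nc k)}"
    by (auto simp: hpullback_def hom_gpd_simps disc_fun_def) (auto simp: disc_gpd_def)
  have nat: "nat_iso (disc_gpd M) B (F \<circ>\<circ> disc_fun E mc) (disc_fun B nc \<circ>\<circ> disc_fun (disc_gpd N) pm) \<theta>"
  proof (rule nat_isoI[OF gfunctor_gcomp[OF mf F] gfunctor_gcomp[OF pf nf]])
    show "\<theta> x \<in> Hom B (omap (F \<circ>\<circ> disc_fun E mc) x) (omap (disc_fun B nc \<circ>\<circ> disc_fun (disc_gpd N) pm) x)"
      if "x \<in> Obj (disc_gpd M)" for x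
      using th that by (simp add: gcomp_def disc_fun_def) (simp add: disc_gpd_def)
    show "amap (disc_fun B nc \<circ>\<circ> disc_fun (disc_gpd N) pm) a \<cdot>\<^bsub>B\<^esub> \<theta> x =
       \<theta> y \<cdot>\<^bsub>B\<^esub> amap (F \<circ>\<circ> disc_fun E mc) a" if "a \<in> Hom (disc_gpd M) x y" for a x y
    proof -
      have a: "x = a" "y = a" "a \<in> M" using that by (auto simp: Hom_disc)
      have "Ident (disc_gpd N) k = k" for k by (simp add: disc_gpd_def)
      then show ?thesis
        using F.Y.Ident_right[OF th[OF a(3)]] F.Y.Ident_left[OF th[OF a(3)]] m[OF a(3)]
        by (simp add: a gcomp_def disc_fun_def F.amap_Ident)
    qed
  qed
  have KF: "gfunctor (disc_gpd M) ?H K"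
  proof (rule gfunctorI[OF groupoid_disc H], goal_cases)
    case (1 x)
    then show ?case using m pm th by (auto simp: Ko OH) (auto simp: disc_gpd_def)
  next
    case (2 a x y)
    then show ?case using m pm th F.Y.Ident_right[OF th[of y]]
      by (auto simp: Ko Ka HH Hom_disc F.X.Ident_Hom F.amap_Ident)
  next
    case (3 x)
    then show ?case by (simp add: Ko Ka hpullback_def hom_gpd_simps) (simp add: disc_gpd_def)
  next
    case (4 a b x y z)
    then show ?case using m
      by (auto simp: Ka Hom_disc hpullback_def hom_gpd_simps F.X.Ident_left[OF F.X.Ident_Hom])
        (auto simp: disc_gpd_def F.X.Ident_left[OF F.X.Ident_Hom])
  qed
  have "?L \<longleftrightarrow> gequivalence (disc_gpd M) ?H K"
    using nat by (simp add: is_hpullback_def K_def)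
  also have "\<dots> \<longleftrightarrow> ?R"
  proof
    assume K: "gequivalence (disc_gpd M) ?H K"
    show ?R
    proof (intro ballI)
      fix k e \<phi> assume h: "k \<in> N" "e \<in> Obj E" "\<phi> \<in> Hom B (omap F e) (nc k)"
      then have "(e, k, \<phi>) \<in> Obj ?H" by (simp add: OH)
      from gequivalence_ess_surj[OF K this] obtain x a where
        x: "x \<in> M" "pm x = k" "a \<in> Hom E (mc x) e" "\<phi> \<cdot>\<^bsub>B\<^esub> amap F a = \<theta> x"
        by (auto simp: Ko HH) (auto simp: disc_gpd_def)
      have "x' = x \<and> a' = a" if x': "x' \<in> M" "pm x' = k" "a' \<in> Hom E (mc x') e" "\<phi> \<cdot>\<^bsub>B\<^esub> amap F a' = \<theta> x'" for x' a'
      proof -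
        \<comment> \<open>Two solutions over the same \<open>e\<close> differ by an arrow between
          the colours of their marks. It defines an arrow of the homotopy pullback, hence by
          fullness comes from an arrow of the discrete groupoid of marks, which can only be an
          identity.\<close>
        let ?c = "ginv E a \<cdot>\<^bsub>E\<^esub> a'"
        have c: "?c \<in> Hom E (mc x') (mc x)"
          using x x' by (auto intro: F.X.comp_Hom F.X.ginv_Hom)
        have "amap F ?c = ginv B (amap F a) \<cdot>\<^bsub>B\<^esub> amap F a'"
          using F.amap_comp_Hom[OF x'(3) F.X.ginv_Hom[OF x(3)]] F.amap_ginv[OF x(3)] by simp
        then have "\<theta> x \<cdot>\<^bsub>B\<^esub> amap F ?c = \<phi> \<cdot>\<^bsub>B\<^esub> (amap F a \<cdot>\<^bsub>B\<^esub> (ginv B (amap F a) \<cdot>\<^bsub>B\<^esub> amap F a'))"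
          using F.Y.assoc_Hom[OF F.amap_Hom[OF c] F.amap_Hom[OF x(3)] h(3)] x(4) by simp
        then have "\<theta> x \<cdot>\<^bsub>B\<^esub> amap F ?c = \<theta> x'"
          using x' by (simp add: F.Y.ginv_cancel_left'[OF F.amap_Hom[OF x'(3)] F.amap_Hom[OF x(3)]])
        then have "((mc x', k, \<theta> x'), (mc x, k, \<theta> x), (?c, k)) \<in> Hom ?H (omap K x') (omap K x)"
          using c x x' th[of x'] th[of x] h(1) by (simp add: Ko HH)
        from gequivalence_full[OF K _ _ this] obtain d where
          "d \<in> Hom (disc_gpd M) x' x" "amap K d = ((mc x', k, \<theta> x'), (mc x, k, \<theta> x), (?c, k))"
          using x(1) x'(1) by (auto simp: disc_gpd_def)
        then have eq: "x' = x" and "?c = Ident E (mc x)"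
          by (auto simp: Hom_disc Ka)
        then have "a' = a \<cdot>\<^bsub>E\<^esub> Ident E (mc x)"
          using F.X.ginv_cancel_left'[OF x'(3) x(3)] by simp
        then show ?thesis
          using eq F.X.Ident_right[OF x(3)] by simp
      qed
      note unique = this
      show "\<exists>!(m, a). m \<in> M \<and> pm m = k \<and> a \<in> Hom E (mc m) e \<and> \<phi> \<cdot>\<^bsub>B\<^esub> amap F a = \<theta> m"
      proof (rule ex1I[of _ "(x, a)"])
        show "case (x, a) of (m, a) \<Rightarrow> m \<in> M \<and> pm m = k \<and> a \<in> Hom E (mc m) e \<and> \<phi> \<cdot>\<^bsub>B\<^esub> amap F a = \<theta> m"
          using x by simp
        show "y = (x, a)"
          if "case y of (m, a) \<Rightarrow> m \<in> M \<and> pm m = k \<and> a \<in> Hom E (mc m) e \<and> \<phi> \<cdot>\<^bsub>B\<^esub> amap F a = \<theta> m" for y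
          using that unique[of "fst y" "snd y"] by (simp add: case_prod_unfold prod_eq_iff)
      qed
    qed
  next
    assume R: ?R
    show "gequivalence (disc_gpd M) ?H K"
    proof (rule gequivalenceI[OF KF])
      fix x x' b assume x: "x \<in> Obj (disc_gpd M)" "x' \<in> Obj (disc_gpd M)"
        and b: "b \<in> Hom ?H (omap K x) (omap K x')"
      then have xM: "x \<in> M" "x' \<in> M" by (auto simp: disc_gpd_def)
      from b obtain a where a: "b = (omap K x, omap K x', (a, pm x))" "pm x = pm x'" "a \<in> Hom E (mc x) (mc x')"
        "\<theta> x' \<cdot>\<^bsub>B\<^esub> amap F a = \<theta> x"
        by (auto simp: Ko HH)
      have "\<exists>!(m, a). m \<in> M \<and> pm m = pm x' \<and> a \<in> Hom E (mc m) (mc x') \<and> \<theta> x' \<cdot>\<^bsub>B\<^esub> amap F a = \<theta> m"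
        using R[rule_format, OF pm[OF xM(2)] m[OF xM(2)] th[OF xM(2)]] .
      \<comment> \<open>At the object \<open>mc x'\<close> with the arrow \<open>\<theta> x'\<close>
        one solution is the mark \<open>x'\<close> itself with an identity. The given arrow makes
        \<open>x\<close> a second one, so uniqueness identifies them.\<close>
      moreover have "\<theta> x' \<cdot>\<^bsub>B\<^esub> amap F (Ident E (mc x')) = \<theta> x'"
        using th[OF xM(2)] m[OF xM(2)] by (simp add: F.amap_Ident F.Y.Ident_right)
      ultimately have "(x, a) = (x', Ident E (mc x'))"
        using xM a F.X.Ident_Hom[OF m[OF xM(2)]] by blast
      then show "\<exists>!d. d \<in> Hom (disc_gpd M) x x' \<and> amap K d = b"
        using xM a(1) by (auto simp: Hom_disc Ka Ko)
    next
      fix y assume "y \<in> Obj ?H"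
      then obtain e k \<phi> where y: "y = (e, k, \<phi>)" "k \<in> N" "e \<in> Obj E" "\<phi> \<in> Hom B (omap F e) (nc k)"
        by (auto simp: OH)
      with R have "\<exists>!(m, a). m \<in> M \<and> pm m = k \<and> a \<in> Hom E (mc m) e \<and> \<phi> \<cdot>\<^bsub>B\<^esub> amap F a = \<theta> m"
        by blast
      then obtain x a where x: "x \<in> M" "pm x = k" "a \<in> Hom E (mc x) e" "\<phi> \<cdot>\<^bsub>B\<^esub> amap F a = \<theta> x" by auto
      then have "(omap K x, y, (a, k)) \<in> Hom ?H (omap K x) y"
        using y th[of x] by (auto simp: Ko HH)
      moreover have "x \<in> Obj (disc_gpd M)"
        using x(1) by (simp add: disc_gpd_def)
      ultimately show "\<exists>x\<in>Obj (disc_gpd M). \<exists>b. b \<in> Hom ?H (omap K x) y"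
        by blast
    qed
  qed
  finally show ?thesis .
qed

section \<open>Trees\<close>

lemma is_treeD:
  assumes "is_tree T"
  shows smap_in: "m \<in> marks T \<Longrightarrow> smap T m \<in> edges T"
    and pmap_in: "m \<in> marks T \<Longrightarrow> pmap T m \<in> nodes T"
    and tmap_in: "n \<in> nodes T \<Longrightarrow> tmap T n \<in> edges T"
    and inj_tmap: "inj_on (tmap T) (nodes T)"
    and inj_smap: "inj_on (smap T) (marks T)"
    and root_complement: "edges T - smap T ` marks T = {root T}"
proof -
  show "edges T - smap T ` marks T = {root T}"
    using assms unfolding is_tree_def root_def is_singleton_the_elem by blast
qed (use assms in \<open>auto simp: is_tree_def\<close>)

lemma root_in: "is_tree T \<Longrightarrow> root T \<in> edges T"
  using root_complement by blast

lemma smap_neq_root: "is_tree T \<Longrightarrow> m \<in> marks T \<Longrightarrow> smap T m \<noteq> root T"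
  using root_complement by blast

lemma edge_cases:
  assumes "is_tree T" "x \<in> edges T"
  obtains "x = root T" | m where "m \<in> marks T" "x = smap T m"
  using root_complement[OF assms(1)] assms(2) by blast

lemma walk_root: "walk T (root T) = root T"
  by (simp add: walk_def)

lemma walk_smap: "is_tree T \<Longrightarrow> m \<in> marks T \<Longrightarrow> walk T (smap T m) = tmap T (pmap T m)"
  by (simp add: walk_def smap_neq_root the_inv_into_f_f inj_smap)

lemma funpow_walk_root: "(walk T ^^ k) (root T) = root T"
  by (induction k) (auto simp: walk_root)

text \<open>The height is the number of steps to the root. Only its strict decrease along marks is
  exported, because this is the form that restricts to subtrees and can be rebuilt after gluing and
  copying.\<close>

lemma tree_height:
  assumes "is_tree T"
  obtains d :: "'u \<Rightarrow> nat" where "\<And>m. m \<in> marks T \<Longrightarrow> d (tmap T (pmap T m)) < d (smap T m)"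
proof
  fix m assume m: "m \<in> marks T"
  let ?d = "\<lambda>x. LEAST k. (walk T ^^ k) x = root T"
  have "\<exists>k. (walk T ^^ k) (smap T m) = root T"
    using assms m smap_in[OF assms m] by (auto simp: is_tree_def)
  then have *: "(walk T ^^ ?d (smap T m)) (smap T m) = root T"
    by (rule LeastI_ex)
  \<comment> \<open>The least number of steps is positive because an edge in the image of
    \<open>smap\<close> is never the root.\<close>
  then obtain j where j: "?d (smap T m) = Suc j"
    using smap_neq_root[OF assms m] by (cases "?d (smap T m)") auto
  then have "(walk T ^^ j) (tmap T (pmap T m)) = root T"
    using * by (simp add: funpow_Suc_right walk_smap[OF assms m] del: funpow.simps)
  then have "?d (tmap T (pmap T m)) \<le> j"
    by (rule Least_le)
  then show "?d (tmap T (pmap T m)) < ?d (smap T m)"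
    using j by simp
qed

text \<open>Induction from the root towards the leaves: every other edge is an input edge of a node
  whose output edge has smaller height.\<close>

lemma tree_induct [consumes 2, case_names root smap]:
  assumes T: "is_tree T" and "x \<in> edges T"
    and root: "Q (root T)"
    and smap: "\<And>m. m \<in> marks T \<Longrightarrow> Q (tmap T (pmap T m)) \<Longrightarrow> Q (smap T m)"
  shows "Q x"
proof -
  obtain d where d: "\<And>m. m \<in> marks T \<Longrightarrow> (d (tmap T (pmap T m)) :: nat) < d (smap T m)"
    using tree_height[OF T] by blast
  from \<open>x \<in> edges T\<close> show ?thesis
  proof (induction "d x" arbitrary: x rule: less_induct)
    case less
    from T less.prems show ?case
    proof (cases rule: edge_cases)
      case (2 m)
      then show ?thesis
        using less.hyps[of "tmap T (pmap T m)"] d smap tmap_in[OF T pmap_in[OF T]] by auto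
    qed (use root in simp)
  qed
qed

text \<open>Converse of \<open>tree_height\<close>: any function that decreases along marks forces
  every walk to end at the only edge that is not an input edge.\<close>

lemma is_treeI:
  assumes "finite (edges T)" "finite (marks T)" "finite (nodes T)"
    "smap T \<in> marks T \<rightarrow>\<^sub>E edges T" "pmap T \<in> marks T \<rightarrow>\<^sub>E nodes T" "tmap T \<in> nodes T \<rightarrow>\<^sub>E edges T"
    "inj_on (tmap T) (nodes T)" "inj_on (smap T) (marks T)"
    and r: "edges T - smap T ` marks T = {r}"
    and d: "\<And>m. m \<in> marks T \<Longrightarrow> (d (tmap T (pmap T m)) :: nat) < d (smap T m)"
  shows "is_tree T" and "root T = r"
proof -
  show root: "root T = r"
    using r by (simp add: root_def)
  have "\<exists>k. (walk T ^^ k) x = root T" if "x \<in> edges T" for x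
    using that
  proof (induction "d x" arbitrary: x rule: less_induct)
    case less
    show ?case
    proof (cases "x = r")
      case True
      then show ?thesis using root by (intro exI[of _ 0]) simp
    next
      case False
      then obtain m where m: "m \<in> marks T" "x = smap T m"
        using less.prems r by blast
      then have "walk T x = tmap T (pmap T m)"
        using False root assms(8) by (simp add: walk_def the_inv_into_f_f)
      moreover obtain k where "(walk T ^^ k) (tmap T (pmap T m)) = root T"
        using less.hyps[of "tmap T (pmap T m)"] d[OF m(1)] m assms(5,6) by blast
      ultimately have "(walk T ^^ Suc k) x = root T"
        by (simp add: funpow_Suc_right del: funpow.simps)
      then show ?thesis ..
    qed
  qed
  with assms show "is_tree T"
    by (simp add: is_tree_def is_singleton_def)
qed

section \<open>Ideal subtrees, and subtrees that contain the root\<close>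

definition ideal_edges :: "('u, 'z) tree_scheme \<Rightarrow> 'u \<Rightarrow> 'u set" where
  "ideal_edges T l = {x \<in> edges T. \<exists>k. (walk T ^^ k) x = l}"

definition ideal_nodes :: "('u, 'z) tree_scheme \<Rightarrow> 'u \<Rightarrow> 'u set" where
  "ideal_nodes T l = {n \<in> nodes T. tmap T n \<in> ideal_edges T l}"

text \<open>The pullback square in the definition of an embedding forces a subtree to contain all
  marks of each of its nodes, so the marks of a subtree need not be recorded separately.\<close>

definition marks_over :: "('u, 'z) tree_scheme \<Rightarrow> 'u set \<Rightarrow> 'u set" where
  "marks_over T N = {m \<in> marks T. pmap T m \<in> N}"

lemma ideal_edges_self: "l \<in> edges T \<Longrightarrow> l \<in> ideal_edges T l"
  unfolding ideal_edges_def by (auto intro: exI[of _ 0])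

lemma ideal_edges_root: "is_tree T \<Longrightarrow> root T \<in> ideal_edges T l \<longleftrightarrow> root T = l"
  by (auto simp: ideal_edges_def funpow_walk_root root_in)

text \<open>Together with \<open>ideal_edges_root\<close> this is a recursive description of the
  edges above \<open>l\<close>, which replaces iterates of \<open>walk\<close> in the later
  inductions.\<close>

lemma ideal_edges_smap:
  assumes "is_tree T" "m \<in> marks T"
  shows "smap T m \<in> ideal_edges T l \<longleftrightarrow> smap T m = l \<or> tmap T (pmap T m) \<in> ideal_edges T l"
proof -
  have "(\<exists>k. (walk T ^^ k) (smap T m) = l) \<longleftrightarrow> smap T m = l \<or> (\<exists>k. (walk T ^^ k) (tmap T (pmap T m)) = l)"
    (is "?L \<longleftrightarrow> ?R")
  proof
    assume ?L
    then obtain k where k: "(walk T ^^ k) (smap T m) = l" ..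
    then show ?R
      by (cases k) (auto simp: funpow_Suc_right walk_smap[OF assms] simp del: funpow.simps(2))
  next
    assume ?R
    then show ?L
    proof
      assume "\<exists>k. (walk T ^^ k) (tmap T (pmap T m)) = l"
      then obtain k where "(walk T ^^ Suc k) (smap T m) = l"
        by (auto simp: funpow_Suc_right walk_smap[OF assms] simp del: funpow.simps(2))
      then show ?L ..
    qed (auto intro: exI[of _ 0])
  qed
  then show ?thesis
    using assms by (auto simp: ideal_edges_def smap_in tmap_in pmap_in)
qed

lemma ideal_edges_height:
  assumes "is_tree T" "\<And>m. m \<in> marks T \<Longrightarrow> (d (tmap T (pmap T m)) :: nat) < d (smap T m)"
    and "x \<in> ideal_edges T l"
  shows "d l \<le> d x"
proof -
  have "x \<in> edges T"
    using assms(3) by (simp add: ideal_edges_def)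
  with assms(1) have "x \<in> ideal_edges T l \<longrightarrow> d l \<le> d x"
  proof (induction rule: tree_induct)
    case root
    then show ?case using assms(1) by (simp add: ideal_edges_root)
  next
    case (smap m)
    then show ?case using assms(1,2) by (auto simp: ideal_edges_smap intro: order.strict_implies_order le_less_trans)
  qed
  with assms(3) show ?thesis by blast
qed

text \<open>An edge above \<open>l\<close> is at least as high as \<open>l\<close>, but the parent
  of an edge is strictly lower. This is why \<open>l\<close> becomes the root of its ideal
  subtree.\<close>

lemma parent_notin_ideal_edges:
  assumes "is_tree T" "m \<in> marks T"
  shows "tmap T (pmap T m) \<notin> ideal_edges T (smap T m)"
proof -
  obtain d where d: "\<And>m. m \<in> marks T \<Longrightarrow> (d (tmap T (pmap T m)) :: nat) < d (smap T m)"
    using tree_height[OF assms(1)] by blast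
  from ideal_edges_height[OF assms(1) this, where x = "tmap T (pmap T m)" and l = "smap T m"] d[OF assms(2)]
  show ?thesis by auto
qed

text \<open>Both the subtree of a cut and the ideal subtrees are of this form.\<close>

definition spans :: "('u, 'z) tree_scheme \<Rightarrow> 'u set \<Rightarrow> 'u set \<Rightarrow> 'u \<Rightarrow> bool" where
  "spans T A N r \<longleftrightarrow> A \<subseteq> edges T \<and> N \<subseteq> nodes T \<and> tmap T ` N \<subseteq> A \<and>
    smap T ` marks_over T N \<subseteq> A \<and> A - smap T ` marks_over T N = {r}"

text \<open>An edge above \<open>l\<close> and different from \<open>l\<close> has its parent above
  \<open>l\<close>, so its mark lies over a node of the ideal subtree. The edge \<open>l\<close> is
  the only exception, as its parent is not above it.\<close>

lemma spans_ideal: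
  assumes T: "is_tree T" and l: "l \<in> edges T"
  shows "spans T (ideal_edges T l) (ideal_nodes T l) l"
proof -
  let ?M = "marks_over T (ideal_nodes T l)"
  have M: "m \<in> ?M \<longleftrightarrow> m \<in> marks T \<and> tmap T (pmap T m) \<in> ideal_edges T l" for m
    using T by (auto simp: marks_over_def ideal_nodes_def pmap_in)
  have "x = l" if "x \<in> ideal_edges T l" "x \<notin> smap T ` ?M" for x
  proof -
    have "x \<in> edges T" using that by (simp add: ideal_edges_def)
    with T show ?thesis
    proof (cases rule: edge_cases)
      case 1
      then show ?thesis using that T by (simp add: ideal_edges_root)
    next
      case (2 m)
      then show ?thesis using that M[of m] T by (auto simp: ideal_edges_smap)
    qed
  qed
  moreover have "l \<notin> smap T ` ?M"
    using parent_notin_ideal_edges[OF T] M by auto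
  ultimately have "ideal_edges T l - smap T ` ?M = {l}"
    using ideal_edges_self[OF l] by auto
  then show ?thesis
    using M by (auto simp: spans_def ideal_nodes_def ideal_edges_smap[OF T]) (auto simp: ideal_edges_def)
qed

text \<open>These are the node sets of subtrees containing the root: below every node of
  \<open>N\<close> there is the root or another node of \<open>N\<close>. The empty set is allowed
  and gives the tree whose only edge is the root.\<close>

definition closed_nodes :: "('u, 'z) tree_scheme \<Rightarrow> 'u set \<Rightarrow> bool" where
  "closed_nodes T N \<longleftrightarrow> N \<subseteq> nodes T \<and> (\<forall>n\<in>N. tmap T n = root T \<or> tmap T n \<in> smap T ` marks_over T N)"

text \<open>The root is added separately because it is not an input edge of any node and must be
  present even when \<open>N\<close> is empty.\<close>

definition edges_over :: "('u, 'z) tree_scheme \<Rightarrow> 'u set \<Rightarrow> 'u set" where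
  "edges_over T N = insert (root T) (smap T ` marks_over T N)"

lemma spans_closed:
  assumes "is_tree T" "closed_nodes T N"
  shows "spans T (edges_over T N) N (root T)"
proof -
  have "root T \<notin> smap T ` marks_over T N"
    using smap_neq_root[OF assms(1)] by (force simp: marks_over_def)
  then show ?thesis
    using assms root_in[OF assms(1)]
    by (auto simp: spans_def edges_over_def closed_nodes_def marks_over_def smap_in)
qed

lemma smap_edges_over:
  assumes "is_tree T" "m \<in> marks T"
  shows "smap T m \<in> edges_over T N \<longleftrightarrow> pmap T m \<in> N"
  using assms smap_neq_root[OF assms] inj_onD[OF inj_smap[OF assms(1)]]
  by (auto simp: edges_over_def marks_over_def)

lemma tmap_edges_over: "closed_nodes T N \<Longrightarrow> n \<in> N \<Longrightarrow> tmap T n \<in> edges_over T N"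
  by (auto simp: closed_nodes_def edges_over_def)

text \<open>The leaf is the first edge of the subtree met on the walk down from \<open>x\<close>. If
  the parent of an edge outside lies in the subtree, then that parent is a leaf: it is the output
  edge of a node not in \<open>N\<close>, and \<open>tmap\<close> is injective.\<close>

lemma edge_above_leaf:
  assumes T: "is_tree T" and N: "closed_nodes T N" and x: "x \<in> edges T" "x \<notin> edges_over T N"
  shows "\<exists>l \<in> edges_over T N - tmap T ` N. x \<in> ideal_edges T l"
  using T x
proof (induction rule: tree_induct)
  case root
  then show ?case by (simp add: edges_over_def)
next
  case (smap m)
  then have m: "pmap T m \<notin> N"
    using smap_edges_over[OF T] by blast
  show ?case
  proof (cases "tmap T (pmap T m) \<in> edges_over T N")
    case True
    have "tmap T (pmap T m) \<notin> tmap T ` N"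
      using m inj_onD[OF inj_tmap[OF T]] pmap_in[OF T smap.hyps] N by (auto simp: closed_nodes_def)
    moreover have "tmap T (pmap T m) \<in> ideal_edges T (tmap T (pmap T m))"
      by (intro ideal_edges_self tmap_in[OF T] pmap_in[OF T] smap.hyps)
    ultimately show ?thesis
      using True ideal_edges_smap[OF T smap.hyps] by blast
  next
    case False
    then show ?thesis
      using smap.IH ideal_edges_smap[OF T smap.hyps] by blast
  qed
qed

text \<open>If such an \<open>x\<close> were not \<open>l\<close>, its parent would again lie in
  both sets and so, inductively, be \<open>l\<close>. But the parent is the output edge of a node of
  \<open>N\<close>, and a leaf is not.\<close>

lemma ideal_edges_Int_edges_over:
  assumes T: "is_tree T" and N: "closed_nodes T N" and l: "l \<in> edges_over T N - tmap T ` N"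
    and x: "x \<in> ideal_edges T l" "x \<in> edges_over T N"
  shows "x = l"
proof -
  have "x \<in> edges T" using x by (simp add: ideal_edges_def)
  from T this x show ?thesis
  proof (induction rule: tree_induct)
    case root
    then show ?case using T by (simp add: ideal_edges_root)
  next
    case (smap m)
    then have "pmap T m \<in> N"
      using smap_edges_over[OF T] by blast
    then have "tmap T (pmap T m) \<in> edges_over T N" "tmap T (pmap T m) \<noteq> l"
      using tmap_edges_over[OF N] l by auto
    then show ?case
      using smap ideal_edges_smap[OF T] by blast
  qed
qed

text \<open>A common edge that is neither \<open>l\<close> nor \<open>l'\<close> has a common
  parent. If it is one of the two leaves, it lies in the subtree and
  \<open>ideal_edges_Int_edges_over\<close> applies to the other one.\<close>

lemma ideal_edges_disjoint:
  assumes T: "is_tree T" and N: "closed_nodes T N"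
    and l: "l \<in> edges_over T N - tmap T ` N" "l' \<in> edges_over T N - tmap T ` N"
    and x: "x \<in> ideal_edges T l" "x \<in> ideal_edges T l'"
  shows "l = l'"
proof -
  have "x \<in> edges T" using x by (simp add: ideal_edges_def)
  from T this x show ?thesis
  proof (induction rule: tree_induct)
    case root
    then show ?case using ideal_edges_root[OF T, of l] ideal_edges_root[OF T, of l'] by simp
  next
    case (smap m)
    then show ?case
      using ideal_edges_smap[OF T] ideal_edges_Int_edges_over[OF T N] l by (metis DiffD1)
  qed
qed

section \<open>\<open>P\<close>-trees\<close>

lemma bij_betw_the_inv_into_props:
  assumes "bij_betw f A B"
  shows "y \<in> B \<Longrightarrow> the_inv_into A f y \<in> A" "y \<in> B \<Longrightarrow> f (the_inv_into A f y) = y"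
    "x \<in> A \<Longrightarrow> the_inv_into A f (f x) = x"
  using assms by (auto simp: bij_betw_def f_the_inv_into_f the_inv_into_f_f intro: the_inv_into_into)

lemma ptree_embeddingD:
  assumes "ptree_embedding P S T f"
  shows emap_in: "x \<in> edges S \<Longrightarrow> emap f x \<in> edges T"
    and mmap_in: "m \<in> marks S \<Longrightarrow> mmap f m \<in> marks T"
    and nmap_in: "n \<in> nodes S \<Longrightarrow> nmap f n \<in> nodes T"
    and emap_smap: "m \<in> marks S \<Longrightarrow> emap f (smap S m) = smap T (mmap f m)"
    and nmap_pmap: "m \<in> marks S \<Longrightarrow> nmap f (pmap S m) = pmap T (mmap f m)"
    and emap_tmap: "n \<in> nodes S \<Longrightarrow> emap f (tmap S n) = tmap T (nmap f n)"
    and mark_lift: "\<lbrakk>n \<in> nodes S; m' \<in> marks T; nmap f n = pmap T m'\<rbrakk>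
      \<Longrightarrow> \<exists>!m. m \<in> marks S \<and> pmap S m = n \<and> mmap f m = m'"
    and eiso_Hom: "x \<in> edges S \<Longrightarrow> eiso f x \<in> Hom (gpdI P) (ecol S x) (ecol T (emap f x))"
    and miso_Hom: "m \<in> marks S \<Longrightarrow> miso f m \<in> Hom (gpdE P) (mcol S m) (mcol T (mmap f m))"
    and niso_Hom: "n \<in> nodes S \<Longrightarrow> niso f n \<in> Hom (gpdB P) (ncol S n) (ncol T (nmap f n))"
    and siso_nat: "m \<in> marks S \<Longrightarrow> siso T (mmap f m) \<cdot>\<^bsub>gpdI P\<^esub> eiso f (smap S m)
      = amap (funS P) (miso f m) \<cdot>\<^bsub>gpdI P\<^esub> siso S m"
    and piso_nat: "m \<in> marks S \<Longrightarrow> piso T (mmap f m) \<cdot>\<^bsub>gpdB P\<^esub> amap (funP P) (miso f m)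
      = niso f (pmap S m) \<cdot>\<^bsub>gpdB P\<^esub> piso S m"
    and tiso_nat: "n \<in> nodes S \<Longrightarrow> tiso T (nmap f n) \<cdot>\<^bsub>gpdI P\<^esub> amap (funT P) (niso f n)
      = eiso f (tmap S n) \<cdot>\<^bsub>gpdI P\<^esub> tiso S n"
    and embedding_extensional: "emap f \<in> extensional (edges S)" "mmap f \<in> extensional (marks S)"
      "nmap f \<in> extensional (nodes S)" "eiso f \<in> extensional (edges S)"
      "miso f \<in> extensional (marks S)" "niso f \<in> extensional (nodes S)"
  using assms unfolding ptree_embedding_def tree_embedding_def PiE_iff by blast+

lemma ptree_embeddingI:
  assumes "\<And>x. x \<in> edges S \<Longrightarrow> emap f x \<in> edges T"
    "\<And>m. m \<in> marks S \<Longrightarrow> mmap f m \<in> marks T"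
    "\<And>n. n \<in> nodes S \<Longrightarrow> nmap f n \<in> nodes T"
    "\<And>m. m \<in> marks S \<Longrightarrow> emap f (smap S m) = smap T (mmap f m)"
    "\<And>m. m \<in> marks S \<Longrightarrow> nmap f (pmap S m) = pmap T (mmap f m)"
    "\<And>n. n \<in> nodes S \<Longrightarrow> emap f (tmap S n) = tmap T (nmap f n)"
    "\<And>n m'. \<lbrakk>n \<in> nodes S; m' \<in> marks T; nmap f n = pmap T m'\<rbrakk>
      \<Longrightarrow> \<exists>!m. m \<in> marks S \<and> pmap S m = n \<and> mmap f m = m'"
    "\<And>x. x \<in> edges S \<Longrightarrow> eiso f x \<in> Hom (gpdI P) (ecol S x) (ecol T (emap f x))"
    "\<And>m. m \<in> marks S \<Longrightarrow> miso f m \<in> Hom (gpdE P) (mcol S m) (mcol T (mmap f m))"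
    "\<And>n. n \<in> nodes S \<Longrightarrow> niso f n \<in> Hom (gpdB P) (ncol S n) (ncol T (nmap f n))"
    "\<And>m. m \<in> marks S \<Longrightarrow> siso T (mmap f m) \<cdot>\<^bsub>gpdI P\<^esub> eiso f (smap S m)
      = amap (funS P) (miso f m) \<cdot>\<^bsub>gpdI P\<^esub> siso S m"
    "\<And>m. m \<in> marks S \<Longrightarrow> piso T (mmap f m) \<cdot>\<^bsub>gpdB P\<^esub> amap (funP P) (miso f m)
      = niso f (pmap S m) \<cdot>\<^bsub>gpdB P\<^esub> piso S m"
    "\<And>n. n \<in> nodes S \<Longrightarrow> tiso T (nmap f n) \<cdot>\<^bsub>gpdI P\<^esub> amap (funT P) (niso f n)
      = eiso f (tmap S n) \<cdot>\<^bsub>gpdI P\<^esub> tiso S n"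
    "emap f \<in> extensional (edges S)" "mmap f \<in> extensional (marks S)"
      "nmap f \<in> extensional (nodes S)" "eiso f \<in> extensional (edges S)"
      "miso f \<in> extensional (marks S)" "niso f \<in> extensional (nodes S)"
  shows "ptree_embedding P S T f"
  unfolding ptree_embedding_def tree_embedding_def PiE_iff
  by (intro conjI ballI allI impI; (rule assms; assumption)?)

text \<open>The reason why \<open>ptree_isoI\<close> needs no separate check of the pullback square:
  the preimage of the mark lies over \<open>n\<close> because the map on nodes is injective.\<close>

lemma mark_lift_bij:
  assumes "bij_betw (mmap f) (marks S) (marks T)" "bij_betw (nmap f) (nodes S) (nodes T)"
    and "\<And>m. m \<in> marks S \<Longrightarrow> nmap f (pmap S m) = pmap T (mmap f m)"
    and "\<And>m. m \<in> marks S \<Longrightarrow> pmap S m \<in> nodes S"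
    and "n \<in> nodes S" "m' \<in> marks T" "nmap f n = pmap T m'"
  shows "\<exists>!m. m \<in> marks S \<and> pmap S m = n \<and> mmap f m = m'"
proof -
  have "m' \<in> mmap f ` marks S"
    using assms(1,6) by (simp add: bij_betw_def)
  then obtain m where m: "m \<in> marks S" "m' = mmap f m" ..
  then have "nmap f (pmap S m) = nmap f n"
    using assms(3,7) by simp
  then have "pmap S m = n"
    using inj_onD[OF bij_betw_imp_inj_on[OF assms(2)]] assms(4,5) m(1) by blast
  with m show ?thesis
    using inj_onD[OF bij_betw_imp_inj_on[OF assms(1)]] by blast
qed

lemma ptree_isoD:
  assumes "ptree_iso P S T f"
  shows iso_embedding: "ptree_embedding P S T f"
    and bij_emap: "bij_betw (emap f) (edges S) (edges T)"
    and bij_mmap: "bij_betw (mmap f) (marks S) (marks T)"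
    and bij_nmap: "bij_betw (nmap f) (nodes S) (nodes T)"
  using assms by (auto simp: ptree_iso_def)

lemma ptree_map_eqI:
  fixes f g :: "('u, 'ia, 'ea, 'ba) ptree_map"
  assumes "ptree_embedding P S T f" "ptree_embedding P S T' g"
    "\<And>x. x \<in> edges S \<Longrightarrow> emap f x = emap g x" "\<And>x. x \<in> marks S \<Longrightarrow> mmap f x = mmap g x"
    "\<And>x. x \<in> nodes S \<Longrightarrow> nmap f x = nmap g x" "\<And>x. x \<in> edges S \<Longrightarrow> eiso f x = eiso g x"
    "\<And>x. x \<in> marks S \<Longrightarrow> miso f x = miso g x" "\<And>x. x \<in> nodes S \<Longrightarrow> niso f x = niso g x"
  shows "f = g"
  using embedding_extensional[OF assms(1)] embedding_extensional[OF assms(2)] assms(3-)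
  by (intro ptree_map.equality) (auto intro: extensionalityI)

lemma restrict_ptree_simps [simp]:
  "edges (restrict_ptree T A M N) = A" "marks (restrict_ptree T A M N) = M"
  "nodes (restrict_ptree T A M N) = N" "smap (restrict_ptree T A M N) = restrict (smap T) M"
  "pmap (restrict_ptree T A M N) = restrict (pmap T) M"
  "tmap (restrict_ptree T A M N) = restrict (tmap T) N"
  "ecol (restrict_ptree T A M N) = restrict (ecol T) A"
  "mcol (restrict_ptree T A M N) = restrict (mcol T) M"
  "ncol (restrict_ptree T A M N) = restrict (ncol T) N"
  "siso (restrict_ptree T A M N) = restrict (siso T) M"
  "piso (restrict_ptree T A M N) = restrict (piso T) M"
  "tiso (restrict_ptree T A M N) = restrict (tiso T) N"
  by (simp_all add: restrict_ptree_def)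

lemma restrict_ptree_map_simps [simp]:
  "emap (restrict_ptree_map S f) = restrict (emap f) (edges S)"
  "mmap (restrict_ptree_map S f) = restrict (mmap f) (marks S)"
  "nmap (restrict_ptree_map S f) = restrict (nmap f) (nodes S)"
  "eiso (restrict_ptree_map S f) = restrict (eiso f) (edges S)"
  "miso (restrict_ptree_map S f) = restrict (miso f) (marks S)"
  "niso (restrict_ptree_map S f) = restrict (niso f) (nodes S)"
  by (simp_all add: restrict_ptree_map_def)

lemma ptree_id_simps [simp]:
  "emap (ptree_id P S) = (\<lambda>x\<in>edges S. x)" "mmap (ptree_id P S) = (\<lambda>m\<in>marks S. m)"
  "nmap (ptree_id P S) = (\<lambda>n\<in>nodes S. n)"
  "eiso (ptree_id P S) = (\<lambda>x\<in>edges S. Ident (gpdI P) (ecol S x))"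
  "miso (ptree_id P S) = (\<lambda>m\<in>marks S. Ident (gpdE P) (mcol S m))"
  "niso (ptree_id P S) = (\<lambda>n\<in>nodes S. Ident (gpdB P) (ncol S n))"
  by (simp_all add: ptree_id_def)

lemma ptree_comp_simps [simp]:
  "emap (ptree_comp P S g f) = (\<lambda>x\<in>edges S. emap g (emap f x))"
  "mmap (ptree_comp P S g f) = (\<lambda>m\<in>marks S. mmap g (mmap f m))"
  "nmap (ptree_comp P S g f) = (\<lambda>n\<in>nodes S. nmap g (nmap f n))"
  "eiso (ptree_comp P S g f) = (\<lambda>x\<in>edges S. eiso g (emap f x) \<cdot>\<^bsub>gpdI P\<^esub> eiso f x)"
  "miso (ptree_comp P S g f) = (\<lambda>m\<in>marks S. miso g (mmap f m) \<cdot>\<^bsub>gpdE P\<^esub> miso f m)"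
  "niso (ptree_comp P S g f) = (\<lambda>n\<in>nodes S. niso g (nmap f n) \<cdot>\<^bsub>gpdB P\<^esub> niso f n)"
  by (simp_all add: ptree_comp_def)

locale polynomial =
  fixes P :: "('i, 'ia, 'e, 'ea, 'b, 'ba) poly"
  assumes is_poly: "is_poly P"

text \<open>In the proofs below \<open>s.Y\<close> is the groupoid \<open>gpdI P\<close>,
  \<open>s.X\<close> is \<open>gpdE P\<close> and \<open>p.Y\<close> is
  \<open>gpdB P\<close>.\<close>

sublocale polynomial \<subseteq> s: gfunctor "gpdE P" "gpdI P" "funS P"
  using is_poly by (simp add: is_poly_def)

sublocale polynomial \<subseteq> p: gfunctor "gpdE P" "gpdB P" "funP P"
  using is_poly by (simp add: is_poly_def)

sublocale polynomial \<subseteq> t: gfunctor "gpdB P" "gpdI P" "funT P"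
  using is_poly by (simp add: is_poly_def)

text \<open>The part of the homotopy pullback condition that belongs to a single node, in the form
  given by \<open>is_hpullback_disc_iff\<close>.\<close>

definition local_pullback :: "('i, 'ia, 'e, 'ea, 'b, 'ba) poly \<Rightarrow> ('u, 'i, 'ia, 'e, 'b, 'ba) ptree \<Rightarrow> 'u \<Rightarrow> bool" where
  "local_pullback P T n \<longleftrightarrow> (\<forall>e\<in>Obj (gpdE P). \<forall>\<phi>\<in>Hom (gpdB P) (omap (funP P) e) (ncol T n).
    \<exists>!(m, a). m \<in> marks T \<and> pmap T m = n \<and> a \<in> Hom (gpdE P) (mcol T m) e \<and>
      \<phi> \<cdot>\<^bsub>gpdB P\<^esub> amap (funP P) a = piso T m)"

text \<open>The map \<open>h\<close> matches the marks of \<open>n\<close> with those of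
  \<open>n'\<close> without changing their colours. It is the identity for restriction and gluing,
  and a renaming for copies.\<close>

lemma local_pullback_cong:
  assumes "ncol T n = ncol T' n'"
    and "\<And>m. m \<in> marks T \<Longrightarrow> pmap T m = n \<Longrightarrow> h m \<in> marks T' \<and> pmap T' (h m) = n' \<and>
      mcol T' (h m) = mcol T m \<and> piso T' (h m) = piso T m"
    and "\<And>m'. m' \<in> marks T' \<Longrightarrow> pmap T' m' = n' \<Longrightarrow> \<exists>!m. m \<in> marks T \<and> pmap T m = n \<and> h m = m'"
    and "local_pullback P T n"
  shows "local_pullback P T' n'"
  unfolding local_pullback_def
proof (intro ballI)
  fix e \<phi> assume e: "e \<in> Obj (gpdE P)" and \<phi>: "\<phi> \<in> Hom (gpdB P) (omap (funP P) e) (ncol T' n')"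
  let ?Q = "\<lambda>(m, a). m \<in> marks T \<and> pmap T m = n \<and> a \<in> Hom (gpdE P) (mcol T m) e \<and>
      \<phi> \<cdot>\<^bsub>gpdB P\<^esub> amap (funP P) a = piso T m"
  have "\<exists>!q. ?Q q"
    using assms(1,4) e \<phi> by (simp add: local_pullback_def)
  then obtain q where q: "?Q q" "\<And>q'. ?Q q' \<Longrightarrow> q' = q"
    by (elim ex1E) blast
  obtain m a where qma: "q = (m, a)" by (cases q)
  with q(1) have m: "m \<in> marks T" "pmap T m = n" "a \<in> Hom (gpdE P) (mcol T m) e"
      "\<phi> \<cdot>\<^bsub>gpdB P\<^esub> amap (funP P) a = piso T m"
    by simp_all
  have uniq: "m' = m \<and> a' = a" if "m' \<in> marks T" "pmap T m' = n" "a' \<in> Hom (gpdE P) (mcol T m') e"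
      "\<phi> \<cdot>\<^bsub>gpdB P\<^esub> amap (funP P) a' = piso T m'" for m' a'
  proof -
    have "?Q (m', a')"
      using that by simp
    from q(2)[OF this] show ?thesis
      unfolding qma by simp
  qed
  show "\<exists>!(m, a). m \<in> marks T' \<and> pmap T' m = n' \<and> a \<in> Hom (gpdE P) (mcol T' m) e \<and>
      \<phi> \<cdot>\<^bsub>gpdB P\<^esub> amap (funP P) a = piso T' m"
  proof (rule ex1I[of _ "(h m, a)"])
    show "case (h m, a) of (m, a) \<Rightarrow> m \<in> marks T' \<and> pmap T' m = n' \<and> a \<in> Hom (gpdE P) (mcol T' m) e \<and>
      \<phi> \<cdot>\<^bsub>gpdB P\<^esub> amap (funP P) a = piso T' m"
      using m assms(2)[OF m(1,2)] by simp
    fix y assume y: "case y of (m, a) \<Rightarrow> m \<in> marks T' \<and> pmap T' m = n' \<and> a \<in> Hom (gpdE P) (mcol T' m) e \<and>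
      \<phi> \<cdot>\<^bsub>gpdB P\<^esub> amap (funP P) a = piso T' m"
    obtain m'' a' where [simp]: "y = (m'', a')" by (cases y)
    from y have "m'' \<in> marks T'" "pmap T' m'' = n'" by auto
    with assms(3) obtain m' where m': "m' \<in> marks T" "pmap T m' = n" "h m' = m''" by blast
    with y uniq[of m' a'] assms(2)[OF m'(1,2)] show "y = (h m, a)"
      by simp
  qed
qed

context polynomial
begin

lemma is_ptree_iff:
  "is_ptree P T \<longleftrightarrow> is_tree T \<and>
    ecol T \<in> edges T \<rightarrow>\<^sub>E Obj (gpdI P) \<and>
    mcol T \<in> marks T \<rightarrow>\<^sub>E Obj (gpdE P) \<and>
    ncol T \<in> nodes T \<rightarrow>\<^sub>E Obj (gpdB P) \<and>
    siso T \<in> (\<Pi>\<^sub>E m\<in>marks T. Hom (gpdI P) (ecol T (smap T m)) (omap (funS P) (mcol T m))) \<and>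
    piso T \<in> (\<Pi>\<^sub>E m\<in>marks T. Hom (gpdB P) (omap (funP P) (mcol T m)) (ncol T (pmap T m))) \<and>
    tiso T \<in> (\<Pi>\<^sub>E n\<in>nodes T. Hom (gpdI P) (omap (funT P) (ncol T n)) (ecol T (tmap T n))) \<and>
    (\<forall>n\<in>nodes T. local_pullback P T n)"
\<comment> \<open>The case condition collects what \<open>is_hpullback_disc_iff\<close> requires.
  Without it both sides of the equivalence are false.\<close>
proof (cases "is_tree T \<and> mcol T \<in> marks T \<rightarrow>\<^sub>E Obj (gpdE P) \<and> ncol T \<in> nodes T \<rightarrow>\<^sub>E Obj (gpdB P) \<and>
    piso T \<in> (\<Pi>\<^sub>E m\<in>marks T. Hom (gpdB P) (omap (funP P) (mcol T m)) (ncol T (pmap T m)))")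
  case True
  have "is_hpullback (disc_gpd (marks T)) (gpdE P) (disc_gpd (nodes T)) (gpdB P)
      (disc_fun (gpdE P) (mcol T)) (disc_fun (disc_gpd (nodes T)) (pmap T))
      (funP P) (disc_fun (gpdB P) (ncol T)) (piso T) \<longleftrightarrow> (\<forall>n\<in>nodes T. local_pullback P T n)"
    unfolding local_pullback_def
    by (rule is_hpullback_disc_iff[OF p.gfunctor_axioms]) (use True pmap_in in \<open>auto simp: PiE_iff\<close>)
  then show ?thesis
    by (simp add: is_ptree_def)
qed (auto simp: is_ptree_def)

lemma ptreeD:
  assumes "is_ptree P T"
  shows ptree_tree: "is_tree T"
    and ecol_Obj: "x \<in> edges T \<Longrightarrow> ecol T x \<in> Obj (gpdI P)"
    and mcol_Obj: "m \<in> marks T \<Longrightarrow> mcol T m \<in> Obj (gpdE P)"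
    and ncol_Obj: "n \<in> nodes T \<Longrightarrow> ncol T n \<in> Obj (gpdB P)"
    and siso_Hom: "m \<in> marks T \<Longrightarrow> siso T m \<in> Hom (gpdI P) (ecol T (smap T m)) (omap (funS P) (mcol T m))"
    and piso_Hom: "m \<in> marks T \<Longrightarrow> piso T m \<in> Hom (gpdB P) (omap (funP P) (mcol T m)) (ncol T (pmap T m))"
    and tiso_Hom: "n \<in> nodes T \<Longrightarrow> tiso T n \<in> Hom (gpdI P) (omap (funT P) (ncol T n)) (ecol T (tmap T n))"
    and ptree_pullback: "n \<in> nodes T \<Longrightarrow> local_pullback P T n"
    and ptree_extensional: "smap T \<in> extensional (marks T)" "pmap T \<in> extensional (marks T)"
      "tmap T \<in> extensional (nodes T)" "ecol T \<in> extensional (edges T)" "mcol T \<in> extensional (marks T)"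
      "ncol T \<in> extensional (nodes T)" "siso T \<in> extensional (marks T)"
      "piso T \<in> extensional (marks T)" "tiso T \<in> extensional (nodes T)"
  using assms by (auto simp: is_ptree_iff PiE_iff is_tree_def)

lemma ptree_isoI:
  assumes "is_ptree P S" "is_ptree P T"
    "bij_betw (emap f) (edges S) (edges T)" "bij_betw (mmap f) (marks S) (marks T)"
    "bij_betw (nmap f) (nodes S) (nodes T)"
    "\<And>m. m \<in> marks S \<Longrightarrow> emap f (smap S m) = smap T (mmap f m)"
    "\<And>m. m \<in> marks S \<Longrightarrow> nmap f (pmap S m) = pmap T (mmap f m)"
    "\<And>n. n \<in> nodes S \<Longrightarrow> emap f (tmap S n) = tmap T (nmap f n)"
    "\<And>x. x \<in> edges S \<Longrightarrow> eiso f x \<in> Hom (gpdI P) (ecol S x) (ecol T (emap f x))"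
    "\<And>m. m \<in> marks S \<Longrightarrow> miso f m \<in> Hom (gpdE P) (mcol S m) (mcol T (mmap f m))"
    "\<And>n. n \<in> nodes S \<Longrightarrow> niso f n \<in> Hom (gpdB P) (ncol S n) (ncol T (nmap f n))"
    "\<And>m. m \<in> marks S \<Longrightarrow> siso T (mmap f m) \<cdot>\<^bsub>gpdI P\<^esub> eiso f (smap S m)
      = amap (funS P) (miso f m) \<cdot>\<^bsub>gpdI P\<^esub> siso S m"
    "\<And>m. m \<in> marks S \<Longrightarrow> piso T (mmap f m) \<cdot>\<^bsub>gpdB P\<^esub> amap (funP P) (miso f m)
      = niso f (pmap S m) \<cdot>\<^bsub>gpdB P\<^esub> piso S m"
    "\<And>n. n \<in> nodes S \<Longrightarrow> tiso T (nmap f n) \<cdot>\<^bsub>gpdI P\<^esub> amap (funT P) (niso f n)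
      = eiso f (tmap S n) \<cdot>\<^bsub>gpdI P\<^esub> tiso S n"
    "emap f \<in> extensional (edges S)" "mmap f \<in> extensional (marks S)"
      "nmap f \<in> extensional (nodes S)" "eiso f \<in> extensional (edges S)"
      "miso f \<in> extensional (marks S)" "niso f \<in> extensional (nodes S)"
  shows "ptree_iso P S T f"
  unfolding ptree_iso_def
proof (intro conjI ptree_embeddingI)
  fix n m' assume "n \<in> nodes S" "m' \<in> marks T" "nmap f n = pmap T m'"
  then show "\<exists>!m. m \<in> marks S \<and> pmap S m = n \<and> mmap f m = m'"
    using mark_lift_bij[OF assms(4,5,7) pmap_in[OF ptree_tree[OF assms(1)]]] by blast
qed (use assms bij_betwE[OF assms(3)] bij_betwE[OF assms(4)] bij_betwE[OF assms(5)] in auto)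

lemma ptree_id_embedding: "is_ptree P S \<Longrightarrow> ptree_embedding P S S (ptree_id P S)"
  using is_treeD(1-3)[OF ptree_tree[of S]]
  by (intro ptree_embeddingI)
    (auto simp: s.X.Ident_Hom s.Y.Ident_Hom p.Y.Ident_Hom s.amap_Ident p.amap_Ident t.amap_Ident
      ecol_Obj mcol_Obj ncol_Obj
      s.Y.Ident_left[OF siso_Hom] s.Y.Ident_right[OF siso_Hom] p.Y.Ident_left[OF piso_Hom]
      p.Y.Ident_right[OF piso_Hom] s.Y.Ident_left[OF tiso_Hom] s.Y.Ident_right[OF tiso_Hom])

lemma ptree_comp_embedding:
  assumes S: "is_ptree P S" and T: "is_ptree P T" and U: "is_ptree P U"
    and f: "ptree_embedding P S T f" and g: "ptree_embedding P T U g"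
  shows "ptree_embedding P S U (ptree_comp P S g f)"
proof (rule ptree_embeddingI, goal_cases)
  case (7 n m')
  \<comment> \<open>The pullback squares are pasted: the mark is lifted through \<open>g\<close>
    over \<open>nmap f n\<close>, and the result through \<open>f\<close> over \<open>n\<close>.
    Both lifts are unique.\<close>
  then have "nmap g (nmap f n) = pmap U m'" by simp
  from mark_lift[OF g nmap_in[OF f 7(1)] 7(2) this]
  obtain m where m: "m \<in> marks T" "pmap T m = nmap f n" "mmap g m = m'"
    and m_uniq: "\<And>k. k \<in> marks T \<Longrightarrow> pmap T k = nmap f n \<Longrightarrow> mmap g k = m' \<Longrightarrow> k = m"
    by blast
  from mark_lift[OF f 7(1) m(1)] m(2)
  have "\<exists>!k. k \<in> marks S \<and> pmap S k = n \<and> mmap f k = m" by simp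
  moreover have "mmap g (mmap f k) = m' \<longleftrightarrow> mmap f k = m" if "k \<in> marks S" "pmap S k = n" for k
    using m m_uniq[of "mmap f k"] mmap_in[OF f that(1)] nmap_pmap[OF f that(1)] that(2) by auto
  ultimately show ?case
    by (smt (verit, ccfv_SIG) ptree_comp_simps(2) restrict_apply')
next
  case (11 m)
  note h = emap_in[OF f] mmap_in[OF f 11] smap_in[OF ptree_tree[OF S] 11]
  show ?case
    using 11 h s.Y.paste_squares[OF eiso_Hom[OF f h(3)] eiso_Hom[OF g h(1)[OF h(3)]]
        s.amap_Hom[OF miso_Hom[OF f 11]] s.amap_Hom[OF miso_Hom[OF g h(2)]] siso_Hom[OF S 11] _ _ siso_nat[OF f 11]]
      siso_Hom[OF T h(2)] siso_Hom[OF U mmap_in[OF g h(2)]] siso_nat[OF g h(2)]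
    by (simp add: emap_smap[OF f] emap_smap[OF g] s.amap_comp_Hom[OF miso_Hom[OF f 11] miso_Hom[OF g h(2)]])
next
  case (12 m)
  note h = nmap_in[OF f] mmap_in[OF f 12] pmap_in[OF ptree_tree[OF S] 12]
  show ?case
    using 12 h p.Y.paste_squares[OF p.amap_Hom[OF miso_Hom[OF f 12]] p.amap_Hom[OF miso_Hom[OF g h(2)]]
        niso_Hom[OF f h(3)] niso_Hom[OF g h(1)[OF h(3)]] piso_Hom[OF S 12] _ _ piso_nat[OF f 12]]
      piso_Hom[OF T h(2)] piso_Hom[OF U mmap_in[OF g h(2)]] piso_nat[OF g h(2)]
    by (simp add: nmap_pmap[OF f] nmap_pmap[OF g] p.amap_comp_Hom[OF miso_Hom[OF f 12] miso_Hom[OF g h(2)]])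
next
  case (13 n)
  note h = emap_in[OF f] nmap_in[OF f 13] tmap_in[OF ptree_tree[OF S] 13]
  show ?case
    using 13 h s.Y.paste_squares[OF t.amap_Hom[OF niso_Hom[OF f 13]] t.amap_Hom[OF niso_Hom[OF g h(2)]]
        eiso_Hom[OF f h(3)] eiso_Hom[OF g h(1)[OF h(3)]] tiso_Hom[OF S 13] _ _ tiso_nat[OF f 13]]
      tiso_Hom[OF T h(2)] tiso_Hom[OF U nmap_in[OF g h(2)]] tiso_nat[OF g h(2)]
    by (simp add: emap_tmap[OF f] emap_tmap[OF g] t.amap_comp_Hom[OF niso_Hom[OF f 13] niso_Hom[OF g h(2)]])
qed (use is_treeD(1-3)[OF ptree_tree[OF S]] in \<open>auto simp: ptree_embeddingD[OF f] ptree_embeddingD[OF g]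
    intro: s.Y.comp_Hom[OF eiso_Hom[OF f] eiso_Hom[OF g]] s.X.comp_Hom[OF miso_Hom[OF f] miso_Hom[OF g]]
      p.Y.comp_Hom[OF niso_Hom[OF f] niso_Hom[OF g]]\<close>)

lemma ptree_id_iso: "is_ptree P S \<Longrightarrow> ptree_iso P S S (ptree_id P S)"
  by (auto simp: ptree_iso_def ptree_id_embedding bij_betw_def inj_on_def)

lemma ptree_comp_iso:
  assumes "is_ptree P S" "is_ptree P T" "is_ptree P U" "ptree_iso P S T f" "ptree_iso P T U g"
  shows "ptree_iso P S U (ptree_comp P S g f)"
  using ptree_comp_embedding[OF assms(1-3)] assms(4,5)
    bij_betw_trans[OF bij_emap[OF assms(4)] bij_emap[OF assms(5)]]
    bij_betw_trans[OF bij_mmap[OF assms(4)] bij_mmap[OF assms(5)]]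
    bij_betw_trans[OF bij_nmap[OF assms(4)] bij_nmap[OF assms(5)]]
  by (simp add: ptree_iso_def comp_def)

lemma ptree_comp_assoc:
  assumes f: "ptree_embedding P S T f" and g: "ptree_embedding P T U g" and h: "ptree_embedding P U V h"
  shows "ptree_comp P S (ptree_comp P T h g) f = ptree_comp P S h (ptree_comp P S g f)"
  by (rule ptree_map.equality)
    (auto simp: fun_eq_iff restrict_def ptree_embeddingD[OF f] ptree_embeddingD[OF g]
      intro: s.Y.assoc_Hom[OF eiso_Hom[OF f] eiso_Hom[OF g] eiso_Hom[OF h]]
        s.X.assoc_Hom[OF miso_Hom[OF f] miso_Hom[OF g] miso_Hom[OF h]]
        p.Y.assoc_Hom[OF niso_Hom[OF f] niso_Hom[OF g] niso_Hom[OF h]])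

lemma ptree_comp_id_left:
  assumes f: "ptree_embedding P S T f"
  shows "ptree_comp P S (ptree_id P T) f = f"
  using embedding_extensional[OF f]
  by (intro ptree_map.equality)
    (auto simp: fun_eq_iff restrict_def ptree_embeddingD[OF f] extensional_def
      s.Y.Ident_left[OF eiso_Hom[OF f]] s.X.Ident_left[OF miso_Hom[OF f]] p.Y.Ident_left[OF niso_Hom[OF f]])

lemma ptree_comp_id_right:
  assumes f: "ptree_embedding P S T f"
  shows "ptree_comp P S f (ptree_id P S) = f"
  using embedding_extensional[OF f]
  by (intro ptree_map.equality)
    (auto simp: fun_eq_iff restrict_def ptree_embeddingD[OF f] extensional_def
      s.Y.Ident_right[OF eiso_Hom[OF f]] s.X.Ident_right[OF miso_Hom[OF f]] p.Y.Ident_right[OF niso_Hom[OF f]])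

lemma ptree_iso_inverse:
  assumes S: "is_ptree P S" and T: "is_ptree P T" and f: "ptree_iso P S T f"
  obtains g where "ptree_iso P T S g" "ptree_comp P S g f = ptree_id P S"
    "ptree_comp P T f g = ptree_id P T"
proof -
  note fe = iso_embedding[OF f]
  define ei where "ei = the_inv_into (edges S) (emap f)"
  define mi where "mi = the_inv_into (marks S) (mmap f)"
  define ni where "ni = the_inv_into (nodes S) (nmap f)"
  note ei = bij_betw_the_inv_into_props[OF bij_emap[OF f], folded ei_def]
  note mi = bij_betw_the_inv_into_props[OF bij_mmap[OF f], folded mi_def]
  note ni = bij_betw_the_inv_into_props[OF bij_nmap[OF f], folded ni_def]
  define g where "g = \<lparr>emap = restrict ei (edges T), mmap = restrict mi (marks T), nmap = restrict ni (nodes T),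
    eiso = (\<lambda>x\<in>edges T. ginv (gpdI P) (eiso f (ei x))), miso = (\<lambda>x\<in>marks T. ginv (gpdE P) (miso f (mi x))),
    niso = (\<lambda>x\<in>nodes T. ginv (gpdB P) (niso f (ni x)))\<rparr>"
  have g_simps [simp]: "emap g = restrict ei (edges T)" "mmap g = restrict mi (marks T)" "nmap g = restrict ni (nodes T)"
    "eiso g = (\<lambda>x\<in>edges T. ginv (gpdI P) (eiso f (ei x)))" "miso g = (\<lambda>x\<in>marks T. ginv (gpdE P) (miso f (mi x)))"
    "niso g = (\<lambda>x\<in>nodes T. ginv (gpdB P) (niso f (ni x)))"
    by (simp_all add: g_def)
  have sm: "ei (smap T m) = smap S (mi m)" if "m \<in> marks T" for m
    using that emap_smap[OF fe mi(1)[OF that]] ei(3)[OF smap_in[OF ptree_tree[OF S] mi(1)[OF that]]] mi(2) by simp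
  have pm: "ni (pmap T m) = pmap S (mi m)" if "m \<in> marks T" for m
    using that nmap_pmap[OF fe mi(1)[OF that]] ni(3)[OF pmap_in[OF ptree_tree[OF S] mi(1)[OF that]]] mi(2) by simp
  have tm: "ei (tmap T n) = tmap S (ni n)" if "n \<in> nodes T" for n
    using that emap_tmap[OF fe ni(1)[OF that]] ei(3)[OF tmap_in[OF ptree_tree[OF S] ni(1)[OF that]]] ni(2) by simp
  have eH: "eiso f (ei x) \<in> Hom (gpdI P) (ecol S (ei x)) (ecol T x)" if "x \<in> edges T" for x
    using eiso_Hom[OF fe ei(1)[OF that]] ei(2)[OF that] by simp
  have mH: "miso f (mi x) \<in> Hom (gpdE P) (mcol S (mi x)) (mcol T x)" if "x \<in> marks T" for x
    using miso_Hom[OF fe mi(1)[OF that]] mi(2)[OF that] by simp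
  have nH: "niso f (ni x) \<in> Hom (gpdB P) (ncol S (ni x)) (ncol T x)" if "x \<in> nodes T" for x
    using niso_Hom[OF fe ni(1)[OF that]] ni(2)[OF that] by simp
  note T_in = is_treeD(1-3)[OF ptree_tree[OF T]]
  have "ptree_iso P T S g"
  proof (rule ptree_isoI[OF T S], goal_cases)
    case 1 show ?case by (rule bij_betwI[where g = "emap f"]) (auto simp: ei emap_in[OF fe])
  next
    case 2 show ?case by (rule bij_betwI[where g = "mmap f"]) (auto simp: mi mmap_in[OF fe])
  next
    case 3 show ?case by (rule bij_betwI[where g = "nmap f"]) (auto simp: ni nmap_in[OF fe])
  next
    case (10 m)
    note h = T_in(1)[OF 10] mi(1)[OF 10]
    show ?case
      using s.Y.ginv_square[OF eH[OF h(1)] siso_Hom[OF T 10] _ s.amap_Hom[OF mH[OF 10]]] siso_Hom[OF S h(2)]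
        siso_nat[OF fe h(2)] 10 T_in s.amap_ginv[OF mH[OF 10]]
      by (simp add: sm mi(2))
  next
    case (11 m)
    note h = T_in(2)[OF 11] mi(1)[OF 11]
    show ?case
      using p.Y.ginv_square[OF p.amap_Hom[OF mH[OF 11]] piso_Hom[OF T 11] _ nH[OF h(1)]] piso_Hom[OF S h(2)]
        piso_nat[OF fe h(2)] 11 T_in p.amap_ginv[OF mH[OF 11]]
      by (simp add: pm mi(2))
  next
    case (12 n)
    note h = T_in(3)[OF 12] ni(1)[OF 12]
    show ?case
      using s.Y.ginv_square[OF t.amap_Hom[OF nH[OF 12]] tiso_Hom[OF T 12] _ eH[OF h(1)]] tiso_Hom[OF S h(2)]
        tiso_nat[OF fe h(2)] 12 T_in t.amap_ginv[OF nH[OF 12]]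
      by (simp add: tm ni(2))
  qed (auto simp: T_in sm pm tm intro: s.Y.ginv_Hom[OF eH] s.X.ginv_Hom[OF mH] p.Y.ginv_Hom[OF nH])
  moreover have "ptree_comp P S g f = ptree_id P S"
    by (rule ptree_map.equality)
      (auto simp: fun_eq_iff restrict_def ei mi ni ptree_embeddingD[OF fe] s.Y.ginv_left[OF eiso_Hom[OF fe]]
        s.X.ginv_left[OF miso_Hom[OF fe]] p.Y.ginv_left[OF niso_Hom[OF fe]])
  moreover have "ptree_comp P T f g = ptree_id P T"
    by (rule ptree_map.equality)
      (auto simp: fun_eq_iff restrict_def ei mi ni s.Y.ginv_right[OF eH] s.X.ginv_right[OF mH] p.Y.ginv_right[OF nH])
  ultimately show thesis by (rule that)
qed

lemma Hom_ptrees: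
  "d \<in> Hom (ptrees P) S T \<longleftrightarrow> (\<exists>f. d = (S, T, f) \<and> is_ptree P S \<and> is_ptree P T \<and> ptree_iso P S T f)"
  by (auto simp: ptrees_def Hom_hom_gpd)

lemma ptrees_simps:
  "Obj (ptrees P) = {T. is_ptree P T}"
  "Ident (ptrees P) T = (T, T, ptree_id P T)"
  "(T, U, g) \<cdot>\<^bsub>ptrees P\<^esub> (S, T', f) = (S, U, ptree_comp P S g f)"
  by (auto simp: ptrees_def hom_gpd_simps)

lemma groupoid_ptrees: "groupoid (ptrees P)"
  unfolding ptrees_def
proof (rule groupoid_hom_gpd, goal_cases)
  case (6 S T f)
  then show ?case using ptree_iso_inverse[of S T f] by auto
qed (auto simp: ptree_id_iso ptree_comp_iso iso_embedding ptree_comp_id_left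
    intro: ptree_comp_assoc ptree_comp_id_right iso_embedding)

lemma groupoid_pforests: "groupoid (pforests P)"
  unfolding pforests_def by (rule groupoid_tilde[OF groupoid_ptrees])

end

lemma Obj_tilde: "(X, N) \<in> Obj (tilde G) \<longleftrightarrow> finite X \<and> N \<in> X \<rightarrow>\<^sub>E Obj G"
  by (simp add: tilde_def hom_gpd_simps)

lemma Hom_tilde: "d \<in> Hom (tilde G) (X, N) (X', N') \<longleftrightarrow>
  (X, N) \<in> Obj (tilde G) \<and> (X', N') \<in> Obj (tilde G) \<and> (\<exists>f \<eta>. d = ((X, N), (X', N'), (f, \<eta>)) \<and>
    f \<in> X \<rightarrow>\<^sub>E X' \<and> bij_betw f X X' \<and> \<eta> \<in> (\<Pi>\<^sub>E x\<in>X. Hom G (N x) (N' (f x))))"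
  by (auto simp: tilde_def Hom_hom_gpd hom_gpd_simps)

lemma Ident_tilde: "Ident (tilde G) (X, N) = ((X, N), (X, N), (\<lambda>x\<in>X. x, \<lambda>x\<in>X. Ident G (N x)))"
  by (simp add: tilde_def hom_gpd_simps)

lemma Comp_tilde: "(v, w, (g, \<theta>)) \<cdot>\<^bsub>tilde G\<^esub> ((X, N), v', (f, \<eta>)) =
    ((X, N), w, (\<lambda>x\<in>X. g (f x), \<lambda>x\<in>X. \<theta> (f x) \<cdot>\<^bsub>G\<^esub> \<eta> x))"
  by (simp add: tilde_def hom_gpd_simps split: prod.split)

abbreviation span :: "('u, 'i, 'ia, 'e, 'b, 'ba) ptree \<Rightarrow> 'u set \<Rightarrow> 'u set \<Rightarrow> ('u, 'i, 'ia, 'e, 'b, 'ba) ptree" where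
  "span T A N \<equiv> restrict_ptree T A (marks_over T N) N"

lemma ideal_tree_eq: "ideal_tree T l = span T (ideal_edges T l) (ideal_nodes T l)"
  by (simp add: ideal_tree_def ideal_edges_def ideal_nodes_def marks_over_def)

lemma image_eq_if_preimage:
  assumes "f ` A = B" "A' \<subseteq> A" "B' \<subseteq> B" "\<And>x. x \<in> A \<Longrightarrow> f x \<in> B' \<longleftrightarrow> x \<in> A'"
  shows "f ` A' = B'"
proof -
  have "f ` {x \<in> A. f x \<in> B'} = B'"
    using assms(1,3) by blast
  moreover have "{x \<in> A. f x \<in> B'} = A'"
    using assms(2,4) by blast
  ultimately show ?thesis by simp
qed

lemma leaves_subset: "l \<in> leaves T \<Longrightarrow> l \<in> edges T"
  by (simp add: leaves_def)

context polynomial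
begin

section \<open>Restriction of trees and isomorphisms to subtrees\<close>

lemma ptree_eqI:
  fixes S T :: "('u, 'i, 'ia, 'e, 'b, 'ba) ptree"
  assumes "is_ptree P S" "is_ptree P T" "edges S = edges T" "marks S = marks T" "nodes S = nodes T"
    "\<And>m. m \<in> marks S \<Longrightarrow> smap S m = smap T m \<and> pmap S m = pmap T m \<and> mcol S m = mcol T m \<and>
      siso S m = siso T m \<and> piso S m = piso T m"
    "\<And>n. n \<in> nodes S \<Longrightarrow> tmap S n = tmap T n \<and> ncol S n = ncol T n \<and> tiso S n = tiso T n"
    "\<And>x. x \<in> edges S \<Longrightarrow> ecol S x = ecol T x"
  shows "S = T"
  using ptree_extensional[OF assms(1)] ptree_extensional[OF assms(2)] assms(3-)
  by (intro ptree.equality) (auto intro: extensionalityI)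

text \<open>A height function of \<open>T\<close> also works for the part, and the pullback
  condition survives because each retained node keeps all its marks.\<close>

lemma span_ptree:
  assumes T: "is_ptree P T" and A: "spans T A N r"
  shows span_is_ptree: "is_ptree P (span T A N)" and root_span: "root (span T A N) = r"
proof -
  have tT: "is_tree T" using T by (rule ptree_tree)
  have A': "A \<subseteq> edges T" "N \<subseteq> nodes T" "tmap T ` N \<subseteq> A" "smap T ` marks_over T N \<subseteq> A"
      "A - smap T ` marks_over T N = {r}"
    using A by (auto simp: spans_def)
  have M: "m \<in> marks_over T N \<Longrightarrow> m \<in> marks T \<and> pmap T m \<in> N" for m
    by (simp add: marks_over_def)
  then have M': "marks_over T N \<subseteq> marks T" by blast
  obtain d where d: "\<And>m. m \<in> marks T \<Longrightarrow> (d (tmap T (pmap T m)) :: nat) < d (smap T m)"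
    using tree_height[OF tT] by blast
  have fin: "finite (edges (span T A N))" "finite (marks (span T A N))" "finite (nodes (span T A N))"
    using A'(1,2) M' tT by (auto simp: is_tree_def intro: finite_subset)
  have maps: "smap (span T A N) \<in> marks (span T A N) \<rightarrow>\<^sub>E edges (span T A N)"
    "pmap (span T A N) \<in> marks (span T A N) \<rightarrow>\<^sub>E nodes (span T A N)"
    "tmap (span T A N) \<in> nodes (span T A N) \<rightarrow>\<^sub>E edges (span T A N)"
    using A'(3,4) M by auto
  have inj: "inj_on (tmap (span T A N)) (nodes (span T A N))" "inj_on (smap (span T A N)) (marks (span T A N))"
    using A'(2) M' inj_smap[OF tT] inj_tmap[OF tT] by (auto intro: inj_on_subset)
  have r: "edges (span T A N) - smap (span T A N) ` marks (span T A N) = {r}"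
    using A'(5) by simp
  have h: "d (tmap (span T A N) (pmap (span T A N) m)) < d (smap (span T A N) m)" if "m \<in> marks (span T A N)" for m
    using that M d by simp
  have "is_tree (span T A N)" "root (span T A N) = r"
    by (rule is_treeI[OF fin maps inj r h], assumption)+
  moreover have "local_pullback P (span T A N) n" if "n \<in> N" for n
  proof (rule local_pullback_cong[where h = "\<lambda>m. m" and T = T])
    show "local_pullback P T n"
      using ptree_pullback[OF T] A'(2) that by blast
  qed (use that in \<open>auto simp: marks_over_def\<close>)
  moreover have "x \<in> A \<Longrightarrow> x \<in> edges T" "n \<in> N \<Longrightarrow> n \<in> nodes T" "n \<in> N \<Longrightarrow> tmap T n \<in> A"
      "m \<in> marks_over T N \<Longrightarrow> smap T m \<in> A" for x n m
    using A' by auto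
  ultimately show "is_ptree P (span T A N)" "root (span T A N) = r"
    using M by (simp_all add: is_ptree_iff PiE_iff ecol_Obj[OF T] mcol_Obj[OF T] ncol_Obj[OF T]
        siso_Hom[OF T] piso_Hom[OF T] tiso_Hom[OF T])
qed

text \<open>Commutation with \<open>pmap\<close> gives one inclusion. The other is the lifting of
  marks through the pullback square of an embedding.\<close>

lemma image_marks_over:
  assumes fe: "ptree_embedding P T T' f" and N: "N \<subseteq> nodes T"
  shows "mmap f ` marks_over T N = marks_over T' (nmap f ` N)"
proof -
  show ?thesis
  proof (intro subset_antisym subsetI)
    fix m' assume "m' \<in> mmap f ` marks_over T N"
    then obtain m where m: "m \<in> marks T" "pmap T m \<in> N" "m' = mmap f m"
      by (auto simp: marks_over_def)
    then show "m' \<in> marks_over T' (nmap f ` N)"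
      using mmap_in[OF fe m(1)] nmap_pmap[OF fe m(1), symmetric] by (simp add: marks_over_def)
  next
    fix m' assume "m' \<in> marks_over T' (nmap f ` N)"
    then obtain n where n: "m' \<in> marks T'" "n \<in> N" "nmap f n = pmap T' m'"
      by (auto simp: marks_over_def)
    then obtain m where "m \<in> marks T" "pmap T m = n" "mmap f m = m'"
      using mark_lift[OF fe _ n(1,3)] N by blast
    then show "m' \<in> mmap f ` marks_over T N"
      using n(2) by (auto simp: marks_over_def)
  qed
qed

text \<open>Only the edges and nodes have to be matched by hypothesis, as
  \<open>image_marks_over\<close> takes care of the marks.\<close>

lemma restrict_iso:
  assumes T: "is_ptree P T" and T': "is_ptree P T'" and f: "ptree_iso P T T' f"
    and A: "spans T A N r" and A': "spans T' A' N' r'" and im: "emap f ` A = A'" "nmap f ` N = N'"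
  shows "ptree_iso P (span T A N) (span T' A' N') (restrict_ptree_map (span T A N) f)"
proof -
  note fe = iso_embedding[OF f]
  have h: "A \<subseteq> edges T" "N \<subseteq> nodes T" "tmap T ` N \<subseteq> A" "smap T ` marks_over T N \<subseteq> A"
    using A by (auto simp: spans_def)
  have M: "m \<in> marks_over T N \<Longrightarrow> m \<in> marks T \<and> pmap T m \<in> N" for m
    by (simp add: marks_over_def)
  then have M': "marks_over T N \<subseteq> marks T" by blast
  note imM = image_marks_over[OF fe h(2), unfolded im(2)]
  have b: "bij_betw (emap f) A A'" "bij_betw (nmap f) N N'" "bij_betw (mmap f) (marks_over T N) (marks_over T' N')"
    using h M' im imM bij_emap[OF f] bij_nmap[OF f] bij_mmap[OF f] by (auto simp: bij_betw_def intro: inj_on_subset)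
  have in': "\<And>x. x \<in> A \<Longrightarrow> emap f x \<in> A'" "\<And>x. x \<in> N \<Longrightarrow> nmap f x \<in> N'"
      "\<And>x. x \<in> marks_over T N \<Longrightarrow> mmap f x \<in> marks_over T' N'"
    using im imM by auto
  show ?thesis
    by (rule ptree_isoI[OF span_is_ptree[OF T A] span_is_ptree[OF T' A']])
      (use b h in' M in \<open>auto simp: emap_smap[OF fe] nmap_pmap[OF fe] emap_tmap[OF fe] eiso_Hom[OF fe]
        miso_Hom[OF fe] niso_Hom[OF fe] siso_nat[OF fe] piso_nat[OF fe] tiso_nat[OF fe] image_subset_iff subset_iff\<close>)
qed

text \<open>If the image of the root were an input edge, its mark would have a preimage, and by
  injectivity on edges the root of \<open>S\<close> would be an input edge too.\<close>

lemma iso_root: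
  assumes S: "is_ptree P S" and T: "is_ptree P T" and f: "ptree_iso P S T f"
  shows "emap f (root S) = root T"
proof -
  note fe = iso_embedding[OF f] and tS = ptree_tree[OF S] and tT = ptree_tree[OF T]
  have "emap f (root S) \<in> edges T"
    by (rule emap_in[OF fe root_in[OF tS]])
  with tT show ?thesis
  proof (cases rule: edge_cases)
    case (2 m')
    then have "m' \<in> mmap f ` marks S"
      using bij_mmap[OF f] by (simp add: bij_betw_def)
    then obtain m where m: "m \<in> marks S" "m' = mmap f m" ..
    with 2 have "emap f (root S) = emap f (smap S m)"
      by (simp add: emap_smap[OF fe])
    then have "root S = smap S m"
      using inj_onD[OF bij_betw_imp_inj_on[OF bij_emap[OF f]]] root_in[OF tS] smap_in[OF tS m(1)] by blast
    then show ?thesis using smap_neq_root[OF tS m(1)] by simp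
  qed
qed

text \<open>Both memberships obey the recursion of \<open>ideal_edges_smap\<close>, and
  \<open>f\<close> respects each of its clauses.\<close>

lemma emap_ideal_edges:
  assumes S: "is_ptree P S" and T: "is_ptree P T" and f: "ptree_iso P S T f"
    and l: "l \<in> edges S" and x: "x \<in> edges S"
  shows "emap f x \<in> ideal_edges T (emap f l) \<longleftrightarrow> x \<in> ideal_edges S l"
  using ptree_tree[OF S] x
proof (induction rule: tree_induct)
  note fe = iso_embedding[OF f] and tS = ptree_tree[OF S] and tT = ptree_tree[OF T]
  have inj: "emap f x = emap f y \<longleftrightarrow> x = y" if "x \<in> edges S" "y \<in> edges S" for x y
    using inj_on_eq_iff[OF bij_betw_imp_inj_on[OF bij_emap[OF f]]] that by blast
  {
    case root
    then show ?case
      using inj[OF root_in[OF tS] l] iso_root[OF S T f] ideal_edges_root[OF tT, of "emap f l"]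
        ideal_edges_root[OF tS, of l] by simp
  next
    case (smap m)
    have "emap f (tmap S (pmap S m)) = tmap T (pmap T (mmap f m))"
      by (simp add: emap_tmap[OF fe pmap_in[OF tS smap.hyps]] nmap_pmap[OF fe smap.hyps])
    moreover have "emap f (smap S m) = emap f l \<longleftrightarrow> smap S m = l"
      using inj[OF smap_in[OF tS smap.hyps] l] .
    ultimately show ?case
      using smap.IH ideal_edges_smap[OF tT mmap_in[OF fe smap.hyps], of "emap f l"]
        ideal_edges_smap[OF tS smap.hyps, of l]
      by (simp add: emap_smap[OF fe smap.hyps])
  }
qed

lemma iso_ideal:
  assumes S: "is_ptree P S" and T: "is_ptree P T" and f: "ptree_iso P S T f" and l: "l \<in> edges S"
  shows image_ideal_edges: "emap f ` ideal_edges S l = ideal_edges T (emap f l)"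
    and image_ideal_nodes: "nmap f ` ideal_nodes S l = ideal_nodes T (emap f l)"
proof -
  note fe = iso_embedding[OF f] and e = emap_ideal_edges[OF S T f l]
  show "emap f ` ideal_edges S l = ideal_edges T (emap f l)"
    by (rule image_eq_if_preimage[OF bij_betw_imp_surj_on[OF bij_emap[OF f]] _ _ e])
      (auto simp: ideal_edges_def)
  show "nmap f ` ideal_nodes S l = ideal_nodes T (emap f l)"
  proof (rule image_eq_if_preimage[OF bij_betw_imp_surj_on[OF bij_nmap[OF f]]])
    show "nmap f n \<in> ideal_nodes T (emap f l) \<longleftrightarrow> n \<in> ideal_nodes S l" if "n \<in> nodes S" for n
      using e[OF tmap_in[OF ptree_tree[OF S] that]] nmap_in[OF fe that] that
      by (simp add: ideal_nodes_def emap_tmap[OF fe that])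
  qed (auto simp: ideal_nodes_def)
qed

lemma ideal_tree_is_ptree: "is_ptree P T \<Longrightarrow> l \<in> edges T \<Longrightarrow> is_ptree P (ideal_tree T l)"
  unfolding ideal_tree_eq by (rule span_is_ptree[OF _ spans_ideal[OF ptree_tree]])

lemma root_ideal_tree: "is_ptree P T \<Longrightarrow> l \<in> edges T \<Longrightarrow> root (ideal_tree T l) = l"
  unfolding ideal_tree_eq by (rule root_span[OF _ spans_ideal[OF ptree_tree]])

lemma restrict_iso_ideal:
  assumes "is_ptree P T" "is_ptree P T'" "ptree_iso P T T' f" "l \<in> edges T"
  shows "ptree_iso P (ideal_tree T l) (ideal_tree T' (emap f l)) (restrict_ptree_map (ideal_tree T l) f)"
  unfolding ideal_tree_eq
  by (rule restrict_iso[OF assms(1-3) spans_ideal[OF ptree_tree[OF assms(1)] assms(4)]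
        spans_ideal[OF ptree_tree[OF assms(2)] emap_in[OF iso_embedding[OF assms(3)] assms(4)]]
        iso_ideal[OF assms]])

lemma iso_leaves:
  assumes S: "is_ptree P S" and f: "ptree_iso P S T f"
  shows "emap f ` leaves S = leaves T"
proof -
  have "tmap T ` nodes T = tmap T ` nmap f ` nodes S"
    using bij_nmap[OF f] by (simp add: bij_betw_def)
  also have "\<dots> = emap f ` tmap S ` nodes S"
    unfolding image_image by (rule image_cong[OF refl]) (simp add: emap_tmap[OF iso_embedding[OF f]])
  finally have "tmap T ` nodes T = emap f ` tmap S ` nodes S" .
  moreover have "tmap S ` nodes S \<subseteq> edges S"
    using tmap_in[OF ptree_tree[OF S]] by blast
  then have "emap f ` (edges S - tmap S ` nodes S) = emap f ` edges S - emap f ` tmap S ` nodes S"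
    by (intro inj_on_image_set_diff[OF bij_betw_imp_inj_on[OF bij_emap[OF f]]]) auto
  ultimately show ?thesis
    using bij_betw_imp_surj_on[OF bij_emap[OF f]] by (simp add: leaves_def)
qed

lemma bij_betw_leaves:
  assumes "is_ptree P S" "ptree_iso P S T f"
  shows "bij_betw (emap f) (leaves S) (leaves T)"
  using iso_leaves[OF assms] bij_emap[OF assms(2)]
  by (auto simp: bij_betw_def leaves_def intro: inj_on_subset)

section \<open>The leaf and root functors\<close>

lemma omap_leaf_fun: "omap leaf_fun T = (leaves T, restrict (ecol T) (leaves T))"
  by (simp add: leaf_fun_def)

lemma amap_leaf_fun: "amap leaf_fun (S, T, f) = ((leaves S, restrict (ecol S) (leaves S)),
    (leaves T, restrict (ecol T) (leaves T)), (restrict (emap f) (leaves S), restrict (eiso f) (leaves S)))"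
  by (simp add: leaf_fun_def)

lemma omap_root_fun: "omap root_fun (X, Q) = (X, \<lambda>x\<in>X. ecol (Q x) (root (Q x)))"
  by (simp add: root_fun_def)

lemma amap_root_fun: "amap root_fun ((X, Q), (X', Q'), (f, \<eta>)) =
    ((X, \<lambda>x\<in>X. ecol (Q x) (root (Q x))), (X', \<lambda>x\<in>X'. ecol (Q' x) (root (Q' x))),
      (f, \<lambda>x\<in>X. (case \<eta> x of (_, _, g) \<Rightarrow> eiso g (root (Q x)))))"
  by (simp add: root_fun_def)

lemma Obj_leaf_fun:
  "is_ptree P T \<Longrightarrow> (leaves T, restrict (ecol T) (leaves T)) \<in> Obj (tilde (gpdI P))"
  using ecol_Obj by (auto simp: Obj_tilde leaves_def) (auto dest: ptree_tree simp: is_tree_def)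

lemma gfunctor_leaf_fun: "gfunctor (ptrees P) (tilde (gpdI P)) leaf_fun"
proof (rule gfunctorI[OF groupoid_ptrees groupoid_tilde[OF s.Y.groupoid_axioms]], goal_cases)
  case (1 T)
  then show ?case
    by (simp add: omap_leaf_fun ptrees_simps Obj_leaf_fun)
next
  case (2 d S T)
  then obtain f where f: "d = (S, T, f)" "is_ptree P S" "is_ptree P T" "ptree_iso P S T f"
    by (auto simp: Hom_ptrees)
  then show ?case
    using bij_betw_leaves[OF f(2,4)] eiso_Hom[OF iso_embedding[OF f(4)]] bij_betwE[OF bij_betw_leaves[OF f(2,4)]]
    by (auto simp: omap_leaf_fun amap_leaf_fun Hom_tilde Obj_leaf_fun leaves_subset)
next
  case (3 T)
  then show ?case
    by (auto simp: omap_leaf_fun amap_leaf_fun ptrees_simps Ident_tilde fun_eq_iff restrict_def leaves_subset)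
next
  case (4 d e S T U)
  then obtain f g where f: "d = (S, T, f)" "is_ptree P S" "ptree_iso P S T f" and g: "e = (T, U, g)"
    by (auto simp: Hom_ptrees)
  then show ?case
    using bij_betwE[OF bij_betw_leaves[OF f(2,3)]]
    by (auto simp: amap_leaf_fun ptrees_simps Comp_tilde fun_eq_iff restrict_def leaves_subset)
qed

lemma Obj_pforests: "(X, Q) \<in> Obj (pforests P) \<longleftrightarrow> finite X \<and> Q \<in> extensional X \<and> (\<forall>x\<in>X. is_ptree P (Q x))"
  by (auto simp: pforests_def Obj_tilde ptrees_simps PiE_iff)

lemma Hom_pforests: "d \<in> Hom (pforests P) (X, Q) (X', Q') \<longleftrightarrow>
  (X, Q) \<in> Obj (pforests P) \<and> (X', Q') \<in> Obj (pforests P) \<and> (\<exists>f \<eta>. d = ((X, Q), (X', Q'), (f, \<eta>)) \<and>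
    f \<in> extensional X \<and> bij_betw f X X' \<and> \<eta> \<in> extensional X \<and>
    (\<forall>x\<in>X. \<exists>g. \<eta> x = (Q x, Q' (f x), g) \<and> ptree_iso P (Q x) (Q' (f x)) g))"
  by (auto simp: pforests_def Hom_tilde Hom_ptrees PiE_iff Obj_tilde ptrees_simps bij_betwE)

lemma ecol_root_Obj: "is_ptree P T \<Longrightarrow> ecol T (root T) \<in> Obj (gpdI P)"
  by (intro ecol_Obj root_in ptree_tree)

text \<open>The colour arrow of an isomorphism of trees is read off at the root of the source. It
  ends in the colour of the root of the target by \<open>iso_root\<close>, which also gives
  compatibility with composition.\<close>

lemma gfunctor_root_fun: "gfunctor (pforests P) (tilde (gpdI P)) root_fun"
proof (rule gfunctorI[OF groupoid_pforests groupoid_tilde[OF s.Y.groupoid_axioms]], goal_cases)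
  case (1 F)
  then show ?case
    by (cases F) (auto simp: omap_root_fun Obj_pforests Obj_tilde intro!: ecol_Obj root_in ptree_tree)
next
  case (2 d F G)
  obtain X Q X' Q' where FG: "F = (X, Q)" "G = (X', Q')" by (metis surj_pair)
  from 2 obtain f \<eta> where f: "d = ((X, Q), (X', Q'), (f, \<eta>))" "f \<in> extensional X" "bij_betw f X X'"
      "\<And>x. x \<in> X \<Longrightarrow> \<exists>g. \<eta> x = (Q x, Q' (f x), g) \<and> ptree_iso P (Q x) (Q' (f x)) g"
      "finite X" "finite X'" "\<And>x. x \<in> X \<Longrightarrow> is_ptree P (Q x)" "\<And>x. x \<in> X' \<Longrightarrow> is_ptree P (Q' x)"
    by (auto simp: FG Hom_pforests Obj_pforests)
  have fX: "f x \<in> X'" if "x \<in> X" for x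
    using f(3) that bij_betwE by blast
  have "(case \<eta> x of (_, _, g) \<Rightarrow> eiso g (root (Q x))) \<in>
      Hom (gpdI P) (ecol (Q x) (root (Q x))) (ecol (Q' (f x)) (root (Q' (f x))))" if x: "x \<in> X" for x
    using f(4)[OF x] eiso_Hom[OF iso_embedding root_in[OF ptree_tree[OF f(7)[OF x]]]]
      iso_root[OF f(7)[OF x] f(8)[OF fX[OF x]]] by force
  then show ?case
    using f fX
    by (auto simp: FG ecol_root_Obj omap_root_fun amap_root_fun Hom_tilde Obj_tilde PiE_iff)
next
  case (3 F)
  obtain X Q where F: "F = (X, Q)" by (cases F)
  with 3 have "root (Q x) \<in> edges (Q x)" if "x \<in> X" for x
    using that by (simp add: Obj_pforests root_in ptree_tree)
  then show ?case
    by (auto simp: F omap_root_fun pforests_def Ident_tilde amap_root_fun fun_eq_iff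
        restrict_def ptrees_simps)
next
  case (4 d e F G H)
  obtain X Q X' Q' X'' Q'' where FG: "F = (X, Q)" "G = (X', Q')" "H = (X'', Q'')" by (metis surj_pair)
  from 4 obtain f \<eta> g \<theta> where f: "d = ((X, Q), (X', Q'), (f, \<eta>))" "bij_betw f X X'"
      "\<And>x. x \<in> X \<Longrightarrow> \<exists>h. \<eta> x = (Q x, Q' (f x), h) \<and> ptree_iso P (Q x) (Q' (f x)) h"
      "\<And>x. x \<in> X \<Longrightarrow> is_ptree P (Q x)" "\<And>x. x \<in> X' \<Longrightarrow> is_ptree P (Q' x)"
    and g: "e = ((X', Q'), (X'', Q''), (g, \<theta>))"
      "\<And>x. x \<in> X' \<Longrightarrow> \<exists>h. \<theta> x = (Q' x, Q'' (g x), h) \<and> ptree_iso P (Q' x) (Q'' (g x)) h"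
    by (auto simp: FG Hom_pforests Obj_pforests)
  have "(case \<theta> (f x) \<cdot>\<^bsub>ptrees P\<^esub> \<eta> x of (_, _, h) \<Rightarrow> eiso h (root (Q x))) =
      (case \<theta> (f x) of (_, _, h) \<Rightarrow> eiso h (root (Q' (f x)))) \<cdot>\<^bsub>gpdI P\<^esub>
      (case \<eta> x of (_, _, h) \<Rightarrow> eiso h (root (Q x)))" if x: "x \<in> X" for x
  proof -
    have fx: "f x \<in> X'" using f(2) x bij_betwE by blast
    obtain h where h: "\<eta> x = (Q x, Q' (f x), h)" "ptree_iso P (Q x) (Q' (f x)) h"
      using f(3)[OF x] by blast
    obtain k where k: "\<theta> (f x) = (Q' (f x), Q'' (g (f x)), k)"
      using g(2)[OF fx] by blast
    show ?thesis
      using iso_root[OF f(4)[OF x] f(5)[OF fx] h(2)] root_in[OF ptree_tree[OF f(4)[OF x]]]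
      by (simp add: h k ptrees_simps)
  qed
  then show ?case
    using bij_betwE[OF f(2)]
    by (simp add: FG f(1) g(1) pforests_def Comp_tilde amap_root_fun fun_eq_iff restrict_def)
qed

section \<open>Cuts\<close>

abbreviation subtree :: "('u, 'i, 'ia, 'e, 'b, 'ba) ptree \<Rightarrow> 'u set \<Rightarrow> ('u, 'i, 'ia, 'e, 'b, 'ba) ptree" where
  "subtree T N \<equiv> span T (edges_over T N) N"

lemma subtree_is_ptree: "is_ptree P T \<Longrightarrow> closed_nodes T N \<Longrightarrow> is_ptree P (subtree T N)"
  by (rule span_is_ptree[OF _ spans_closed[OF ptree_tree]])

lemma root_subtree: "is_ptree P T \<Longrightarrow> closed_nodes T N \<Longrightarrow> root (subtree T N) = root T"
  by (rule root_span[OF _ spans_closed[OF ptree_tree]])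

lemma leaves_subtree: "leaves (subtree T N) = edges_over T N - tmap T ` N"
  by (simp add: leaves_def)

text \<open>Preservation of the root and the pullback square leave no freedom: the marks of the
  image are all marks over its nodes, and its edges are the root and the edges of these marks.
  Injectivity is not built into \<open>tree_embedding\<close> and is derived here by induction from
  the root.\<close>

lemma rp_embedding_image:
  assumes T: "is_ptree P T" and c: "(S, c) \<in> rp_embeddings P T"
  shows "closed_nodes T (nmap c ` nodes S)"
    and "mmap c ` marks S = marks_over T (nmap c ` nodes S)"
    and "emap c ` edges S = edges_over T (nmap c ` nodes S)"
    and "inj_on (emap c) (edges S)" and "inj_on (mmap c) (marks S)" and "inj_on (nmap c) (nodes S)"
proof -
  have S: "is_ptree P S" and ce: "ptree_embedding P S T c" and r: "emap c (root S) = root T"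
    using c by (auto simp: rp_embeddings_def)
  have tS: "is_tree S" and tT: "is_tree T" using S T ptree_tree by auto
  let ?N = "nmap c ` nodes S"
  have "marks S = marks_over S (nodes S)"
    using pmap_in[OF tS] by (auto simp: marks_over_def)
  then show M: "mmap c ` marks S = marks_over T ?N"
    using image_marks_over[OF ce subset_refl] by simp
  have eS: "edges S = insert (root S) (smap S ` marks S)"
    using root_complement[OF tS] smap_in[OF tS] by blast
  have "emap c ` smap S ` marks S = smap T ` mmap c ` marks S"
    unfolding image_image by (rule image_cong[OF refl emap_smap[OF ce]])
  then show E: "emap c ` edges S = edges_over T ?N"
    by (simp add: eS r edges_over_def M)
  show "closed_nodes T ?N"
    unfolding closed_nodes_def
  proof (intro conjI ballI)
    show "?N \<subseteq> nodes T" using nmap_in[OF ce] by blast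
    fix n assume "n \<in> ?N"
    then obtain k where k: "k \<in> nodes S" "n = nmap c k" ..
    then have "tmap T n \<in> emap c ` edges S"
      using emap_tmap[OF ce k(1)] tmap_in[OF tS k(1)] by force
    then show "tmap T n = root T \<or> tmap T n \<in> smap T ` marks_over T ?N"
      by (auto simp: E edges_over_def)
  qed
  have "\<forall>y\<in>edges S. emap c x = emap c y \<longrightarrow> x = y" if "x \<in> edges S" for x
    using tS that
  proof (induction rule: tree_induct)
    case root
    show ?case
    proof (intro ballI impI)
      fix y assume y: "y \<in> edges S" "emap c (root S) = emap c y"
      from tS y(1) show "root S = y"
      proof (cases rule: edge_cases)
        case (2 m)
        then show ?thesis
          using y(2) r emap_smap[OF ce 2(1)] smap_neq_root[OF tT mmap_in[OF ce 2(1)]] by simp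
      qed simp
    qed
  next
    case (smap m)
    show ?case
    proof (intro ballI impI)
      fix y assume y: "y \<in> edges S" "emap c (smap S m) = emap c y"
      from tS y(1) show "smap S m = y"
      proof (cases rule: edge_cases)
        case 1
        then show ?thesis
          using y(2) r emap_smap[OF ce smap.hyps] smap_neq_root[OF tT mmap_in[OF ce smap.hyps]] by simp
      next
        case (2 m')
        have pm: "pmap S m \<in> nodes S" "pmap S m' \<in> nodes S"
          using pmap_in[OF tS] smap.hyps 2(1) by auto
        \<comment> \<open>Equal images of two input edges give equal images of the marks, of their
          nodes and of the output edges. The induction hypothesis identifies the output edges,
          injectivity of \<open>tmap\<close> the nodes, and uniqueness of lifts the marks.\<close>
        have mm: "mmap c m = mmap c m'"
          using y(2) 2 emap_smap[OF ce] smap.hyps inj_onD[OF inj_smap[OF tT]] mmap_in[OF ce] by simp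
        then have nn: "nmap c (pmap S m) = nmap c (pmap S m')"
          using nmap_pmap[OF ce] smap.hyps 2(1) by simp
        then have "tmap S (pmap S m) = tmap S (pmap S m')"
          using smap.IH tmap_in[OF tS pm(2)] emap_tmap[OF ce] pm by simp
        then have "pmap S m = pmap S m'"
          using inj_onD[OF inj_tmap[OF tS]] pm by blast
        then have "m = m'"
          using mark_lift[OF ce pm(1) mmap_in[OF ce smap.hyps] nmap_pmap[OF ce smap.hyps]] mm smap.hyps 2(1)
          by auto
        then show ?thesis using 2 by simp
      qed
    qed
  qed
  then show ie: "inj_on (emap c) (edges S)"
    by (auto simp: inj_on_def)
  show "inj_on (nmap c) (nodes S)"
  proof (rule inj_onI)
    fix n n' assume n: "n \<in> nodes S" "n' \<in> nodes S" "nmap c n = nmap c n'"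
    then have "emap c (tmap S n) = emap c (tmap S n')"
      by (simp add: emap_tmap[OF ce])
    then show "n = n'"
      using n ie inj_tmap[OF tS] tmap_in[OF tS] by (auto dest: inj_onD)
  qed
  show "inj_on (mmap c) (marks S)"
  proof (rule inj_onI)
    fix m m' assume m: "m \<in> marks S" "m' \<in> marks S" "mmap c m = mmap c m'"
    then have "emap c (smap S m) = emap c (smap S m')"
      by (simp add: emap_smap[OF ce])
    then show "m = m'"
      using m ie inj_smap[OF tS] smap_in[OF tS] by (auto dest: inj_onD)
  qed
qed

text \<open>A cut is determined by the set \<open>N\<close> of nodes of the subtree.\<close>

definition cut_of :: "('u, 'i, 'ia, 'e, 'b, 'ba) ptree \<Rightarrow> 'u set \<Rightarrow> ('u, 'i, 'ia, 'e, 'ea, 'b, 'ba) ptree_cut" where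
  "cut_of T N = {(S, c) \<in> rp_embeddings P T. nmap c ` nodes S = N}"

definition inclusion :: "('u, 'i, 'ia, 'e, 'b, 'ba) ptree \<Rightarrow> 'u set \<Rightarrow> ('u, 'ia, 'ea, 'ba) ptree_map" where
  "inclusion T N = restrict_ptree_map (subtree T N) (ptree_id P T)"

lemma edges_over_subset: "is_tree T \<Longrightarrow> closed_nodes T N \<Longrightarrow> edges_over T N \<subseteq> edges T"
  using spans_closed[of T N] by (simp add: spans_def)

lemma inclusion_in_cut_of:
  assumes T: "is_ptree P T" and N: "closed_nodes T N"
  shows "(subtree T N, inclusion T N) \<in> cut_of T N"
proof -
  have sp: "spans T (edges_over T N) N (root T)"
    by (rule spans_closed[OF ptree_tree[OF T] N])
  then have h: "edges_over T N \<subseteq> edges T" "N \<subseteq> nodes T" "tmap T ` N \<subseteq> edges_over T N"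
      "smap T ` marks_over T N \<subseteq> edges_over T N" "root T \<in> edges_over T N"
    by (auto simp: spans_def edges_over_def)
  have M: "m \<in> marks_over T N \<longleftrightarrow> m \<in> marks T \<and> pmap T m \<in> N" for m
    by (simp add: marks_over_def)
  have "ptree_embedding P (subtree T N) T (inclusion T N)"
    using h by (intro ptree_embeddingI)
      (auto simp: inclusion_def M subset_iff image_subset_iff
        s.X.Ident_Hom s.Y.Ident_Hom p.Y.Ident_Hom s.amap_Ident p.amap_Ident t.amap_Ident
        ecol_Obj[OF T] mcol_Obj[OF T] ncol_Obj[OF T] pmap_in[OF ptree_tree[OF T]]
        s.Y.Ident_left[OF siso_Hom[OF T]] s.Y.Ident_right[OF siso_Hom[OF T]] p.Y.Ident_left[OF piso_Hom[OF T]]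
        p.Y.Ident_right[OF piso_Hom[OF T]] s.Y.Ident_left[OF tiso_Hom[OF T]] s.Y.Ident_right[OF tiso_Hom[OF T]])
  then show ?thesis
    using subtree_is_ptree[OF T N] root_subtree[OF T N] h(2,5) root_in[OF ptree_tree[OF T]]
    by (auto simp: cut_of_def rp_embeddings_def inclusion_def subset_iff)
qed

text \<open>Maps do not record their codomain, and the subtree carries the restricted decoration, so
  the same \<open>c\<close> is at once the embedding into \<open>T\<close> and an isomorphism onto
  its image.\<close>

lemma cut_of_iso_subtree:
  assumes T: "is_ptree P T" and c: "(S, c) \<in> cut_of T N"
  shows "closed_nodes T N" "ptree_iso P S (subtree T N) c" "ptree_comp P S (inclusion T N) c = c"
proof -
  have rp: "(S, c) \<in> rp_embeddings P T" and im: "nmap c ` nodes S = N"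
    using c by (auto simp: cut_of_def)
  have S: "is_ptree P S" and ce: "ptree_embedding P S T c"
    using rp by (auto simp: rp_embeddings_def)
  note i = rp_embedding_image[OF T rp, unfolded im]
  show N: "closed_nodes T N" by (rule i(1))
  have in': "\<And>x. x \<in> edges S \<Longrightarrow> emap c x \<in> edges_over T N" "\<And>x. x \<in> marks S \<Longrightarrow> mmap c x \<in> marks_over T N"
      "\<And>x. x \<in> nodes S \<Longrightarrow> nmap c x \<in> N"
    using i(2,3) im by auto
  show "ptree_iso P S (subtree T N) c"
    by (rule ptree_isoI[OF S subtree_is_ptree[OF T N]])
      (auto simp: bij_betw_def i im in' emap_smap[OF ce] nmap_pmap[OF ce] emap_tmap[OF ce] eiso_Hom[OF ce]
        miso_Hom[OF ce] niso_Hom[OF ce] siso_nat[OF ce] piso_nat[OF ce] tiso_nat[OF ce] embedding_extensional[OF ce])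
  show "ptree_comp P S (inclusion T N) c = c"
    using embedding_extensional[OF ce]
    by (intro ptree_map.equality)
      (auto simp: inclusion_def in' fun_eq_iff restrict_def extensional_def emap_in[OF ce] mmap_in[OF ce]
        nmap_in[OF ce] s.Y.Ident_left[OF eiso_Hom[OF ce]] s.X.Ident_left[OF miso_Hom[OF ce]]
        p.Y.Ident_left[OF niso_Hom[OF ce]])
qed

text \<open>Embeddings with the same node image are isomorphisms onto one and the same subtree. The
  isomorphism over \<open>T\<close> is the first of them followed by the inverse of the
  second.\<close>

lemma iso_over_iff:
  assumes T: "is_ptree P T"
  shows "((S, c), (S', c')) \<in> iso_over P T \<longleftrightarrow> (S, c) \<in> rp_embeddings P T \<and> (S', c') \<in> rp_embeddings P T \<and>
    nmap c ` nodes S = nmap c' ` nodes S'"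
proof safe
  assume h: "((S, c), (S', c')) \<in> iso_over P T"
  then show "(S, c) \<in> rp_embeddings P T" "(S', c') \<in> rp_embeddings P T"
    by (auto simp: iso_over_def)
  obtain g where g: "ptree_iso P S S' g" "ptree_comp P S c' g = c"
    using h by (auto simp: iso_over_def)
  then have "nmap c ` nodes S = nmap c' ` nmap g ` nodes S"
    by (auto simp: image_image)
  also have "nmap g ` nodes S = nodes S'"
    using bij_nmap[OF g(1)] by (simp add: bij_betw_def)
  finally have *: "nmap c ` nodes S = nmap c' ` nodes S'" .
  show "nmap c x \<in> nmap c' ` nodes S'" if "x \<in> nodes S" for x using * that by blast
  show "nmap c' x \<in> nmap c ` nodes S" if "x \<in> nodes S'" for x using * that by blast
next
  assume h: "(S, c) \<in> rp_embeddings P T" "(S', c') \<in> rp_embeddings P T" "nmap c ` nodes S = nmap c' ` nodes S'"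
  define N where "N = nmap c ` nodes S"
  have m: "(S, c) \<in> cut_of T N" "(S', c') \<in> cut_of T N"
    using h by (auto simp: N_def cut_of_def)
  note c = cut_of_iso_subtree[OF T m(1)] and c' = cut_of_iso_subtree[OF T m(2)]
  have S: "is_ptree P S" "is_ptree P S'" "is_ptree P (subtree T N)"
    using h subtree_is_ptree[OF T c(1)] by (auto simp: rp_embeddings_def)
  obtain k where k: "ptree_iso P (subtree T N) S' k" "ptree_comp P (subtree T N) c' k = ptree_id P (subtree T N)"
    using ptree_iso_inverse[OF S(2,3) c'(2)] by metis
  have "ptree_comp P S c' (ptree_comp P S k c) = ptree_comp P S (ptree_comp P (subtree T N) c' k) c"
    using ptree_comp_assoc iso_embedding c(2) k(1) c'(2) by metis
  also have "\<dots> = c"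
    unfolding k(2) by (rule ptree_comp_id_left[OF iso_embedding[OF c(2)]])
  finally show "((S, c), (S', c')) \<in> iso_over P T"
    using h ptree_comp_iso[OF S(1,3,2) c(2) k(1)] by (auto simp: iso_over_def)
qed

text \<open>By \<open>iso_over_iff\<close> the classes are the fibres of the map that takes an
  embedding to its node image. The possible images are exactly the closed sets, since each of them
  is realised by its inclusion.\<close>

lemma cuts_eq:
  assumes T: "is_ptree P T"
  shows "cuts P T = cut_of T ` {N. closed_nodes T N}"
proof -
  have cls: "iso_over P T `` {(S, c)} = cut_of T (nmap c ` nodes S)" if "(S, c) \<in> rp_embeddings P T" for S c
    using that iso_over_iff[OF T] by (fastforce simp: cut_of_def)
  show ?thesis
  proof (intro subset_antisym subsetI)
    fix C assume "C \<in> cuts P T"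
    then obtain S c where c: "(S, c) \<in> rp_embeddings P T" "C = iso_over P T `` {(S, c)}"
      by (auto simp: cuts_def quotient_def)
    then show "C \<in> cut_of T ` {N. closed_nodes T N}"
      using rp_embedding_image(1)[OF T c(1)] by (auto simp: cls)
  next
    fix C assume "C \<in> cut_of T ` {N. closed_nodes T N}"
    then obtain N where N: "closed_nodes T N" "C = cut_of T N" by blast
    have i: "(subtree T N, inclusion T N) \<in> rp_embeddings P T" "nmap (inclusion T N) ` nodes (subtree T N) = N"
      using inclusion_in_cut_of[OF T N(1)] by (auto simp: cut_of_def)
    with N have "C = iso_over P T `` {(subtree T N, inclusion T N)}"
      by (simp add: cls[OF i(1)])
    with i(1) show "C \<in> cuts P T"
      by (auto simp: cuts_def quotient_def)
  qed
qed

text \<open>The unions in \<open>cut_tree\<close> run over a nonempty class whose members all have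
  the same image. The inclusion of the subtree witnesses that the class is nonempty.\<close>

lemma cut_tree_cut_of:
  assumes T: "is_ptree P T" and N: "closed_nodes T N"
  shows "cut_tree T (cut_of T N) = subtree T N"
proof -
  have im: "emap c ` edges S = edges_over T N" "mmap c ` marks S = marks_over T N" "nmap c ` nodes S = N"
    if "(S, c) \<in> cut_of T N" for S c
    using that rp_embedding_image[OF T, of S c] by (auto simp: cut_of_def)
  have "(\<Union>(S, c)\<in>cut_of T N. emap c ` edges S) = edges_over T N"
    "(\<Union>(S, c)\<in>cut_of T N. mmap c ` marks S) = marks_over T N"
    "(\<Union>(S, c)\<in>cut_of T N. nmap c ` nodes S) = N"
    by (rule UN_constant_eq[OF inclusion_in_cut_of[OF T N]]; clarsimp simp: im)+
  then show ?thesis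
    by (simp add: cut_tree_def)
qed

lemma inj_on_cut_of: "is_ptree P T \<Longrightarrow> inj_on (cut_of T) {N. closed_nodes T N}"
proof (rule inj_onI)
  fix N N' assume h: "is_ptree P T" "N \<in> {N. closed_nodes T N}" "N' \<in> {N. closed_nodes T N}" "cut_of T N = cut_of T N'"
  then have "nodes (subtree T N) = nodes (subtree T N')"
    by (simp only: cut_tree_cut_of[symmetric] mem_Collect_eq)
  then show "N = N'" by simp
qed

lemma iso_closed_nodes:
  assumes S: "is_ptree P S" and T: "is_ptree P T" and f: "ptree_iso P S T f" and N: "closed_nodes S N"
  shows "closed_nodes T (nmap f ` N)" "emap f ` edges_over S N = edges_over T (nmap f ` N)"
proof -
  note fe = iso_embedding[OF f]
  have N': "N \<subseteq> nodes S" using N by (simp add: closed_nodes_def)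
  have M: "marks_over S N \<subseteq> marks S" by (auto simp: marks_over_def)
  have "emap f ` smap S ` marks_over S N = smap T ` mmap f ` marks_over S N"
    unfolding image_image using M by (intro image_cong[OF refl] emap_smap[OF fe]) blast
  then show E: "emap f ` edges_over S N = edges_over T (nmap f ` N)"
    by (simp add: edges_over_def iso_root[OF S T f] image_marks_over[OF fe N'])
  have "tmap T (nmap f n) \<in> edges_over T (nmap f ` N)" if "n \<in> N" for n
    unfolding E[symmetric] emap_tmap[OF fe subsetD[OF N' that], symmetric]
    using tmap_edges_over[OF N that] by (rule imageI)
  then show "closed_nodes T (nmap f ` N)"
    using N' nmap_in[OF fe] by (auto simp: closed_nodes_def edges_over_def)
qed

text \<open>One inclusion is proved for arbitrary isomorphisms, so that it applies to the inverse of
  \<open>f\<close> as well. Pushing a cut of \<open>T\<close> back and forth then gives the other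
  inclusion.\<close>

lemma push_cut_of:
  assumes S: "is_ptree P S" and T: "is_ptree P T" and f: "ptree_iso P S T f" and N: "closed_nodes S N"
  shows "(\<lambda>(U, c). (U, ptree_comp P U f c)) ` cut_of S N = cut_of T (nmap f ` N)"
proof -
  have sub: "(\<lambda>(U, c). (U, ptree_comp P U f c)) ` cut_of S N \<subseteq> cut_of T (nmap f ` N)"
    if S: "is_ptree P S" and T: "is_ptree P T" and f: "ptree_iso P S T f"
    for S T :: "('z, 'i, 'ia, 'e, 'b, 'ba) ptree" and f :: "('z, 'ia, 'ea, 'ba) ptree_map" and N
  proof
    fix x assume "x \<in> (\<lambda>(U, c). (U, ptree_comp P U f c)) ` cut_of S N"
    then obtain U c where c: "(U, c) \<in> cut_of S N" "x = (U, ptree_comp P U f c)" by auto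
    then have U: "is_ptree P U" "ptree_embedding P U S c" "emap c (root U) = root S" "nmap c ` nodes U = N"
      by (auto simp: cut_of_def rp_embeddings_def)
    then show "x \<in> cut_of T (nmap f ` N)"
      using ptree_comp_embedding[OF U(1) S T U(2) iso_embedding[OF f]] iso_root[OF S T f] c(2)
        root_in[OF ptree_tree[OF U(1)]]
      by (auto simp: cut_of_def rp_embeddings_def image_image)
  qed
  obtain g where g: "ptree_iso P T S g" "ptree_comp P S g f = ptree_id P S" "ptree_comp P T f g = ptree_id P T"
    using ptree_iso_inverse[OF S T f] by blast
  have "nmap g (nmap f n) = n" if "n \<in> nodes S" for n
    using arg_cong[OF g(2), of "\<lambda>h. nmap h n"] that by simp
  then have gf: "nmap g ` nmap f ` N = N"
    using N by (force simp: closed_nodes_def image_image)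
  have "x \<in> (\<lambda>(U, c). (U, ptree_comp P U f c)) ` cut_of S N" if x: "x \<in> cut_of T (nmap f ` N)" for x
  proof -
    obtain U c where c: "x = (U, c)" by (cases x)
    then have ce: "ptree_embedding P U T c"
      using x by (auto simp: cut_of_def rp_embeddings_def)
    have "(U, ptree_comp P U g c) \<in> cut_of S N"
      using sub[OF T S g(1), of "nmap f ` N"] x c gf by auto
    moreover have "ptree_comp P U f (ptree_comp P U g c) = c"
      using ptree_comp_assoc[OF ce iso_embedding[OF g(1)] iso_embedding[OF f]] g(3) ptree_comp_id_left[OF ce]
      by simp
    ultimately show ?thesis
      using c by force
  qed
  with sub[OF S T f] show ?thesis by blast
qed

lemma fam_cut_family: "fam (cut_family P) T = disc_gpd (cuts P T)"
  by (simp add: cut_family_def)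

lemma tra_cut_family:
  "omap (tra (cut_family P) (S, T, f)) C = (\<lambda>(U, c). (U, ptree_comp P U f c)) ` C"
  "amap (tra (cut_family P) (S, T, f)) C = (\<lambda>(U, c). (U, ptree_comp P U f c)) ` C"
  by (simp_all add: cut_family_def Let_def)

text \<open>By \<open>cuts_eq\<close> and \<open>push_cut_of\<close>, transport of cuts is the
  direct image of node sets, for which strict functoriality is clear.\<close>

lemma is_family_cut: "is_family (ptrees P) (cut_family P)"
proof -
  have o: "Obj (disc_gpd X) = X" for X :: "'x set" by (simp add: disc_gpd_def)
  have push: "(\<lambda>(U, c). (U, ptree_comp P U f c)) ` C \<in> cuts P T"
    if "is_ptree P S" "is_ptree P T" "ptree_iso P S T f" "C \<in> cuts P S"
    for S T :: "('z, 'i, 'ia, 'e, 'b, 'ba) ptree" and f :: "('z, 'ia, 'ea, 'ba) ptree_map" and C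
    using that iso_closed_nodes[OF that(1-3)] by (auto simp: cuts_eq push_cut_of)
  have push_id: "(\<lambda>(U, c). (U, ptree_comp P U (ptree_id P T) c)) ` C = C"
    if T: "is_ptree P T" and C: "C \<in> cuts P T"
    for T :: "('z, 'i, 'ia, 'e, 'b, 'ba) ptree" and C :: "('z, 'i, 'ia, 'e, 'ea, 'b, 'ba) ptree_cut"
  proof -
    obtain N where N: "closed_nodes T N" "C = cut_of T N" using C by (auto simp: cuts_eq[OF T])
    then have "nmap (ptree_id P T) ` N = N"
      by (force simp: closed_nodes_def)
    then show ?thesis
      unfolding N(2) push_cut_of[OF T T ptree_id_iso[OF T] N(1)] by simp
  qed
  have push_comp: "(\<lambda>(U, c). (U, ptree_comp P U (ptree_comp P S g f) c)) ` C =
      (\<lambda>(U, c). (U, ptree_comp P U g c)) ` (\<lambda>(U, c). (U, ptree_comp P U f c)) ` C"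
    if S: "is_ptree P S" and T: "is_ptree P T" and V: "is_ptree P V" and f: "ptree_iso P S T f"
      and g: "ptree_iso P T V g" and C: "C \<in> cuts P S"
    for S T V :: "('z, 'i, 'ia, 'e, 'b, 'ba) ptree" and f g :: "('z, 'ia, 'ea, 'ba) ptree_map" and C
  proof -
    obtain N where N: "closed_nodes S N" "C = cut_of S N" using C by (auto simp: cuts_eq[OF S])
    then have "nmap (ptree_comp P S g f) ` N = nmap g ` nmap f ` N"
      by (force simp: closed_nodes_def)
    then show ?thesis
      using N by (simp add: push_cut_of[OF S V ptree_comp_iso[OF S T V f g]] push_cut_of[OF S T f]
          push_cut_of[OF T V g] iso_closed_nodes[OF S T f])
  qed
  show ?thesis
    unfolding is_family_def fam_cut_family
  proof (intro conjI ballI allI groupoid_ptrees groupoid_disc)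
    fix S T \<sigma> assume "\<sigma> \<in> Hom (ptrees P) S T"
    then obtain f where [simp]: "\<sigma> = (S, T, f)" and "is_ptree P S" "is_ptree P T" "ptree_iso P S T f"
      by (auto simp: Hom_ptrees)
    note push' = push[OF this(2-)]
    show "gfunctor (disc_gpd (cuts P S)) (disc_gpd (cuts P T)) (tra (cut_family P) \<sigma>)"
      by (rule gfunctorI[OF groupoid_disc groupoid_disc])
        (auto simp: tra_cut_family push' Hom_disc o, auto simp: disc_gpd_def tra_cut_family)
  qed (auto simp: o ptrees_simps Hom_ptrees Hom_disc tra_cut_family push_id push_comp)
qed

end

section \<open>Grafting\<close>

text \<open>The union of functions defined on overlapping sets. The choice of a piece is harmless
  when the functions agree on overlaps, which is what \<open>amalg_eq\<close> requires.\<close>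

definition amalg :: "'k set \<Rightarrow> ('k \<Rightarrow> 'a set) \<Rightarrow> ('k \<Rightarrow> 'a \<Rightarrow> 'b) \<Rightarrow> 'a \<Rightarrow> 'b" where
  "amalg K D F = (\<lambda>x\<in>(\<Union>k\<in>K. D k). F (SOME k. k \<in> K \<and> x \<in> D k) x)"

lemma amalg_extensional: "amalg K D F \<in> extensional (\<Union>k\<in>K. D k)"
  by (simp add: amalg_def)

lemma amalg_eq:
  assumes "k \<in> K" "x \<in> D k" "\<And>k'. k' \<in> K \<Longrightarrow> x \<in> D k' \<Longrightarrow> F k' x = F k x"
  shows "amalg K D F x = F k x"
proof -
  let ?k = "SOME k. k \<in> K \<and> x \<in> D k"
  have "?k \<in> K \<and> x \<in> D ?k"
    by (rule someI[of _ k]) (use assms in simp)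
  then have "F ?k x = F k x"
    using assms(3) by simp
  moreover have "x \<in> (\<Union>k\<in>K. D k)"
    using assms(1,2) by (rule UN_I)
  ultimately show ?thesis
    by (simp add: amalg_def del: UN_iff)
qed

text \<open>The pieces of a tree cut at \<open>S\<close>: \<open>None\<close> stands for \<open>S\<close> and \<open>Some l\<close> for the tree grafted onto the
  leaf \<open>l\<close>.\<close>

definition piece :: "'t \<Rightarrow> ('u \<Rightarrow> 't) \<Rightarrow> 'u option \<Rightarrow> 't" where
  "piece S Q k = (case k of None \<Rightarrow> S | Some l \<Rightarrow> Q l)"

lemma piece_simps [simp]: "piece S Q None = S" "piece S Q (Some l) = Q l"
  by (simp_all add: piece_def)

definition indices :: "('u, 'z) tree_scheme \<Rightarrow> 'u option set" where
  "indices S = insert None (Some ` leaves S)"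

lemma None_indices [simp]: "None \<in> indices S"
  by (simp add: indices_def)

lemma Some_indices [simp]: "Some l \<in> indices S \<longleftrightarrow> l \<in> leaves S"
  by (auto simp: indices_def)

text \<open>The situation in which grafting is a plain union: the tree on the leaf \<open>l\<close>
  has the element \<open>l\<close> as root, with the same colour, and this is the only edge that two
  pieces may share. Edges, marks and nodes are compared only with elements of the same sort.\<close>

definition separated :: "('i, 'ia, 'e, 'ea, 'b, 'ba) poly \<Rightarrow> ('u, 'i, 'ia, 'e, 'b, 'ba) ptree \<Rightarrow>
    ('u \<Rightarrow> ('u, 'i, 'ia, 'e, 'b, 'ba) ptree) \<Rightarrow> bool" where
  "separated P S Q \<longleftrightarrow> (\<forall>k\<in>indices S. is_ptree P (piece S Q k)) \<and>
    (\<forall>l\<in>leaves S. root (Q l) = l \<and> ecol (Q l) l = ecol S l) \<and>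
    (\<forall>k\<in>indices S. \<forall>k'\<in>indices S. k \<noteq> k' \<longrightarrow>
      nodes (piece S Q k) \<inter> nodes (piece S Q k') = {} \<and>
      marks (piece S Q k) \<inter> marks (piece S Q k') = {}) \<and>
    (\<forall>l\<in>leaves S. edges S \<inter> edges (Q l) \<subseteq> {l}) \<and>
    (\<forall>l\<in>leaves S. \<forall>l'\<in>leaves S. l \<noteq> l' \<longrightarrow> edges (Q l) \<inter> edges (Q l') = {})"

definition agree_on :: "('u, 'i, 'ia, 'e, 'b, 'ba) ptree \<Rightarrow> ('u, 'i, 'ia, 'e, 'b, 'ba) ptree \<Rightarrow> bool" where
  "agree_on T U \<longleftrightarrow> (\<forall>x\<in>edges U. ecol T x = ecol U x) \<and>
    (\<forall>m\<in>marks U. smap T m = smap U m \<and> pmap T m = pmap U m \<and> mcol T m = mcol U m \<and>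
      siso T m = siso U m \<and> piso T m = piso U m) \<and>
    (\<forall>n\<in>nodes U. tmap T n = tmap U n \<and> ncol T n = ncol U n \<and> tiso T n = tiso U n)"

text \<open>The common interface of cutting and grafting: \<open>assembled_cut\<close> cuts a tree
  into such pieces, \<open>assembled_ex\<close> glues separated pieces, and
  \<open>assembled_unique\<close> says that cutting the glued tree gives the pieces back.\<close>

definition assembled :: "('i, 'ia, 'e, 'ea, 'b, 'ba) poly \<Rightarrow> ('u, 'i, 'ia, 'e, 'b, 'ba) ptree \<Rightarrow>
    ('u, 'i, 'ia, 'e, 'b, 'ba) ptree \<Rightarrow> ('u \<Rightarrow> ('u, 'i, 'ia, 'e, 'b, 'ba) ptree) \<Rightarrow> bool" where
  "assembled P T S Q \<longleftrightarrow> separated P S Q \<and> is_ptree P T \<and> root T = root S \<and>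
    edges T = (\<Union>k\<in>indices S. edges (piece S Q k)) \<and>
    marks T = (\<Union>k\<in>indices S. marks (piece S Q k)) \<and>
    nodes T = (\<Union>k\<in>indices S. nodes (piece S Q k)) \<and>
    (\<forall>k\<in>indices S. agree_on T (piece S Q k))"

context polynomial
begin

lemma separatedD:
  assumes "separated P S Q"
  shows sep_ptree: "k \<in> indices S \<Longrightarrow> is_ptree P (piece S Q k)"
    and sep_root: "l \<in> leaves S \<Longrightarrow> root (Q l) = l"
    and sep_ecol: "l \<in> leaves S \<Longrightarrow> ecol (Q l) l = ecol S l"
    and sep_nodes: "\<lbrakk>k \<in> indices S; k' \<in> indices S; n \<in> nodes (piece S Q k); n \<in> nodes (piece S Q k')\<rbrakk> \<Longrightarrow> k = k'"
    and sep_marks: "\<lbrakk>k \<in> indices S; k' \<in> indices S; n \<in> marks (piece S Q k); n \<in> marks (piece S Q k')\<rbrakk> \<Longrightarrow> k = k'"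
    and sep_edges: "\<lbrakk>k \<in> indices S; k' \<in> indices S; x \<in> edges (piece S Q k); x \<in> edges (piece S Q k')\<rbrakk>
      \<Longrightarrow> k = k' \<or> x \<in> leaves S \<and> (k = None \<and> k' = Some x \<or> k = Some x \<and> k' = None)"
proof -
  note a = assms[unfolded separated_def]
  show "k \<in> indices S \<Longrightarrow> is_ptree P (piece S Q k)" "l \<in> leaves S \<Longrightarrow> root (Q l) = l"
    "l \<in> leaves S \<Longrightarrow> ecol (Q l) l = ecol S l"
    using a by auto
  show "k = k'" if "k \<in> indices S" "k' \<in> indices S" "n \<in> nodes (piece S Q k)" "n \<in> nodes (piece S Q k')"
    using a that by (metis disjoint_iff)
  show "k = k'" if "k \<in> indices S" "k' \<in> indices S" "n \<in> marks (piece S Q k)" "n \<in> marks (piece S Q k')"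
    using a that by (metis disjoint_iff)
  assume k: "k \<in> indices S" "k' \<in> indices S" "x \<in> edges (piece S Q k)" "x \<in> edges (piece S Q k')"
  have e: "\<And>l x. l \<in> leaves S \<Longrightarrow> x \<in> edges S \<Longrightarrow> x \<in> edges (Q l) \<Longrightarrow> x = l"
    "\<And>l l' x. l \<in> leaves S \<Longrightarrow> l' \<in> leaves S \<Longrightarrow> x \<in> edges (Q l) \<Longrightarrow> x \<in> edges (Q l') \<Longrightarrow> l = l'"
    using a by blast+
  show "k = k' \<or> x \<in> leaves S \<and> (k = None \<and> k' = Some x \<or> k = Some x \<and> k' = None)"
  proof (cases k; cases k')
    fix l l' assume "k = Some l" "k' = Some l'"
    then show ?thesis using k e(2)[of l l' x] by simp
  next
    fix l assume "k = None" "k' = Some l"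
    then show ?thesis using k e(1)[of l x] by auto
  next
    fix l assume "k = Some l" "k' = None"
    then show ?thesis using k e(1)[of l x] by auto
  qed simp
qed

lemma separatedI:
  assumes "is_ptree P S" "\<And>l. l \<in> leaves S \<Longrightarrow> is_ptree P (Q l)"
    "\<And>l. l \<in> leaves S \<Longrightarrow> root (Q l) = l" "\<And>l. l \<in> leaves S \<Longrightarrow> ecol (Q l) l = ecol S l"
    "\<And>l. l \<in> leaves S \<Longrightarrow> nodes S \<inter> nodes (Q l) = {}" "\<And>l. l \<in> leaves S \<Longrightarrow> marks S \<inter> marks (Q l) = {}"
    "\<And>l. l \<in> leaves S \<Longrightarrow> edges S \<inter> edges (Q l) \<subseteq> {l}"
    "\<And>l l'. \<lbrakk>l \<in> leaves S; l' \<in> leaves S; l \<noteq> l'\<rbrakk> \<Longrightarrow> nodes (Q l) \<inter> nodes (Q l') = {}"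
    "\<And>l l'. \<lbrakk>l \<in> leaves S; l' \<in> leaves S; l \<noteq> l'\<rbrakk> \<Longrightarrow> marks (Q l) \<inter> marks (Q l') = {}"
    "\<And>l l'. \<lbrakk>l \<in> leaves S; l' \<in> leaves S; l \<noteq> l'\<rbrakk> \<Longrightarrow> edges (Q l) \<inter> edges (Q l') = {}"
  shows "separated P S Q"
proof -
  have "nodes (piece S Q k) \<inter> nodes (piece S Q k') = {} \<and> marks (piece S Q k) \<inter> marks (piece S Q k') = {}"
    if k: "k \<in> indices S" "k' \<in> indices S" "k \<noteq> k'" for k k'
  proof (cases k)
    case None
    then obtain l where "k' = Some l" using k by (cases k') auto
    then show ?thesis using None k assms(5,6) by simp
  next
    case (Some l)
    show ?thesis
    proof (cases k')
      case None
      then show ?thesis using Some k assms(5)[of l] assms(6)[of l] by (simp add: Int_commute)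
    next
      case (Some l')
      then show ?thesis using \<open>k = Some l\<close> k assms(8,9) by simp
    qed
  qed
  moreover have "is_ptree P (piece S Q k)" if "k \<in> indices S" for k
    using that assms(1,2) by (cases k) auto
  ultimately show ?thesis
    using assms(3,4,7,10) by (simp add: separated_def)
qed

lemma assembledD:
  assumes "assembled P T S Q"
  shows asm_sep: "separated P S Q" and asm_ptree: "is_ptree P T" and asm_root: "root T = root S"
    and asm_edges: "edges T = (\<Union>k\<in>indices S. edges (piece S Q k))"
    and asm_marks: "marks T = (\<Union>k\<in>indices S. marks (piece S Q k))"
    and asm_nodes: "nodes T = (\<Union>k\<in>indices S. nodes (piece S Q k))"
    and asm_agree: "k \<in> indices S \<Longrightarrow> agree_on T (piece S Q k)"
  using assms by (auto simp: assembled_def)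

lemma agree_onD:
  assumes "agree_on T U"
  shows agree_ecol: "x \<in> edges U \<Longrightarrow> ecol T x = ecol U x"
    and agree_smap: "m \<in> marks U \<Longrightarrow> smap T m = smap U m"
    and agree_pmap: "m \<in> marks U \<Longrightarrow> pmap T m = pmap U m"
    and agree_mcol: "m \<in> marks U \<Longrightarrow> mcol T m = mcol U m"
    and agree_siso: "m \<in> marks U \<Longrightarrow> siso T m = siso U m"
    and agree_piso: "m \<in> marks U \<Longrightarrow> piso T m = piso U m"
    and agree_tmap: "n \<in> nodes U \<Longrightarrow> tmap T n = tmap U n"
    and agree_ncol: "n \<in> nodes U \<Longrightarrow> ncol T n = ncol U n"
    and agree_tiso: "n \<in> nodes U \<Longrightarrow> tiso T n = tiso U n"
  using assms by (auto simp: agree_on_def)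

lemma agree_on_span: "agree_on T (span T A N)"
  by (auto simp: agree_on_def)

text \<open>Disjointness of the pieces comes from the two lemmas on intersections of ideal subtrees,
  and covering of \<open>T\<close> from \<open>edge_above_leaf\<close>.\<close>

theorem assembled_cut:
  assumes T: "is_ptree P T" and N: "closed_nodes T N"
  shows "assembled P T (subtree T N) (ideal_tree T)"
proof -
  note tT = ptree_tree[OF T]
  let ?S = "subtree T N"
  have lv: "l \<in> leaves ?S \<longleftrightarrow> l \<in> edges_over T N - tmap T ` N" for l
    by (simp add: leaves_subtree)
  have lT: "l \<in> edges T" if "l \<in> leaves ?S" for l
    using that edges_over_subset[OF tT N] by (auto simp: lv)
  have NT: "N \<subseteq> nodes T" using N by (simp add: closed_nodes_def)
  have disj_S: "n \<notin> ideal_nodes T l" if "n \<in> N" "l \<in> leaves ?S" for n l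
  proof
    assume "n \<in> ideal_nodes T l"
    then have "tmap T n = l"
      using ideal_edges_Int_edges_over[OF tT N that(2)[unfolded lv]] tmap_edges_over[OF N that(1)]
      by (simp add: ideal_nodes_def)
    then show False using that lv by blast
  qed
  have disj: "l = l'" if "n \<in> ideal_nodes T l" "n \<in> ideal_nodes T l'" "l \<in> leaves ?S" "l' \<in> leaves ?S" for n l l'
    using ideal_edges_disjoint[OF tT N that(3,4)[unfolded lv]] that(1,2) by (auto simp: ideal_nodes_def)
  have sep: "separated P ?S (ideal_tree T)"
  proof (rule separatedI)
    show "edges ?S \<inter> edges (ideal_tree T l) \<subseteq> {l}" if "l \<in> leaves ?S" for l
      using ideal_edges_Int_edges_over[OF tT N that[unfolded lv]] by (auto simp: ideal_tree_eq)
    show "edges (ideal_tree T l) \<inter> edges (ideal_tree T l') = {}"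
      if "l \<in> leaves ?S" "l' \<in> leaves ?S" "l \<noteq> l'" for l l'
      using ideal_edges_disjoint[OF tT N that(1,2)[unfolded lv]] that(3) by (auto simp: ideal_tree_eq)
    show "ecol (ideal_tree T l) l = ecol ?S l" if "l \<in> leaves ?S" for l
      using ideal_edges_self[OF lT[OF that]] leaves_subset[OF that] by (simp add: ideal_tree_eq)
    show "nodes (subtree T N) \<inter> nodes (ideal_tree T l) = {}" "marks (subtree T N) \<inter> marks (ideal_tree T l) = {}"
      if "l \<in> leaves ?S" for l
      using disj_S that by (auto simp: ideal_tree_eq marks_over_def)
    show "nodes (ideal_tree T l) \<inter> nodes (ideal_tree T l') = {}" "marks (ideal_tree T l) \<inter> marks (ideal_tree T l') = {}"
      if "l \<in> leaves ?S" "l' \<in> leaves ?S" "l \<noteq> l'" for l l'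
      using disj that by (auto simp: ideal_tree_eq marks_over_def)
  qed (simp_all add: subtree_is_ptree T N ideal_tree_is_ptree root_ideal_tree lT)
  have U: "(\<Union>k\<in>indices ?S. h (piece ?S (ideal_tree T) k)) = h ?S \<union> (\<Union>l\<in>leaves ?S. h (ideal_tree T l))"
    for h :: "_ \<Rightarrow> 'z set"
    by (simp add: indices_def)
  have eT: "edges T = edges_over T N \<union> (\<Union>l\<in>leaves ?S. ideal_edges T l)"
  proof (intro subset_antisym subsetI)
    fix x assume "x \<in> edges T"
    then show "x \<in> edges_over T N \<union> (\<Union>l\<in>leaves ?S. ideal_edges T l)"
      using edge_above_leaf[OF tT N] lv by blast
  qed (use edges_over_subset[OF tT N] in \<open>auto simp: ideal_edges_def\<close>)
  \<comment> \<open>If the output edge of the node lies in the subtree it is itself a leaf there, by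
    injectivity of \<open>tmap\<close>. Otherwise it lies above some leaf.\<close>
  have "\<exists>l\<in>leaves ?S. n \<in> ideal_nodes T l" if "n \<in> nodes T" "n \<notin> N" for n
  proof (cases "tmap T n \<in> edges_over T N")
    case True
    then have "tmap T n \<in> leaves ?S"
      using that NT inj_onD[OF inj_tmap[OF tT]] by (auto simp: lv)
    then show ?thesis
      using that ideal_edges_self[OF tmap_in[OF tT that(1)]] by (auto simp: ideal_nodes_def)
  next
    case False
    then show ?thesis
      using edge_above_leaf[OF tT N tmap_in[OF tT that(1)]] that by (auto simp: ideal_nodes_def lv)
  qed
  then have nT: "nodes T = N \<union> (\<Union>l\<in>leaves ?S. ideal_nodes T l)"
    using NT by (auto simp: ideal_nodes_def)
  have "marks T = marks_over T (nodes T)"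
    using pmap_in[OF tT] by (auto simp: marks_over_def)
  then have mT: "marks T = marks_over T N \<union> (\<Union>l\<in>leaves ?S. marks_over T (ideal_nodes T l))"
    by (subst (asm) nT) (auto simp: marks_over_def)
  have "agree_on T (piece ?S (ideal_tree T) k)" for k
    by (cases k) (simp_all add: ideal_tree_eq agree_on_span)
  then show ?thesis
    unfolding assembled_def U using sep T root_subtree[OF T N] eT nT mT by (simp add: ideal_tree_eq)
qed

text \<open>A mark belongs to some piece, together with its node. As the node sets of the pieces are
  disjoint, this piece is determined by the node.\<close>

lemma marks_over_piece:
  assumes A: "assembled P T S Q" and k: "k \<in> indices S"
  shows "marks_over T (nodes (piece S Q k)) = marks (piece S Q k)"
proof -
  note sep = asm_sep[OF A]
  have "m \<in> marks (piece S Q k)" if m: "m \<in> marks T" "pmap T m \<in> nodes (piece S Q k)" for m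
  proof -
    obtain k' where k': "k' \<in> indices S" "m \<in> marks (piece S Q k')"
      using m asm_marks[OF A] by blast
    then have "pmap T m \<in> nodes (piece S Q k')"
      using agree_pmap[OF asm_agree[OF A]] pmap_in[OF ptree_tree[OF sep_ptree[OF sep]]] by simp
    then show ?thesis
      using sep_nodes[OF sep k k'(1) m(2)] k' by simp
  qed
  moreover have "m \<in> marks_over T (nodes (piece S Q k))" if "m \<in> marks (piece S Q k)" for m
    using that k asm_marks[OF A] agree_pmap[OF asm_agree[OF A k] that]
      pmap_in[OF ptree_tree[OF sep_ptree[OF sep k]] that] by (auto simp: marks_over_def)
  ultimately show ?thesis
    by (auto simp: marks_over_def)
qed

text \<open>The edges of \<open>S\<close> are its root and its input edges, which are
  \<open>edges_over T (nodes S)\<close> because \<open>T\<close> has the same root and the same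
  marks over these nodes. For the grafted trees it has to be shown that the edges of
  \<open>T\<close> above \<open>l\<close> are those of \<open>Q l\<close>.\<close>

theorem assembled_unique:
  assumes A: "assembled P T S Q"
  shows "closed_nodes T (nodes S)" "subtree T (nodes S) = S" "\<And>l. l \<in> leaves S \<Longrightarrow> ideal_tree T l = Q l"
proof -
  note sep = asm_sep[OF A] and T = asm_ptree[OF A]
  note tT = ptree_tree[OF T]
  have S: "is_ptree P S" using sep_ptree[OF sep None_indices] by simp
  note tS = ptree_tree[OF S]
  have Q: "is_ptree P (Q l)" if "l \<in> leaves S" for l using sep_ptree[OF sep, of "Some l"] that by simp
  note agS = asm_agree[OF A None_indices, simplified]
  have agQ: "agree_on T (Q l)" if "l \<in> leaves S" for l using asm_agree[OF A, of "Some l"] that by simp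
  have sub: "nodes S \<subseteq> nodes T" "edges S \<subseteq> edges T"
    using asm_nodes[OF A] asm_edges[OF A] by (auto simp: indices_def)
  note mS = marks_over_piece[OF A None_indices, simplified]
  have mQ: "marks_over T (nodes (Q l)) = marks (Q l)" if "l \<in> leaves S" for l
    using marks_over_piece[OF A, of "Some l"] that by simp
  have eS: "edges S = insert (root S) (smap S ` marks S)"
    using root_complement[OF tS] smap_in[OF tS] by blast
  have sS: "smap T ` marks S = smap S ` marks S"
    by (rule image_cong[OF refl agree_smap[OF agS]])
  have eo: "edges_over T (nodes S) = edges S"
    by (simp add: edges_over_def mS eS asm_root[OF A] sS)
  have "tmap T n \<in> edges S" if "n \<in> nodes S" for n
    using agree_tmap[OF agS that] tmap_in[OF tS that] by simp
  then show cl: "closed_nodes T (nodes S)"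
    using sub(1) eS by (auto simp: closed_nodes_def mS asm_root[OF A] sS)
  show "subtree T (nodes S) = S"
    by (rule ptree_eqI[OF subtree_is_ptree[OF T cl] S])
      (simp_all add: eo mS agree_onD[OF agS])
  fix l assume l: "l \<in> leaves S"
  note agl = agQ[OF l] and tQ = ptree_tree[OF Q[OF l]]
  have QT: "edges (Q l) \<subseteq> edges T" "nodes (Q l) \<subseteq> nodes T" "marks (Q l) \<subseteq> marks T"
    using asm_edges[OF A] asm_nodes[OF A] asm_marks[OF A] l by (auto simp: indices_def)
  \<comment> \<open>The only edge that \<open>Q l\<close> can share with another piece is
    \<open>l\<close>, shared with \<open>S\<close>. Being a leaf of \<open>S\<close>, it is not an
    output edge there, so the node belongs to \<open>Q l\<close>.\<close>
  have n_in: "n \<in> nodes (Q l)" if n: "n \<in> nodes T" "tmap T n \<in> edges (Q l)" for n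
  proof -
    obtain k where k: "k \<in> indices S" "n \<in> nodes (piece S Q k)"
      using n(1) asm_nodes[OF A] by blast
    then have e: "tmap T n \<in> edges (piece S Q k)" and t: "tmap T n = tmap (piece S Q k) n"
      using agree_tmap[OF asm_agree[OF A k(1)] k(2)] tmap_in[OF ptree_tree[OF sep_ptree[OF sep k(1)]] k(2)] by auto
    have "k = Some l \<or> tmap T n \<in> leaves S \<and> k = None"
      using sep_edges[OF sep k(1) _ e, of "Some l"] n(2) l by auto
    then show ?thesis
      using k t by (auto simp: leaves_def)
  qed
  have m_in: "m \<in> marks (Q l)" if "m \<in> marks T" "pmap T m \<in> nodes (Q l)" for m
    using mQ[OF l] that by (auto simp: marks_over_def)
  have lQ: "l \<in> edges (Q l)"
    using root_in[OF tQ] sep_root[OF sep l] by simp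
  \<comment> \<open>One inclusion is proved by induction in \<open>T\<close>, where
    \<open>n_in\<close> and \<open>m_in\<close> keep the walk upwards inside \<open>Q l\<close>. The
    reverse one is an induction in \<open>Q l\<close>, starting at its root
    \<open>l\<close>.\<close>
  have "x \<in> ideal_edges T l \<longrightarrow> x \<in> edges (Q l)" if "x \<in> edges T" for x
    using tT that
  proof (induction rule: tree_induct)
    case root
    then show ?case using lQ ideal_edges_root[OF tT, of l] by simp
  next
    case (smap m)
    show ?case
    proof
      assume "smap T m \<in> ideal_edges T l"
      then consider "smap T m = l" | "tmap T (pmap T m) \<in> edges (Q l)"
        using ideal_edges_smap[OF tT smap.hyps] smap.IH by blast
      then show "smap T m \<in> edges (Q l)"
      proof cases
        case 2
        then have m: "m \<in> marks (Q l)"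
          using m_in[OF smap.hyps n_in[OF pmap_in[OF tT smap.hyps]]] by blast
        then show ?thesis
          using agree_smap[OF agl m] smap_in[OF tQ m] by simp
      qed (use lQ in simp)
    qed
  qed
  moreover have "x \<in> ideal_edges T l" if "x \<in> edges (Q l)" for x
    using tQ that
  proof (induction rule: tree_induct)
    case root
    then show ?case
      using ideal_edges_self[of l T] sep_root[OF sep l] lQ QT(1) by auto
  next
    case (smap m)
    then have mT: "m \<in> marks T" using QT by blast
    have "tmap T (pmap T m) = tmap (Q l) (pmap (Q l) m)"
      using agree_pmap[OF agl smap.hyps] agree_tmap[OF agl pmap_in[OF tQ smap.hyps]] by simp
    then show ?case
      using smap.IH ideal_edges_smap[OF tT mT] agree_smap[OF agl smap.hyps] by simp
  qed
  ultimately have ie: "ideal_edges T l = edges (Q l)"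
    by (auto simp: ideal_edges_def)
  have "tmap T n \<in> edges (Q l)" if "n \<in> nodes (Q l)" for n
    using agree_tmap[OF agl that] tmap_in[OF tQ that] by simp
  then have ino: "ideal_nodes T l = nodes (Q l)"
    using n_in QT by (auto simp: ideal_nodes_def ie)
  have lT: "l \<in> edges T" using lQ QT by blast
  show "ideal_tree T l = Q l"
    by (rule ptree_eqI[OF ideal_tree_is_ptree[OF T lT] Q[OF l]])
      (simp_all add: ideal_tree_eq ie ino mQ[OF l] agree_onD[OF agl])
qed

text \<open>All structure maps are amalgamated. A shared edge \<open>l\<close> is a leaf of
  \<open>S\<close> and the root of \<open>Q l\<close>, so it is an output edge only on one side and
  an input edge only on the other. This keeps \<open>tmap\<close> and \<open>smap\<close> injective,
  and a height function for the union is built explicitly.\<close>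

theorem assembled_ex:
  fixes S :: "('u, 'i, 'ia, 'e, 'b, 'ba) ptree"
  assumes sep: "separated P S Q"
  shows "\<exists>T. assembled P T S Q"
proof -
  let ?K = "indices S" and ?C = "piece S Q"
  note C = sep_ptree[OF sep]
  note tC = ptree_tree[OF C]
  have S: "is_ptree P S" using C[OF None_indices] by simp
  note tS = ptree_tree[OF S]
  define T where "T = \<lparr>edges = (\<Union>k\<in>?K. edges (?C k)), marks = (\<Union>k\<in>?K. marks (?C k)), nodes = (\<Union>k\<in>?K. nodes (?C k)),
    smap = amalg ?K (\<lambda>k. marks (?C k)) (\<lambda>k. smap (?C k)), pmap = amalg ?K (\<lambda>k. marks (?C k)) (\<lambda>k. pmap (?C k)),
    tmap = amalg ?K (\<lambda>k. nodes (?C k)) (\<lambda>k. tmap (?C k)), ecol = amalg ?K (\<lambda>k. edges (?C k)) (\<lambda>k. ecol (?C k)),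
    mcol = amalg ?K (\<lambda>k. marks (?C k)) (\<lambda>k. mcol (?C k)), ncol = amalg ?K (\<lambda>k. nodes (?C k)) (\<lambda>k. ncol (?C k)),
    siso = amalg ?K (\<lambda>k. marks (?C k)) (\<lambda>k. siso (?C k)), piso = amalg ?K (\<lambda>k. marks (?C k)) (\<lambda>k. piso (?C k)),
    tiso = amalg ?K (\<lambda>k. nodes (?C k)) (\<lambda>k. tiso (?C k))\<rparr>"
  have TE: "edges T = (\<Union>k\<in>?K. edges (?C k))" and TM: "marks T = (\<Union>k\<in>?K. marks (?C k))"
    and TN: "nodes T = (\<Union>k\<in>?K. nodes (?C k))" by (simp_all add: T_def)
  have am: "amalg ?K (\<lambda>k. marks (?C k)) F m = F k m" if "k \<in> ?K" "m \<in> marks (?C k)"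
    for F :: "'u option \<Rightarrow> 'u \<Rightarrow> 'z" and k m
    using sep_marks[OF sep] that by (intro amalg_eq[where D = "\<lambda>k. marks (?C k)"]) blast+
  have an: "amalg ?K (\<lambda>k. nodes (?C k)) F m = F k m" if "k \<in> ?K" "m \<in> nodes (?C k)"
    for F :: "'u option \<Rightarrow> 'u \<Rightarrow> 'z" and k m
    using sep_nodes[OF sep] that by (intro amalg_eq[where D = "\<lambda>k. nodes (?C k)"]) blast+
  have ae: "amalg ?K (\<lambda>k. edges (?C k)) (\<lambda>k. ecol (?C k)) x = ecol (?C k) x" if "k \<in> ?K" "x \<in> edges (?C k)" for k x
  proof (rule amalg_eq[where D = "\<lambda>k. edges (?C k)" and F = "\<lambda>k. ecol (?C k)", OF that])
    fix k' assume "k' \<in> ?K" "x \<in> edges (?C k')"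
    then show "ecol (?C k') x = ecol (?C k) x"
      using sep_edges[OF sep _ that(1) _ that(2), of k'] sep_ecol[OF sep, of x] by auto
  qed
  have ag: "agree_on T (?C k)" if "k \<in> ?K" for k
    unfolding agree_on_def T_def by (simp add: am[OF that] an[OF that] ae[OF that])
  have finK: "finite ?K"
    using tS by (auto simp: indices_def leaves_def is_tree_def)
  have fin: "finite (edges T)" "finite (marks T)" "finite (nodes T)"
    using finK tC by (auto simp: TE TM TN is_tree_def)
  have mC: "\<exists>k\<in>?K. m \<in> marks (?C k) \<and> smap T m = smap (?C k) m \<and> pmap T m = pmap (?C k) m" if "m \<in> marks T" for m
    using that agree_onD[OF ag] by (auto simp: TM)
  have nC: "\<exists>k\<in>?K. n \<in> nodes (?C k) \<and> tmap T n = tmap (?C k) n" if "n \<in> nodes T" for n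
    using that agree_onD[OF ag] by (auto simp: TN)
  have ext: "smap T \<in> extensional (marks T)" "pmap T \<in> extensional (marks T)"
      "tmap T \<in> extensional (nodes T)" "ecol T \<in> extensional (edges T)" "mcol T \<in> extensional (marks T)"
      "ncol T \<in> extensional (nodes T)" "siso T \<in> extensional (marks T)"
      "piso T \<in> extensional (marks T)" "tiso T \<in> extensional (nodes T)"
    by (simp_all add: T_def amalg_extensional)
  have s_in: "smap T m \<in> edges T" and p_in: "pmap T m \<in> nodes T" if m: "m \<in> marks T" for m
  proof -
    obtain k where k: "k \<in> ?K" "m \<in> marks (?C k)" "smap T m = smap (?C k) m" "pmap T m = pmap (?C k) m"
      using mC[OF m] by blast
    show "smap T m \<in> edges T"
      unfolding TE k(3) by (rule UN_I, rule k(1), rule smap_in[OF tC[OF k(1)] k(2)])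
    show "pmap T m \<in> nodes T"
      unfolding TN k(4) by (rule UN_I, rule k(1), rule pmap_in[OF tC[OF k(1)] k(2)])
  qed
  have t_in: "tmap T n \<in> edges T" if n: "n \<in> nodes T" for n
  proof -
    obtain k where k: "k \<in> ?K" "n \<in> nodes (?C k)" "tmap T n = tmap (?C k) n"
      using nC[OF n] by blast
    show ?thesis
      unfolding TE k(3) by (rule UN_I, rule k(1), rule tmap_in[OF tC[OF k(1)] k(2)])
  qed
  have maps: "smap T \<in> marks T \<rightarrow>\<^sub>E edges T" "pmap T \<in> marks T \<rightarrow>\<^sub>E nodes T" "tmap T \<in> nodes T \<rightarrow>\<^sub>E edges T"
    using s_in p_in t_in ext by (auto simp: PiE_iff)
  have not_root: "smap (?C k) m \<noteq> x" if "k = Some x" "x \<in> leaves S" "m \<in> marks (?C k)" for k x m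
    using smap_neq_root[OF tC[of k] that(3)] sep_root[OF sep that(2)] that(1,2) by simp
  have not_leaf: "tmap (?C k) n \<noteq> x" if "k = None" "x \<in> leaves S" "n \<in> nodes (?C k)" for k x n
    using that by (auto simp: leaves_def)
  have inj_t: "inj_on (tmap T) (nodes T)"
  proof (rule inj_onI)
    fix n n' assume n: "n \<in> nodes T" "n' \<in> nodes T" "tmap T n = tmap T n'"
    then obtain k k' where k: "k \<in> ?K" "n \<in> nodes (?C k)" "tmap T n = tmap (?C k) n"
      "k' \<in> ?K" "n' \<in> nodes (?C k')" "tmap T n' = tmap (?C k') n'" using nC by metis
    have e: "tmap T n \<in> edges (?C k)" "tmap T n \<in> edges (?C k')"
      using tmap_in[OF tC[OF k(1)] k(2)] tmap_in[OF tC[OF k(4)] k(5)] n(3) k(3,6) by simp_all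
    \<comment> \<open>Distinct pieces could share the output edge only if it were a leaf of
      \<open>S\<close>, but one of the pieces would then be \<open>S\<close>, where a leaf is not an
      output edge.\<close>
    have "k = k'"
      using sep_edges[OF sep k(1,4) e] not_leaf[OF _ _ k(2)] not_leaf[OF _ _ k(5)] n(3) k(3,6) by metis
    then show "n = n'"
      using inj_onD[OF inj_tmap[OF tC[OF k(1)]]] k n(3) by auto
  qed
  have inj_s: "inj_on (smap T) (marks T)"
  proof (rule inj_onI)
    fix n n' assume n: "n \<in> marks T" "n' \<in> marks T" "smap T n = smap T n'"
    then obtain k k' where k: "k \<in> ?K" "n \<in> marks (?C k)" "smap T n = smap (?C k) n"
      "k' \<in> ?K" "n' \<in> marks (?C k')" "smap T n' = smap (?C k') n'" using mC by metis
    have e: "smap T n \<in> edges (?C k)" "smap T n \<in> edges (?C k')"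
      using smap_in[OF tC[OF k(1)] k(2)] smap_in[OF tC[OF k(4)] k(5)] n(3) k(3,6) by simp_all
    \<comment> \<open>Dually, a shared input edge would be the root of one of the two pieces, and a
      root is not an input edge.\<close>
    have "k = k'"
      using sep_edges[OF sep k(1,4) e] not_root[OF _ _ k(2)] not_root[OF _ _ k(5)] n(3) k(3,6) by metis
    then show "n = n'"
      using inj_onD[OF inj_smap[OF tC[OF k(1)]]] k n(3) by auto
  qed
  have smapS: "smap S m \<in> smap T ` marks T" if "m \<in> marks S" for m
    using that agree_smap[OF ag[OF None_indices]] by (force simp: TM indices_def)
  have cover: "x = root S \<or> x \<in> smap T ` marks T" if xT: "x \<in> edges T" for x
  proof -
    have S_case: "x = root S \<or> x \<in> smap T ` marks T" if "x \<in> edges S" for x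
      using edge_cases[OF tS that] smapS by metis
    obtain k where k: "k \<in> ?K" "x \<in> edges (?C k)" using xT by (auto simp: TE)
    show ?thesis
    proof (cases k)
      case None
      then show ?thesis using S_case k by simp
    next
      case (Some l)
      then have l: "l \<in> leaves S" using k by simp
      from tC[OF k(1)] k(2) show ?thesis
      proof (cases rule: edge_cases)
        case 1
        then have "x = l" using Some sep_root[OF sep l] by simp
        then show ?thesis using S_case leaves_subset[OF l] by simp
      next
        case (2 m)
        then have "m \<in> marks T" "smap T m = x"
          using k(1) agree_smap[OF ag[OF k(1)]] by (auto simp: TM)
        then show ?thesis by blast
      qed
    qed
  qed
  \<comment> \<open>If the root of \<open>S\<close> lies on a grafted tree, then \<open>S\<close> is
    a single leaf edge with that tree on it, and its root is not an input edge there either.\<close>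
  have rootS: "root S \<noteq> smap T m" if mT: "m \<in> marks T" for m
  proof
    assume r: "root S = smap T m"
    obtain k where k: "k \<in> ?K" "m \<in> marks (?C k)" "smap T m = smap (?C k) m" using mC[OF mT] by blast
    have "k = None \<or> smap T m \<in> leaves S \<and> k = Some (smap T m)"
      using sep_edges[OF sep None_indices k(1), of "smap T m"] root_in[OF tS] smap_in[OF tC[OF k(1)] k(2)] r k(3) by auto
    then show False
      using not_root[of k "smap T m" m] smap_neq_root[OF tS, of m] k r by auto
  qed
  have compl: "edges T - smap T ` marks T = {root S}"
    using cover rootS root_in[OF tS] by (auto simp: TE indices_def)
  obtain dS where dS: "\<And>m. m \<in> marks S \<Longrightarrow> (dS (tmap S (pmap S m)) :: nat) < dS (smap S m)"
    using tree_height[OF tS] by blast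
  have "\<forall>l\<in>leaves S. \<exists>d. \<forall>m\<in>marks (Q l). (d (tmap (Q l) (pmap (Q l) m)) :: nat) < d (smap (Q l) m)"
  proof
    fix l assume "l \<in> leaves S"
    then have "is_tree (Q l)" using tC[of "Some l"] by simp
    then show "\<exists>d. \<forall>m\<in>marks (Q l). (d (tmap (Q l) (pmap (Q l) m)) :: nat) < d (smap (Q l) m)"
      using tree_height by metis
  qed
  then obtain dQ where dQ: "\<And>l m. l \<in> leaves S \<Longrightarrow> m \<in> marks (Q l) \<Longrightarrow>
      (dQ l (tmap (Q l) (pmap (Q l) m)) :: nat) < dQ l (smap (Q l) m)"
    by metis
  \<comment> \<open>\<open>B\<close> exceeds all heights in \<open>S\<close>, so a shift by
    \<open>B\<close> places every edge of a grafted tree other than its root above all of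
    \<open>S\<close>.\<close>
  obtain B where B: "\<And>x. x \<in> edges S \<Longrightarrow> dS x < B"
    using tS finite_nat_set_iff_bounded[of "dS ` edges S"] by (auto simp: is_tree_def)
  \<comment> \<open>On a shared edge the height from \<open>S\<close> is taken. Passing from
    \<open>Q l\<close> down to \<open>l\<close> therefore drops from at least \<open>B\<close> to
    below \<open>B\<close>.\<close>
  define d where "d x = (if x \<in> edges S then dS x else B + amalg (leaves S) (\<lambda>l. edges (Q l)) dQ x)" for x
  have dS': "d x = dS x" if "x \<in> edges S" for x using that by (simp add: d_def)
  have dQ': "d x = B + dQ l x" if l: "l \<in> leaves S" and x: "x \<in> edges (Q l)" "x \<noteq> l" for x l
  proof -
    have "x \<notin> edges S"
      using sep_edges[OF sep, of None "Some l" x] l x by auto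
    moreover have "amalg (leaves S) (\<lambda>l. edges (Q l)) dQ x = dQ l x"
    proof (rule amalg_eq[where D = "\<lambda>l. edges (Q l)"])
      show "dQ l' x = dQ l x" if "l' \<in> leaves S" "x \<in> edges (Q l')" for l'
        using sep_edges[OF sep, of "Some l'" "Some l" x] l x that by simp
    qed (use l x in auto)
    ultimately show ?thesis by (simp add: d_def)
  qed
  have d: "d (tmap T (pmap T m)) < d (smap T m)" if mT: "m \<in> marks T" for m
  proof -
    obtain k where k: "k \<in> ?K" "m \<in> marks (?C k)" "smap T m = smap (?C k) m" "pmap T m = pmap (?C k) m"
      using mC[OF mT] by blast
    have t: "tmap T (pmap T m) = tmap (?C k) (pmap (?C k) m)"
      using k(4) agree_tmap[OF ag[OF k(1)] pmap_in[OF tC[OF k(1)] k(2)]] by simp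
    have tin: "tmap (?C k) (pmap (?C k) m) \<in> edges (?C k)"
      by (intro tmap_in pmap_in tC k)
    have sin: "smap (?C k) m \<in> edges (?C k)" by (intro smap_in tC k)
    show ?thesis
    proof (cases k)
      case None
      then show ?thesis using dS k t tin sin dS' by simp
    next
      case (Some l)
      then have l: "l \<in> leaves S" using k by simp
      have s: "d (smap T m) = B + dQ l (smap (Q l) m)"
        using dQ'[OF l] sin not_root[OF Some l k(2)] Some k(3) by simp
      show ?thesis
      proof (cases "tmap T (pmap T m) = l")
        case True
        then show ?thesis using s B[OF leaves_subset[OF l]] dS'[OF leaves_subset[OF l]] by simp
      next
        case False
        then show ?thesis using s dQ'[OF l _ False] dQ[OF l] tin t k Some by simp
      qed
    qed
  qed
  have tree: "is_tree T" "root T = root S"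
    by (rule is_treeI[OF fin maps inj_t inj_s compl d], assumption)+
  have pb: "local_pullback P T n" if n: "n \<in> nodes T" for n
  proof -
    obtain k where k: "k \<in> ?K" "n \<in> nodes (?C k)" using n by (auto simp: TN)
    note a = agree_onD[OF ag[OF k(1)]]
    show ?thesis
    proof (rule local_pullback_cong[where h = "\<lambda>m. m" and T = "?C k" and n = n])
      show "ncol (?C k) n = ncol T n" using a(8)[OF k(2)] by simp
      show "local_pullback P (?C k) n" by (rule ptree_pullback[OF C[OF k(1)] k(2)])
      show "m \<in> marks T \<and> pmap T m = n \<and> mcol T m = mcol (?C k) m \<and> piso T m = piso (?C k) m"
        if "m \<in> marks (?C k)" "pmap (?C k) m = n" for m
        using that a k(1) by (auto simp: TM)
      \<comment> \<open>All marks of \<open>T\<close> over a node of a piece lie in this piece, so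
        the pullback condition at the node is literally the one in the piece.\<close>
      fix m assume m: "m \<in> marks T" "pmap T m = n"
      obtain k' where k': "k' \<in> ?K" "m \<in> marks (?C k')" "pmap T m = pmap (?C k') m" using mC[OF m(1)] by blast
      then have "k' = k"
        using sep_nodes[OF sep k'(1) k(1) _ k(2)] pmap_in[OF tC[OF k'(1)] k'(2)] m(2) by simp
      then show "\<exists>!m'. m' \<in> marks (?C k) \<and> pmap (?C k) m' = n \<and> m' = m"
        using k' m(2) by auto
    qed
  qed
  have "ecol T x \<in> Obj (gpdI P)" if "x \<in> edges T" for x
    using that agree_ecol[OF ag] ecol_Obj[OF C] by (force simp: TE)
  moreover have "mcol T m \<in> Obj (gpdE P) \<and> siso T m \<in> Hom (gpdI P) (ecol T (smap T m)) (omap (funS P) (mcol T m)) \<and>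
      piso T m \<in> Hom (gpdB P) (omap (funP P) (mcol T m)) (ncol T (pmap T m))" if mT: "m \<in> marks T" for m
  proof -
    obtain k where k: "k \<in> ?K" "m \<in> marks (?C k)" using mT by (auto simp: TM)
    note a = agree_onD[OF ag[OF k(1)]] and c = C[OF k(1)]
    show ?thesis
      using k mcol_Obj[OF c] siso_Hom[OF c] piso_Hom[OF c]
      by (simp add: a smap_in[OF tC] pmap_in[OF tC])
  qed
  moreover have "ncol T n \<in> Obj (gpdB P) \<and> tiso T n \<in> Hom (gpdI P) (omap (funT P) (ncol T n)) (ecol T (tmap T n))"
    if nT: "n \<in> nodes T" for n
  proof -
    obtain k where k: "k \<in> ?K" "n \<in> nodes (?C k)" using nT by (auto simp: TN)
    note a = agree_onD[OF ag[OF k(1)]] and c = C[OF k(1)]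
    show ?thesis
      using k ncol_Obj[OF c] tiso_Hom[OF c] by (simp add: a tmap_in[OF tC])
  qed
  ultimately have "is_ptree P T"
    using tree ext pb by (simp add: is_ptree_iff PiE_iff)
  then have "assembled P T S Q"
    using sep tree ag by (simp add: assembled_def TE TM TN)
  then show ?thesis ..
qed

section \<open>Gluing of isomorphisms\<close>

lemma restrict_ptree_map_eqI:
  fixes f g :: "('u, 'ia, 'ea, 'ba) ptree_map"
  assumes "ptree_embedding P S T g"
    "\<And>x. x \<in> edges S \<Longrightarrow> emap f x = emap g x \<and> eiso f x = eiso g x"
    "\<And>x. x \<in> marks S \<Longrightarrow> mmap f x = mmap g x \<and> miso f x = miso g x"
    "\<And>x. x \<in> nodes S \<Longrightarrow> nmap f x = nmap g x \<and> niso f x = niso g x"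
  shows "restrict_ptree_map S f = g"
  using assms(2-) embedding_extensional[OF assms(1)]
  by (intro ptree_map.equality) (auto simp: fun_eq_iff restrict_def extensional_def)

text \<open>The isomorphisms of the pieces overlap only at the leaves of \<open>S\<close>. There
  they agree on edges because roots go to roots, and on colour arrows by the hypothesis
  \<open>e\<close>, so they can be amalgamated.\<close>

theorem assembled_iso_ex:
  fixes S :: "('u, 'i, 'ia, 'e, 'b, 'ba) ptree" and g :: "('u, 'ia, 'ea, 'ba) ptree_map"
  assumes A: "assembled P T S Q" and A': "assembled P T' S' Q'" and g: "ptree_iso P S S' g"
    and h: "\<And>l. l \<in> leaves S \<Longrightarrow> ptree_iso P (Q l) (Q' (emap g l)) (h l)"
    and e: "\<And>l. l \<in> leaves S \<Longrightarrow> eiso (h l) l = eiso g l"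
  shows "\<exists>f. ptree_iso P T T' f \<and> restrict_ptree_map S f = g \<and>
    (\<forall>l\<in>leaves S. restrict_ptree_map (Q l) f = h l)"
proof -
  let ?K = "indices S" and ?C = "piece S Q" and ?C' = "piece S' Q'" and ?G = "piece g h"
  let ?\<kappa> = "map_option (emap g)"
  note sep = asm_sep[OF A] and sep' = asm_sep[OF A']
  note C = sep_ptree[OF sep] and C' = sep_ptree[OF sep']
  note tC = ptree_tree[OF C] and tC' = ptree_tree[OF C']
  note T = asm_ptree[OF A] and T' = asm_ptree[OF A']
  have S: "is_ptree P S" "is_ptree P S'" using C[OF None_indices] C'[OF None_indices] by simp_all
  have lv: "emap g ` leaves S = leaves S'" by (rule iso_leaves[OF S(1) g])
  have \<kappa>: "?\<kappa> k \<in> indices S'" if "k \<in> ?K" for k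
    using that lv by (cases k) auto
  have \<kappa>_surj: "\<exists>k\<in>?K. k' = ?\<kappa> k" if "k' \<in> indices S'" for k'
  proof (cases k')
    case None
    then show ?thesis by (intro bexI[of _ None]) auto
  next
    case (Some l')
    then have "l' \<in> emap g ` leaves S" using that lv by simp
    then obtain l where "l \<in> leaves S" "l' = emap g l" ..
    with Some show ?thesis by (intro bexI[of _ "Some l"]) auto
  qed
  have G: "ptree_iso P (?C k) (?C' (?\<kappa> k)) (?G k)" if "k \<in> ?K" for k
    using that g h by (cases k) auto
  note Ge = iso_embedding[OF G]
  define f where "f = \<lparr>emap = amalg ?K (\<lambda>k. edges (?C k)) (\<lambda>k. emap (?G k)),
    mmap = amalg ?K (\<lambda>k. marks (?C k)) (\<lambda>k. mmap (?G k)), nmap = amalg ?K (\<lambda>k. nodes (?C k)) (\<lambda>k. nmap (?G k)),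
    eiso = amalg ?K (\<lambda>k. edges (?C k)) (\<lambda>k. eiso (?G k)), miso = amalg ?K (\<lambda>k. marks (?C k)) (\<lambda>k. miso (?G k)),
    niso = amalg ?K (\<lambda>k. nodes (?C k)) (\<lambda>k. niso (?G k))\<rparr>"
  \<comment> \<open>The edge \<open>l\<close> is the root of \<open>Q l\<close>, and its image under
    \<open>g\<close> is the root of the corresponding grafted tree of \<open>T'\<close>.\<close>
  have root_h: "emap (h l) l = emap g l" if l: "l \<in> leaves S" for l
  proof -
    have "emap g l \<in> leaves S'" using l lv by blast
    then show ?thesis
      using iso_root[OF _ _ h[OF l]] C[of "Some l"] C'[of "Some (emap g l)"] l sep_root[OF sep l]
        sep_root[OF sep'] by simp
  qed
  have am: "amalg ?K (\<lambda>k. marks (?C k)) F m = F k m" if "k \<in> ?K" "m \<in> marks (?C k)"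
    for F :: "'u option \<Rightarrow> 'u \<Rightarrow> 'z" and k m
    using sep_marks[OF sep] that by (intro amalg_eq[where D = "\<lambda>k. marks (?C k)"]) blast+
  have an: "amalg ?K (\<lambda>k. nodes (?C k)) F m = F k m" if "k \<in> ?K" "m \<in> nodes (?C k)"
    for F :: "'u option \<Rightarrow> 'u \<Rightarrow> 'z" and k m
    using sep_nodes[OF sep] that by (intro amalg_eq[where D = "\<lambda>k. nodes (?C k)"]) blast+
  have fm: "mmap f m = mmap (?G k) m" "miso f m = miso (?G k) m" if "k \<in> ?K" "m \<in> marks (?C k)" for k m
    by (simp_all add: f_def am[OF that])
  have fn: "nmap f n = nmap (?G k) n" "niso f n = niso (?G k) n" if "k \<in> ?K" "n \<in> nodes (?C k)" for k n
    by (simp_all add: f_def an[OF that])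
  have overlap: "emap (?G k') x = emap (?G k) x \<and> eiso (?G k') x = eiso (?G k) x"
    if "k \<in> ?K" "k' \<in> ?K" "x \<in> edges (?C k)" "x \<in> edges (?C k')" for k k' x
    using sep_edges[OF sep that] root_h e by auto
  have fE: "emap f x = emap (?G k) x" "eiso f x = eiso (?G k) x" if "k \<in> ?K" "x \<in> edges (?C k)" for k x
  proof -
    show "emap f x = emap (?G k) x"
      using amalg_eq[where D = "\<lambda>k. edges (?C k)" and F = "\<lambda>k. emap (?G k)", OF that] overlap[OF that(1) _ that(2)]
      by (simp add: f_def)
    show "eiso f x = eiso (?G k) x"
      using amalg_eq[where D = "\<lambda>k. edges (?C k)" and F = "\<lambda>k. eiso (?G k)", OF that] overlap[OF that(1) _ that(2)]
      by (simp add: f_def)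
  qed
  have ext: "emap f \<in> extensional (edges T)" "mmap f \<in> extensional (marks T)"
      "nmap f \<in> extensional (nodes T)" "eiso f \<in> extensional (edges T)"
      "miso f \<in> extensional (marks T)" "niso f \<in> extensional (nodes T)"
    by (simp_all add: f_def asm_edges[OF A] asm_marks[OF A] asm_nodes[OF A] amalg_extensional)
  have EC: "\<exists>k\<in>?K. x \<in> edges (?C k)" if "x \<in> edges T" for x
    using that by (simp add: asm_edges[OF A])
  have MC: "\<exists>k\<in>?K. x \<in> marks (?C k)" if "x \<in> marks T" for x
    using that by (simp add: asm_marks[OF A])
  have NC: "\<exists>k\<in>?K. x \<in> nodes (?C k)" if "x \<in> nodes T" for x
    using that by (simp add: asm_nodes[OF A])
  have sub': "edges (?C' k) \<subseteq> edges T'" "marks (?C' k) \<subseteq> marks T'" "nodes (?C' k) \<subseteq> nodes T'" if "k \<in> indices S'" for k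
    using that by (auto simp: asm_edges[OF A'] asm_marks[OF A'] asm_nodes[OF A'])
  have fe: "ptree_embedding P T T' f"
  proof (rule ptree_embeddingI)
    fix x assume "x \<in> edges T"
    then obtain k where k: "k \<in> ?K" "x \<in> edges (?C k)" using EC by blast
    note a = asm_agree[OF A k(1)] and a' = asm_agree[OF A' \<kappa>[OF k(1)]]
    show "emap f x \<in> edges T'"
      using emap_in[OF Ge[OF k(1)] k(2)] sub'[OF \<kappa>[OF k(1)]] by (auto simp: fE[OF k])
    show "eiso f x \<in> Hom (gpdI P) (ecol T x) (ecol T' (emap f x))"
      using eiso_Hom[OF Ge[OF k(1)] k(2)]
      by (simp add: fE[OF k] agree_ecol[OF a k(2)] agree_ecol[OF a' emap_in[OF Ge[OF k(1)] k(2)]])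
  next
    fix m assume "m \<in> marks T"
    then obtain k where k: "k \<in> ?K" "m \<in> marks (?C k)" using MC by blast
    note a = asm_agree[OF A k(1)] and a' = asm_agree[OF A' \<kappa>[OF k(1)]]
    note Gk = Ge[OF k(1)] and m' = mmap_in[OF Ge[OF k(1)] k(2)]
    note s = smap_in[OF tC[OF k(1)] k(2)] and p = pmap_in[OF tC[OF k(1)] k(2)]
    note ag = agree_smap[OF a k(2)] agree_pmap[OF a k(2)] agree_mcol[OF a k(2)] agree_siso[OF a k(2)]
      agree_piso[OF a k(2)] agree_smap[OF a' m'] agree_pmap[OF a' m'] agree_mcol[OF a' m']
      agree_siso[OF a' m'] agree_piso[OF a' m']
    note ff = fm[OF k] fE[OF k(1) s] fn[OF k(1) p]
    show "mmap f m \<in> marks T'"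
      using m' sub'[OF \<kappa>[OF k(1)]] by (auto simp: ff)
    show "emap f (smap T m) = smap T' (mmap f m)" "nmap f (pmap T m) = pmap T' (mmap f m)"
      by (simp_all add: ag ff emap_smap[OF Gk k(2)] nmap_pmap[OF Gk k(2)])
    show "miso f m \<in> Hom (gpdE P) (mcol T m) (mcol T' (mmap f m))"
      using miso_Hom[OF Gk k(2)] by (simp add: ag ff)
    show "siso T' (mmap f m) \<cdot>\<^bsub>gpdI P\<^esub> eiso f (smap T m) = amap (funS P) (miso f m) \<cdot>\<^bsub>gpdI P\<^esub> siso T m"
      using siso_nat[OF Gk k(2)] by (simp add: ag ff)
    show "piso T' (mmap f m) \<cdot>\<^bsub>gpdB P\<^esub> amap (funP P) (miso f m) = niso f (pmap T m) \<cdot>\<^bsub>gpdB P\<^esub> piso T m"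
      using piso_nat[OF Gk k(2)] by (simp add: ag ff)
  next
    fix n assume "n \<in> nodes T"
    then obtain k where k: "k \<in> ?K" "n \<in> nodes (?C k)" using NC by blast
    note a = asm_agree[OF A k(1)] and a' = asm_agree[OF A' \<kappa>[OF k(1)]]
    note Gk = Ge[OF k(1)] and n' = nmap_in[OF Ge[OF k(1)] k(2)]
    note t = tmap_in[OF tC[OF k(1)] k(2)]
    note ag = agree_tmap[OF a k(2)] agree_ncol[OF a k(2)] agree_tiso[OF a k(2)]
      agree_tmap[OF a' n'] agree_ncol[OF a' n'] agree_tiso[OF a' n']
    note ff = fn[OF k] fE[OF k(1) t]
    show "nmap f n \<in> nodes T'"
      using n' sub'[OF \<kappa>[OF k(1)]] by (auto simp: ff)
    show "emap f (tmap T n) = tmap T' (nmap f n)"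
      by (simp add: ag ff emap_tmap[OF Gk k(2)])
    show "niso f n \<in> Hom (gpdB P) (ncol T n) (ncol T' (nmap f n))"
      using niso_Hom[OF Gk k(2)] by (simp add: ag ff)
    show "tiso T' (nmap f n) \<cdot>\<^bsub>gpdI P\<^esub> amap (funT P) (niso f n) = eiso f (tmap T n) \<cdot>\<^bsub>gpdI P\<^esub> tiso T n"
      using tiso_nat[OF Gk k(2)] by (simp add: ag ff)
    fix m' assume m': "m' \<in> marks T'" "nmap f n = pmap T' m'"
    \<comment> \<open>The mark over an image node stays in the corresponding piece of
      \<open>T'\<close>, so the lift is supplied by the isomorphism of that piece.\<close>
    then have "m' \<in> marks_over T' (nodes (?C' (?\<kappa> k)))"
      using n' by (simp add: marks_over_def ff)
    then have m'C: "m' \<in> marks (?C' (?\<kappa> k))"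
      by (simp add: marks_over_piece[OF A' \<kappa>[OF k(1)]])
    have ex: "\<exists>!m. m \<in> marks (?C k) \<and> pmap (?C k) m = n \<and> mmap (?G k) m = m'"
      by (rule mark_lift[OF Gk k(2) m'C]) (use m'(2) agree_pmap[OF a' m'C] in \<open>simp add: ff\<close>)
    have "m \<in> marks T \<and> pmap T m = n \<and> mmap f m = m' \<longleftrightarrow>
        m \<in> marks (?C k) \<and> pmap (?C k) m = n \<and> mmap (?G k) m = m'" for m
    proof -
      have "m \<in> marks T \<and> pmap T m \<in> nodes (?C k) \<longleftrightarrow> m \<in> marks (?C k)"
        using marks_over_piece[OF A k(1)] by (auto simp: marks_over_def)
      then show ?thesis
        using k(2) agree_pmap[OF a, of m] fm(1)[OF k(1), of m] by auto
    qed
    then show "\<exists>!m. m \<in> marks T \<and> pmap T m = n \<and> mmap f m = m'"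
      using ex by simp
  qed (rule ext)+
  have "emap f (root T) = root T'"
    using fE(1)[OF None_indices, of "root S"] root_in[OF ptree_tree[OF S(1)]] iso_root[OF S g]
    by (simp add: asm_root[OF A] asm_root[OF A'])
  \<comment> \<open>Injectivity across different pieces needs no case distinction: \<open>f\<close>
    is a root-preserving embedding, and these are injective.\<close>
  then have rp: "(T, f) \<in> rp_embeddings P T'"
    using T fe by (simp add: rp_embeddings_def)
  note inj = rp_embedding_image(4-6)[OF T' rp]
  have surj: "edges T' \<subseteq> emap f ` edges T" "marks T' \<subseteq> mmap f ` marks T" "nodes T' \<subseteq> nmap f ` nodes T"
  proof safe
    fix x assume "x \<in> edges T'"
    then obtain k where k: "k \<in> ?K" "x \<in> edges (?C' (?\<kappa> k))"
      using \<kappa>_surj by (auto simp: asm_edges[OF A'])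
    then have "x \<in> emap (?G k) ` edges (?C k)"
      using bij_emap[OF G[OF k(1)]] by (simp add: bij_betw_def)
    then obtain y where y: "x = emap (?G k) y" "y \<in> edges (?C k)" ..
    then have "x = emap f y" "y \<in> edges T"
      using k(1) fE(1)[OF k(1) y(2)] by (auto simp: asm_edges[OF A])
    then show "x \<in> emap f ` edges T" by blast
  next
    fix x assume "x \<in> marks T'"
    then obtain k where k: "k \<in> ?K" "x \<in> marks (?C' (?\<kappa> k))"
      using \<kappa>_surj by (auto simp: asm_marks[OF A'])
    then have "x \<in> mmap (?G k) ` marks (?C k)"
      using bij_mmap[OF G[OF k(1)]] by (simp add: bij_betw_def)
    then obtain y where y: "x = mmap (?G k) y" "y \<in> marks (?C k)" ..
    then have "x = mmap f y" "y \<in> marks T"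
      using k(1) fm(1)[OF k(1) y(2)] by (auto simp: asm_marks[OF A])
    then show "x \<in> mmap f ` marks T" by blast
  next
    fix x assume "x \<in> nodes T'"
    then obtain k where k: "k \<in> ?K" "x \<in> nodes (?C' (?\<kappa> k))"
      using \<kappa>_surj by (auto simp: asm_nodes[OF A'])
    then have "x \<in> nmap (?G k) ` nodes (?C k)"
      using bij_nmap[OF G[OF k(1)]] by (simp add: bij_betw_def)
    then obtain y where y: "x = nmap (?G k) y" "y \<in> nodes (?C k)" ..
    then have "x = nmap f y" "y \<in> nodes T"
      using k(1) fn(1)[OF k(1) y(2)] by (auto simp: asm_nodes[OF A])
    then show "x \<in> nmap f ` nodes T" by blast
  qed
  have "emap f ` edges T \<subseteq> edges T'" "mmap f ` marks T \<subseteq> marks T'" "nmap f ` nodes T \<subseteq> nodes T'"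
    using emap_in[OF fe] mmap_in[OF fe] nmap_in[OF fe] by auto
  with surj inj fe have "ptree_iso P T T' f"
    by (simp add: ptree_iso_def bij_betw_def)
  moreover have "restrict_ptree_map (?C k) f = ?G k" if "k \<in> ?K" for k
    by (rule restrict_ptree_map_eqI[OF Ge[OF that]]) (simp_all add: fE[OF that] fm[OF that] fn[OF that])
  from this[OF None_indices] this[of "Some _"]
  have "restrict_ptree_map S f = g" "\<forall>l\<in>leaves S. restrict_ptree_map (Q l) f = h l"
    by simp_all
  ultimately show ?thesis by blast
qed

text \<open>The pieces cover \<open>T\<close>, so the restrictions determine the map. This is the
  faithfulness of the first comparison functor.\<close>

lemma assembled_iso_unique:
  fixes f f' :: "('u, 'ia, 'ea, 'ba) ptree_map"
  assumes A: "assembled P T S Q" and f: "ptree_embedding P T T' f" and f': "ptree_embedding P T T' f'"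
    and S: "restrict_ptree_map S f = restrict_ptree_map S f'"
    and Q: "\<And>l. l \<in> leaves S \<Longrightarrow> restrict_ptree_map (Q l) f = restrict_ptree_map (Q l) f'"
  shows "f = f'"
proof -
  have r: "restrict_ptree_map (piece S Q k) f = restrict_ptree_map (piece S Q k) f'" if "k \<in> indices S" for k
    using that S Q by (cases k) auto
  have e: "restrict (emap f) (edges (piece S Q k)) = restrict (emap f') (edges (piece S Q k))"
      "restrict (eiso f) (edges (piece S Q k)) = restrict (eiso f') (edges (piece S Q k))"
      "restrict (mmap f) (marks (piece S Q k)) = restrict (mmap f') (marks (piece S Q k))"
      "restrict (miso f) (marks (piece S Q k)) = restrict (miso f') (marks (piece S Q k))"
      "restrict (nmap f) (nodes (piece S Q k)) = restrict (nmap f') (nodes (piece S Q k))"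
      "restrict (niso f) (nodes (piece S Q k)) = restrict (niso f') (nodes (piece S Q k))"
    if "k \<in> indices S" for k
    using r[OF that] by (simp_all add: restrict_ptree_map_def)
  show ?thesis
  proof (rule ptree_map_eqI[OF f f'])
    fix x assume "x \<in> edges T"
    then obtain k where "k \<in> indices S" "x \<in> edges (piece S Q k)" by (auto simp: asm_edges[OF A])
    then show "emap f x = emap f' x" "eiso f x = eiso f' x"
      using e(1,2)[THEN fun_cong, of k x] by simp_all
  next
    fix x assume "x \<in> marks T"
    then obtain k where "k \<in> indices S" "x \<in> marks (piece S Q k)" by (auto simp: asm_marks[OF A])
    then show "mmap f x = mmap f' x" "miso f x = miso f' x"
      using e(3,4)[THEN fun_cong, of k x] by simp_all
  next
    fix x assume "x \<in> nodes T"
    then obtain k where "k \<in> indices S" "x \<in> nodes (piece S Q k)" by (auto simp: asm_nodes[OF A])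
    then show "nmap f x = nmap f' x" "niso f x = niso f' x"
      using e(5,6)[THEN fun_cong, of k x] by simp_all
  qed
qed

text \<open>Transport of structure along the renamings and along the arrows \<open>u\<close> between
  old and new edge colours. Marks and nodes keep their colours and \<open>piso\<close> is kept, so
  the pullback condition is untouched; only \<open>siso\<close> and \<open>tiso\<close>, which
  involve edge colours, are composed with \<open>u\<close> or its inverse.\<close>

lemma transport_ex:
  fixes S :: "('u, 'i, 'ia, 'e, 'b, 'ba) ptree"
  assumes S: "is_ptree P S" and inj: "inj_on jE (edges S)" "inj_on jM (marks S)" "inj_on jN (nodes S)"
    and u: "\<And>x. x \<in> edges S \<Longrightarrow> u x \<in> Hom (gpdI P) (ecol S x) (col x)"
  obtains S' :: "('u, 'i, 'ia, 'e, 'b, 'ba) ptree" and f :: "('u, 'ia, 'ea, 'ba) ptree_map"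
  where "is_ptree P S'" "ptree_iso P S S' f" "\<And>x. x \<in> edges S \<Longrightarrow> emap f x = jE x"
    "\<And>x. x \<in> edges S \<Longrightarrow> eiso f x = u x" "\<And>x. x \<in> edges S \<Longrightarrow> ecol S' (jE x) = col x"
    "edges S' = jE ` edges S" "marks S' = jM ` marks S" "nodes S' = jN ` nodes S"
proof -
  note tS = ptree_tree[OF S]
  define iE where "iE = the_inv_into (edges S) jE"
  define iM where "iM = the_inv_into (marks S) jM"
  define iN where "iN = the_inv_into (nodes S) jN"
  have i [simp]: "x \<in> edges S \<Longrightarrow> iE (jE x) = x" "m \<in> marks S \<Longrightarrow> iM (jM m) = m" "n \<in> nodes S \<Longrightarrow> iN (jN n) = n" for x m n
    using inj by (auto simp: iE_def iM_def iN_def the_inv_into_f_f)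
  define S' :: "('u, 'i, 'ia, 'e, 'b, 'ba) ptree" where
    "S' = \<lparr>edges = jE ` edges S, marks = jM ` marks S, nodes = jN ` nodes S,
      smap = (\<lambda>m\<in>jM ` marks S. jE (smap S (iM m))), pmap = (\<lambda>m\<in>jM ` marks S. jN (pmap S (iM m))),
      tmap = (\<lambda>n\<in>jN ` nodes S. jE (tmap S (iN n))),
      ecol = (\<lambda>x\<in>jE ` edges S. col (iE x)), mcol = (\<lambda>m\<in>jM ` marks S. mcol S (iM m)),
      ncol = (\<lambda>n\<in>jN ` nodes S. ncol S (iN n)),
      siso = (\<lambda>m\<in>jM ` marks S. siso S (iM m) \<cdot>\<^bsub>gpdI P\<^esub> ginv (gpdI P) (u (smap S (iM m)))),
      piso = (\<lambda>m\<in>jM ` marks S. piso S (iM m)),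
      tiso = (\<lambda>n\<in>jN ` nodes S. u (tmap S (iN n)) \<cdot>\<^bsub>gpdI P\<^esub> tiso S (iN n))\<rparr>"
  have sets: "edges S' = jE ` edges S" "marks S' = jM ` marks S" "nodes S' = jN ` nodes S"
    by (simp_all add: S'_def)
  have at: "ecol S' (jE x) = col x" if "x \<in> edges S" for x
    using that by (simp add: S'_def)
  have am: "smap S' (jM m) = jE (smap S m)" "pmap S' (jM m) = jN (pmap S m)" "mcol S' (jM m) = mcol S m"
    "siso S' (jM m) = siso S m \<cdot>\<^bsub>gpdI P\<^esub> ginv (gpdI P) (u (smap S m))" "piso S' (jM m) = piso S m" if "m \<in> marks S" for m
    using that by (simp_all add: S'_def)
  have an: "tmap S' (jN n) = jE (tmap S n)" "ncol S' (jN n) = ncol S n"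
    "tiso S' (jN n) = u (tmap S n) \<cdot>\<^bsub>gpdI P\<^esub> tiso S n" if "n \<in> nodes S" for n
    using that by (simp_all add: S'_def)
  have ext: "smap S' \<in> extensional (marks S')" "pmap S' \<in> extensional (marks S')"
      "tmap S' \<in> extensional (nodes S')" "ecol S' \<in> extensional (edges S')" "mcol S' \<in> extensional (marks S')"
      "ncol S' \<in> extensional (nodes S')" "siso S' \<in> extensional (marks S')"
      "piso S' \<in> extensional (marks S')" "tiso S' \<in> extensional (nodes S')"
    by (simp_all add: S'_def)
  obtain d where d: "\<And>m. m \<in> marks S \<Longrightarrow> (d (tmap S (pmap S m)) :: nat) < d (smap S m)"
    using tree_height[OF tS] by blast
  note in' = smap_in[OF tS] pmap_in[OF tS] tmap_in[OF tS]
  have fin: "finite (edges S')" "finite (marks S')" "finite (nodes S')"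
    using tS by (auto simp: sets is_tree_def)
  have maps: "smap S' \<in> marks S' \<rightarrow>\<^sub>E edges S'" "pmap S' \<in> marks S' \<rightarrow>\<^sub>E nodes S'" "tmap S' \<in> nodes S' \<rightarrow>\<^sub>E edges S'"
    using ext by (auto simp: PiE_iff sets am an in')
  have injE: "jE x = jE y \<longleftrightarrow> x = y" if "x \<in> edges S" "y \<in> edges S" for x y
    using inj_on_eq_iff[OF inj(1)] that by blast
  have inj_t: "inj_on (tmap S') (nodes S')"
    using inj_onD[OF inj_tmap[OF tS]] by (auto simp: inj_on_def sets an injE in')
  have inj_s: "inj_on (smap S') (marks S')"
    using inj_onD[OF inj_smap[OF tS]] by (auto simp: inj_on_def sets am injE in')
  have "smap S' ` marks S' = jE ` smap S ` marks S"
    unfolding sets image_image by (rule image_cong[OF refl am(1)])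
  moreover have "jE ` (edges S - smap S ` marks S) = jE ` edges S - jE ` smap S ` marks S"
    using in' by (intro inj_on_image_set_diff[OF inj(1)]) auto
  ultimately have compl: "edges S' - smap S' ` marks S' = {jE (root S)}"
    by (simp add: sets root_complement[OF tS])
  have d': "d (iE (tmap S' (pmap S' m))) < d (iE (smap S' m))" if "m \<in> marks S'" for m
    using that d by (auto simp: sets am an in')
  have tree: "is_tree S'"
    by (rule is_treeI(1)[OF fin maps inj_t inj_s compl, of "d \<circ> iE"]) (simp add: d')
  have pb: "local_pullback P S' n" if n: "n \<in> nodes S'" for n
  proof -
    obtain k where k: "k \<in> nodes S" "n = jN k" using n by (auto simp: sets)
    have injN: "jN x = jN y \<longleftrightarrow> x = y" if "x \<in> nodes S" "y \<in> nodes S" for x y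
      using inj_on_eq_iff[OF inj(3)] that by blast
    show ?thesis
    proof (rule local_pullback_cong[where h = jM and T = S and n = k])
      show "ncol S k = ncol S' n" using k by (simp add: an)
      show "local_pullback P S k" by (rule ptree_pullback[OF S k(1)])
      show "jM m \<in> marks S' \<and> pmap S' (jM m) = n \<and> mcol S' (jM m) = mcol S m \<and> piso S' (jM m) = piso S m"
        if "m \<in> marks S" "pmap S m = k" for m
        using that k by (simp add: sets am)
      fix m' assume m': "m' \<in> marks S'" "pmap S' m' = n"
      then obtain m where m: "m \<in> marks S" "m' = jM m" by (auto simp: sets)
      then have "pmap S m = k"
        using m'(2) k injN in' by (simp add: am)
      then show "\<exists>!m. m \<in> marks S \<and> pmap S m = k \<and> jM m = m'"
        using m inj_onD[OF inj(2)] by blast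
    qed
  qed
  have col: "col x \<in> Obj (gpdI P)" if "x \<in> edges S" for x
    using u[OF that] s.Y.Hom_Obj by blast
  have siso': "siso S m \<cdot>\<^bsub>gpdI P\<^esub> ginv (gpdI P) (u (smap S m)) \<in> Hom (gpdI P) (col (smap S m)) (omap (funS P) (mcol S m))"
    if "m \<in> marks S" for m
    by (rule s.Y.comp_Hom[OF s.Y.ginv_Hom[OF u[OF in'(1)[OF that]]] siso_Hom[OF S that]])
  have tiso': "u (tmap S n) \<cdot>\<^bsub>gpdI P\<^esub> tiso S n \<in> Hom (gpdI P) (omap (funT P) (ncol S n)) (col (tmap S n))"
    if "n \<in> nodes S" for n
    by (rule s.Y.comp_Hom[OF tiso_Hom[OF S that] u[OF in'(3)[OF that]]])
  have S': "is_ptree P S'"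
    unfolding is_ptree_iff using tree ext pb siso' tiso' col
    by (auto simp: PiE_iff sets at am an in' mcol_Obj[OF S] ncol_Obj[OF S] piso_Hom[OF S])
  define f :: "('u, 'ia, 'ea, 'ba) ptree_map" where
    "f = \<lparr>emap = restrict jE (edges S), mmap = restrict jM (marks S), nmap = restrict jN (nodes S),
      eiso = restrict u (edges S), miso = (\<lambda>m\<in>marks S. Ident (gpdE P) (mcol S m)),
      niso = (\<lambda>n\<in>nodes S. Ident (gpdB P) (ncol S n))\<rparr>"
  have f: "emap f = restrict jE (edges S)" "mmap f = restrict jM (marks S)" "nmap f = restrict jN (nodes S)"
      "eiso f = restrict u (edges S)" "miso f = (\<lambda>m\<in>marks S. Ident (gpdE P) (mcol S m))"
      "niso f = (\<lambda>n\<in>nodes S. Ident (gpdB P) (ncol S n))"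
    by (simp_all add: f_def)
  have "ptree_iso P S S' f"
  proof (rule ptree_isoI[OF S S'])
    fix m assume m: "m \<in> marks S"
    show "siso S' (mmap f m) \<cdot>\<^bsub>gpdI P\<^esub> eiso f (smap S m) = amap (funS P) (miso f m) \<cdot>\<^bsub>gpdI P\<^esub> siso S m"
      using m mcol_Obj[OF S m] s.Y.ginv_cancel_right'[OF u[OF in'(1)[OF m]] siso_Hom[OF S m]]
        s.Y.Ident_left[OF siso_Hom[OF S m]]
      by (simp add: f am in' s.amap_Ident)
    show "piso S' (mmap f m) \<cdot>\<^bsub>gpdB P\<^esub> amap (funP P) (miso f m) = niso f (pmap S m) \<cdot>\<^bsub>gpdB P\<^esub> piso S m"
      using m mcol_Obj[OF S m] p.Y.Ident_left[OF piso_Hom[OF S m]] p.Y.Ident_right[OF piso_Hom[OF S m]]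
      by (simp add: f am in' p.amap_Ident)
  next
    fix n assume n: "n \<in> nodes S"
    show "tiso S' (nmap f n) \<cdot>\<^bsub>gpdI P\<^esub> amap (funT P) (niso f n) = eiso f (tmap S n) \<cdot>\<^bsub>gpdI P\<^esub> tiso S n"
      using n ncol_Obj[OF S n] s.Y.Ident_right[OF tiso'[OF n]]
      by (simp add: f an in' t.amap_Ident)
  qed (auto simp: f sets at am an in' u bij_betw_def inj s.X.Ident_Hom p.Y.Ident_Hom mcol_Obj[OF S] ncol_Obj[OF S])
  with S' show thesis
    using that[of S' f] at sets by (simp add: f)
qed

end

section \<open>Disjoint copies in an infinite type\<close>

lemma ex_inj_on:
  assumes "finite D"
  shows "\<exists>J :: 'a \<Rightarrow> 'u::infinite. inj_on J D"
proof -
  obtain B :: "'u set" where B: "finite B" "card B = card D"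
    using infinite_arbitrarily_large[OF infinite_UNIV] by blast
  then obtain J where "bij_betw J D B"
    using finite_same_card_bij[OF assms B(1)] by metis
  then show ?thesis
    by (auto simp: bij_betw_def)
qed

context polynomial
begin

text \<open>This is where an infinite supply of edges, marks and nodes is needed. The isomorphisms \<open>\<beta>\<close> of root
  colours with leaf colours are absorbed into the copies, so that these can be glued literally.\<close>

lemma separated_copy:
  fixes S :: "('u::infinite, 'i, 'ia, 'e, 'b, 'ba) ptree" and Q :: "'u \<Rightarrow> ('u, 'i, 'ia, 'e, 'b, 'ba) ptree"
  assumes S: "is_ptree P S" and X: "finite X" and Q: "\<And>x. x \<in> X \<Longrightarrow> is_ptree P (Q x)"
    and b: "bij_betw b X (leaves S)"
    and \<beta>: "\<And>x. x \<in> X \<Longrightarrow> \<beta> x \<in> Hom (gpdI P) (ecol (Q x) (root (Q x))) (ecol S (b x))"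
  obtains S' :: "('u, 'i, 'ia, 'e, 'b, 'ba) ptree" and Q' :: "'u \<Rightarrow> ('u, 'i, 'ia, 'e, 'b, 'ba) ptree"
    and i :: "('u, 'ia, 'ea, 'ba) ptree_map" and a :: "'u \<Rightarrow> ('u, 'ia, 'ea, 'ba) ptree_map"
  where "separated P S' Q'" "Q' \<in> extensional (leaves S')" "ptree_iso P S S' i"
    "\<And>x. x \<in> X \<Longrightarrow> ptree_iso P (Q x) (Q' (emap i (b x))) (a x)"
    "\<And>x. x \<in> X \<Longrightarrow> eiso (a x) (root (Q x)) = eiso i (b x) \<cdot>\<^bsub>gpdI P\<^esub> \<beta> x"
proof -
  let ?all = "\<lambda>U :: ('u, 'i, 'ia, 'e, 'b, 'ba) ptree. edges U \<union> marks U \<union> nodes U"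
  have fin_all: "finite (?all U)" if "is_ptree P U" for U :: "('u, 'i, 'ia, 'e, 'b, 'ba) ptree"
    using ptree_tree[OF that] by (simp add: is_tree_def)
  \<comment> \<open>The first component tags the origin of an element, \<open>None\<close> for
    \<open>S\<close> and \<open>Some x\<close> for \<open>Q x\<close>. An injection on tagged
    elements gives names that are disjoint across the trees, and one injection serves edges, marks
    and nodes alike.\<close>
  define D where "D = insert None (Some ` X) \<times> (?all S \<union> (\<Union>x\<in>X. ?all (Q x)))"
  have "finite D"
    using X fin_all S Q by (simp add: D_def)
  then obtain J :: "'u option \<times> 'u \<Rightarrow> 'u" where J: "inj_on J D"
    using ex_inj_on by metis
  have DS: "(None, y) \<in> D" if "y \<in> ?all S" for y
    using that by (simp add: D_def)
  have DQ: "(Some x, y) \<in> D" if "x \<in> X" "y \<in> ?all (Q x)" for x y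
    unfolding D_def using that by blast
  have JS: "J (None, y) = J (None, z) \<longleftrightarrow> y = z" if "y \<in> ?all S" "z \<in> ?all S" for y z
    using inj_on_eq_iff[OF J DS[OF that(1)] DS[OF that(2)]] by simp
  have JQ: "J (Some x, y) = J (Some x', z) \<longleftrightarrow> x = x' \<and> y = z"
    if "x \<in> X" "x' \<in> X" "y \<in> ?all (Q x)" "z \<in> ?all (Q x')" for x x' y z
    using inj_on_eq_iff[OF J DQ[OF that(1,3)] DQ[OF that(2,4)]] by simp
  have JSQ: "J (None, y) \<noteq> J (Some x, z)" if "x \<in> X" "y \<in> ?all S" "z \<in> ?all (Q x)" for x y z
    using inj_on_eq_iff[OF J DS[OF that(2)] DQ[OF that(1,3)]] by simp
  have bS: "b x \<in> leaves S" "b x \<in> edges S" if "x \<in> X" for x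
    using bij_betwE[OF b] that leaves_subset[of "b x" S] by auto
  have injb: "b x = b y \<longleftrightarrow> x = y" if "x \<in> X" "y \<in> X" for x y
    using inj_on_eq_iff[OF bij_betw_imp_inj_on[OF b]] that by blast
  \<comment> \<open>The root of the copy of \<open>Q x\<close> receives the name of the copied leaf
    \<open>b x\<close> instead of its own, so that the two copies meet exactly in this edge.\<close>
  define jE where "jE x e = (if e = root (Q x) then J (None, b x) else J (Some x, e))" for x e
  have rQ: "root (Q x) \<in> edges (Q x)" if "x \<in> X" for x
    by (intro root_in ptree_tree Q that)
  have jE_inj: "inj_on (jE x) (edges (Q x))" if x: "x \<in> X" for x
    using JSQ[OF x] JSQ[OF x, THEN not_sym] JQ[OF x x] bS(2)[OF x] by (auto simp: inj_on_def jE_def)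
  let ?I = "gpdI P"
  obtain S' :: "('u, 'i, 'ia, 'e, 'b, 'ba) ptree" and i :: "('u, 'ia, 'ea, 'ba) ptree_map" where
    S': "is_ptree P S'" "ptree_iso P S S' i" "\<And>x. x \<in> edges S \<Longrightarrow> emap i x = J (None, x)"
      "\<And>x. x \<in> edges S \<Longrightarrow> eiso i x = Ident ?I (ecol S x)" "\<And>x. x \<in> edges S \<Longrightarrow> ecol S' (J (None, x)) = ecol S x"
      "edges S' = (\<lambda>x. J (None, x)) ` edges S" "marks S' = (\<lambda>x. J (None, x)) ` marks S" "nodes S' = (\<lambda>x. J (None, x)) ` nodes S"
    by (rule transport_ex[OF S, of "\<lambda>x. J (None, x)" "\<lambda>x. J (None, x)" "\<lambda>x. J (None, x)" "\<lambda>x. Ident ?I (ecol S x)" "ecol S"])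
      (auto simp: inj_on_def JS ecol_Obj[OF S] intro!: s.Y.Ident_Hom)
  \<comment> \<open>Each copy is paired with its isomorphism, so that both can be chosen for all
    \<open>x\<close> at once.\<close>
  define copy where "copy x q \<longleftrightarrow> is_ptree P (fst q) \<and> ptree_iso P (Q x) (fst q) (snd q) \<and>
      emap (snd q) (root (Q x)) = J (None, b x) \<and> eiso (snd q) (root (Q x)) = \<beta> x \<and>
      ecol (fst q) (J (None, b x)) = ecol S (b x) \<and> edges (fst q) = jE x ` edges (Q x) \<and>
      marks (fst q) = (\<lambda>m. J (Some x, m)) ` marks (Q x) \<and> nodes (fst q) = (\<lambda>n. J (Some x, n)) ` nodes (Q x)"
    for x and q :: "('u, 'i, 'ia, 'e, 'b, 'ba) ptree \<times> ('u, 'ia, 'ea, 'ba) ptree_map"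
  have "\<exists>q. copy x q" if x: "x \<in> X" for x
  proof -
    \<comment> \<open>Only the root changes its colour: \<open>\<beta> x\<close> replaces its colour
      by that of the leaf, which makes the colours at the gluing edge equal.\<close>
    let ?u = "\<lambda>e. if e = root (Q x) then \<beta> x else Ident ?I (ecol (Q x) e)"
    let ?col = "\<lambda>e. if e = root (Q x) then ecol S (b x) else ecol (Q x) e"
    have u: "?u e \<in> Hom ?I (ecol (Q x) e) (?col e)" if "e \<in> edges (Q x)" for e
      using \<beta>[OF x] s.Y.Ident_Hom[OF ecol_Obj[OF Q[OF x] that]] by simp
    have inj: "inj_on (\<lambda>m. J (Some x, m)) (marks (Q x))" "inj_on (\<lambda>m. J (Some x, m)) (nodes (Q x))"
      using JQ[OF x x] by (auto simp: inj_on_def)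
    obtain q :: "('u, 'i, 'ia, 'e, 'b, 'ba) ptree" and k :: "('u, 'ia, 'ea, 'ba) ptree_map" where
      q: "is_ptree P q" "ptree_iso P (Q x) q k" "\<And>e. e \<in> edges (Q x) \<Longrightarrow> emap k e = jE x e"
        "\<And>e. e \<in> edges (Q x) \<Longrightarrow> eiso k e = ?u e" "\<And>e. e \<in> edges (Q x) \<Longrightarrow> ecol q (jE x e) = ?col e"
        "edges q = jE x ` edges (Q x)" "marks q = (\<lambda>m. J (Some x, m)) ` marks (Q x)"
        "nodes q = (\<lambda>n. J (Some x, n)) ` nodes (Q x)"
      by (rule transport_ex[OF Q[OF x] jE_inj[OF x] inj, of ?u ?col, OF u]) blast+
    then have "copy x (q, k)"
      using q(3,4,5)[OF rQ[OF x]] by (simp add: copy_def jE_def)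
    then show ?thesis ..
  qed
  then obtain c where c: "\<And>x. x \<in> X \<Longrightarrow> copy x (c x)" by metis
  note c' = c[unfolded copy_def]
  define Q' where "Q' = (\<lambda>l\<in>leaves S'. fst (c (the_inv_into X (\<lambda>x. J (None, b x)) l)))"
  have lS': "leaves S' = (\<lambda>x. J (None, b x)) ` X"
  proof -
    have "leaves S' = emap i ` b ` X"
      using iso_leaves[OF S S'(2)] b by (simp add: bij_betw_def)
    also have "\<dots> = (\<lambda>x. J (None, b x)) ` X"
      unfolding image_image by (rule image_cong[OF refl]) (simp add: S'(3) bS)
    finally show ?thesis .
  qed
  have injk: "inj_on (\<lambda>x. J (None, b x)) X"
    using JS bS(2) injb by (auto simp: inj_on_def)
  have Q'x: "Q' (J (None, b x)) = fst (c x)" if "x \<in> X" for x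
    using that the_inv_into_f_f[OF injk that] by (simp add: Q'_def lS')
  have edge_Q: "e = J (None, b x) \<or> (\<exists>e'\<in>edges (Q x). e = J (Some x, e'))" if "x \<in> X" "e \<in> edges (fst (c x))" for x e
    using c'[OF that(1)] that(2) by (auto simp: jE_def)
  have sep: "separated P S' Q'"
  proof (rule separatedI)
    fix l assume "l \<in> leaves S'"
    then obtain x where x: "x \<in> X" "l = J (None, b x)" by (auto simp: lS')
    note cx = c'[OF x(1)]
    show "is_ptree P (Q' l)" using cx x by (simp add: Q'x)
    show "root (Q' l) = l"
    proof -
      have "emap (snd (c x)) (root (Q x)) = root (fst (c x))"
        using cx by (intro iso_root[OF Q[OF x(1)]]) simp_all
      then have "root (fst (c x)) = J (None, b x)"
        using cx by simp
      then show ?thesis using x by (simp add: Q'x)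
    qed
    show "ecol (Q' l) l = ecol S' l"
      using cx x S'(5) bS by (simp add: Q'x)
    show "nodes S' \<inter> nodes (Q' l) = {}" "marks S' \<inter> marks (Q' l) = {}"
      using cx x JSQ[OF x(1)] by (auto simp: Q'x S'(7,8))
    show "edges S' \<inter> edges (Q' l) \<subseteq> {l}"
    proof
      fix e assume "e \<in> edges S' \<inter> edges (Q' l)"
      then have e: "e \<in> edges S'" "e \<in> edges (fst (c x))"
        using x by (simp_all add: Q'x)
      then obtain y where "y \<in> edges S" "e = J (None, y)" by (auto simp: S'(6))
      then show "e \<in> {l}"
        using edge_Q[OF x(1) e(2)] JSQ[OF x(1), of y] x(2) by auto
    qed
    fix l' assume "l' \<in> leaves S'" and ll: "l \<noteq> l'"
    then obtain x' where x': "x' \<in> X" "l' = J (None, b x')" by (auto simp: lS')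
    then have xx: "x \<noteq> x'" using ll x by auto
    note cx' = c'[OF x'(1)]
    show "nodes (Q' l) \<inter> nodes (Q' l') = {}" "marks (Q' l) \<inter> marks (Q' l') = {}"
      using cx cx' x x' JQ[OF x(1) x'(1)] xx by (auto simp: Q'x)
    show "edges (Q' l) \<inter> edges (Q' l') = {}"
    proof (rule equals0I)
      fix e assume "e \<in> edges (Q' l) \<inter> edges (Q' l')"
      then have e: "e \<in> edges (fst (c x))" "e \<in> edges (fst (c x'))"
        using x x' by (simp_all add: Q'x)
      from edge_Q[OF x(1) e(1)] edge_Q[OF x'(1) e(2)] show False
      proof (elim disjE bexE)
        assume "e = J (None, b x)" "e = J (None, b x')"
        then show False using ll x x' by simp
      next
        fix z assume "e = J (None, b x)" "z \<in> edges (Q x')" "e = J (Some x', z)"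
        then show False using JSQ[OF x'(1), of "b x" z] bS(2)[OF x(1)] by simp
      next
        fix y assume "y \<in> edges (Q x)" "e = J (Some x, y)" "e = J (None, b x')"
        then show False using JSQ[OF x(1), of "b x'" y] bS(2)[OF x'(1)] by simp
      next
        fix y z assume "y \<in> edges (Q x)" "e = J (Some x, y)" "z \<in> edges (Q x')" "e = J (Some x', z)"
        then show False using JQ[OF x(1) x'(1), of y z] xx by simp
      qed
    qed
  qed (rule S'(1))
  show thesis
  proof (rule that[of S' Q' i "\<lambda>x. snd (c x)"])
    show "separated P S' Q'" "ptree_iso P S S' i" by fact+
    show "Q' \<in> extensional (leaves S')" by (simp add: Q'_def)
    fix x assume x: "x \<in> X"
    show "ptree_iso P (Q x) (Q' (emap i (b x))) (snd (c x))"
      using c'[OF x] x by (simp add: S'(3) bS Q'x)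
    show "eiso (snd (c x)) (root (Q x)) = eiso i (b x) \<cdot>\<^bsub>gpdI P\<^esub> \<beta> x"
      using c'[OF x] x by (simp add: S'(4) bS s.Y.Ident_left[OF \<beta>])
  qed
qed

section \<open>The homotopy sum of the cuts and its structure map\<close>

abbreviation cutsum where "cutsum \<equiv> hsum (ptrees P) (cut_family P)"

lemma Obj_cutsum: "(T, C) \<in> Obj cutsum \<longleftrightarrow> is_ptree P T \<and> (\<exists>N. closed_nodes T N \<and> C = cut_of T N)"
  by (auto simp: hsum_def hom_gpd_simps fam_cut_family disc_gpd_def ptrees_simps cuts_eq)

text \<open>The fibres are discrete, so an arrow over \<open>f\<close> is just the equation that
  \<open>f\<close> carries the first cut to the second. By \<open>push_cut_of\<close> and
  \<open>inj_on_cut_of\<close> this is an equation of node sets.\<close>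

lemma Hom_cutsum:
  fixes T T' :: "('c, 'i, 'ia, 'e, 'b, 'ba) ptree"
  assumes "(T, cut_of T N) \<in> Obj cutsum" "(T', cut_of T' N') \<in> Obj cutsum" "closed_nodes T N" "closed_nodes T' N'"
  shows "d \<in> Hom cutsum (T, cut_of T N) (T', cut_of T' N') \<longleftrightarrow>
    (\<exists>f. d = ((T, cut_of T N), (T', cut_of T' N'), ((T, T', f), cut_of T' N')) \<and> ptree_iso P T T' f \<and> nmap f ` N = N')"
proof -
  have T: "is_ptree P T" "is_ptree P T'" using assms by (auto simp: Obj_cutsum)
  have eq: "cut_of T' (nmap f ` N) = cut_of T' N' \<longleftrightarrow> nmap f ` N = N'" if "ptree_iso P T T' f"
    for f :: "('c, 'ia, 'ea, 'ba) ptree_map"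
    using inj_on_eq_iff[OF inj_on_cut_of[OF T(2)]] iso_closed_nodes(1)[OF T that assms(3)] assms(4) by blast
  have o: "Obj (disc_gpd X) = X" for X :: "'z set" by (simp add: disc_gpd_def)
  have "cut_of T N \<in> cuts P T" "cut_of T' N' \<in> cuts P T'"
    using assms(3,4) by (auto simp: cuts_eq T)
  then have "d \<in> Hom cutsum (T, cut_of T N) (T', cut_of T' N') \<longleftrightarrow>
    (\<exists>f. d = ((T, cut_of T N), (T', cut_of T' N'), ((T, T', f), cut_of T' N')) \<and> ptree_iso P T T' f \<and>
      (\<lambda>(U, c). (U, ptree_comp P U f c)) ` cut_of T N = cut_of T' N')"
    using T by (auto simp: hsum_def Hom_hom_gpd fam_cut_family Hom_disc Hom_ptrees tra_cut_family o
        ptrees_simps image_iff simp del: image_eqI)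
  also have "\<dots> \<longleftrightarrow> (\<exists>f. d = ((T, cut_of T N), (T', cut_of T' N'), ((T, T', f), cut_of T' N')) \<and> ptree_iso P T T' f \<and>
      cut_of T' (nmap f ` N) = cut_of T' N')"
    using push_cut_of[OF T _ assms(3)] by auto
  finally have "d \<in> Hom cutsum (T, cut_of T N) (T', cut_of T' N') \<longleftrightarrow>
    (\<exists>f. d = ((T, cut_of T N), (T', cut_of T' N'), ((T, T', f), cut_of T' N')) \<and> ptree_iso P T T' f \<and>
      cut_of T' (nmap f ` N) = cut_of T' N')" .
  then show ?thesis
    using eq by auto
qed

lemma groupoid_cutsum: "groupoid cutsum"
  by (rule groupoid_hsum[OF is_family_cut])

lemma Obj_cutsumE:
  assumes "u \<in> Obj cutsum"
  obtains T N where "u = (T, cut_of T N)" "is_ptree P T" "closed_nodes T N"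
  using assms by (cases u) (auto simp: Obj_cutsum)

lemma Hom_cutsumE:
  assumes d: "d \<in> Hom cutsum u v"
  obtains T N T' N' f where "u = (T, cut_of T N)" "is_ptree P T" "closed_nodes T N"
    "v = (T', cut_of T' N')" "is_ptree P T'" "closed_nodes T' N'"
    "d = (u, v, ((T, T', f), cut_of T' N'))" "ptree_iso P T T' f" "nmap f ` N = N'"
proof -
  have uv: "u \<in> Obj cutsum" "v \<in> Obj cutsum"
    using groupoid.Hom_Obj[OF groupoid_cutsum d] by simp_all
  obtain T N where u: "u = (T, cut_of T N)" "is_ptree P T" "closed_nodes T N"
    by (rule Obj_cutsumE[OF uv(1)])
  obtain T' N' where v: "v = (T', cut_of T' N')" "is_ptree P T'" "closed_nodes T' N'"
    by (rule Obj_cutsumE[OF uv(2)])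
  obtain f where "d = (u, v, ((T, T', f), cut_of T' N'))" "ptree_iso P T T' f" "nmap f ` N = N'"
    using d Hom_cutsum[OF uv[unfolded u(1) v(1)] u(3) v(3), of d] u(1) v(1) by auto
  with u v show thesis by (rule that)
qed

lemma cut_forest_cut_of:
  "is_ptree P T \<Longrightarrow> closed_nodes T N \<Longrightarrow>
    cut_forest T (cut_of T N) = (leaves (subtree T N), \<lambda>l\<in>leaves (subtree T N). ideal_tree T l)"
  by (simp add: cut_forest_def cut_tree_cut_of)

lemma omap_cut_proj: "omap cut_proj (T, C) = (cut_forest T C, cut_tree T C)"
  by (simp add: cut_proj_def)

lemma amap_cut_proj: "amap cut_proj ((T, C), (T', C'), ((U, U', f), C'')) =
       ((cut_forest T C, cut_forest T' C',
         (restrict (emap f) (leaves (cut_tree T C)),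
          \<lambda>l\<in>leaves (cut_tree T C).
            (ideal_tree T l, ideal_tree T' (emap f l), restrict_ptree_map (ideal_tree T l) f))),
        (cut_tree T C, cut_tree T' C', restrict_ptree_map (cut_tree T C) f))"
  by (simp add: cut_proj_def)

lemma leaves_subtree_edges: "is_ptree P T \<Longrightarrow> closed_nodes T N \<Longrightarrow> l \<in> leaves (subtree T N) \<Longrightarrow> l \<in> edges T"
  using edges_over_subset[OF ptree_tree] by (auto simp: leaves_subtree)

lemma restrict_iso_subtree:
  assumes "is_ptree P T" "is_ptree P T'" "closed_nodes T N" "closed_nodes T' N'" "ptree_iso P T T' f" "nmap f ` N = N'"
  shows "ptree_iso P (subtree T N) (subtree T' N') (restrict_ptree_map (subtree T N) f)"
  using assms restrict_iso[OF assms(1,2,5) spans_closed[OF ptree_tree[OF assms(1)] assms(3)]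
      spans_closed[OF ptree_tree[OF assms(2)] assms(4)]] iso_closed_nodes(2)[OF assms(1,2,5,3)] by simp

lemma restrict_ptree_map_comp:
  assumes "\<And>x. x \<in> edges S \<Longrightarrow> emap f x \<in> edges S' \<and> x \<in> edges T"
    "\<And>x. x \<in> marks S \<Longrightarrow> mmap f x \<in> marks S' \<and> x \<in> marks T"
    "\<And>x. x \<in> nodes S \<Longrightarrow> nmap f x \<in> nodes S' \<and> x \<in> nodes T"
  shows "restrict_ptree_map S (ptree_comp P T g f) =
    ptree_comp P S (restrict_ptree_map S' g) (restrict_ptree_map S f)"
  by (rule ptree_map.equality) (auto simp: fun_eq_iff restrict_def assms)

lemma restrict_ptree_map_id:
  assumes "edges S \<subseteq> edges T" "marks S \<subseteq> marks T" "nodes S \<subseteq> nodes T"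
    "\<And>x. x \<in> edges S \<Longrightarrow> ecol S x = ecol T x" "\<And>x. x \<in> marks S \<Longrightarrow> mcol S x = mcol T x"
    "\<And>x. x \<in> nodes S \<Longrightarrow> ncol S x = ncol T x"
  shows "restrict_ptree_map S (ptree_id P T) = ptree_id P S"
  using assms by (intro ptree_map.equality) (auto simp: fun_eq_iff restrict_def)

lemma restrict_comp_iso:
  assumes f: "ptree_iso P (span T A N) V (restrict_ptree_map (span T A N) f)" and "A \<subseteq> edges T" "N \<subseteq> nodes T"
  shows "restrict_ptree_map (span T A N) (ptree_comp P T g f) =
    ptree_comp P (span T A N) (restrict_ptree_map V g) (restrict_ptree_map (span T A N) f)"
proof -
  note fe = iso_embedding[OF f]
  show ?thesis
    by (rule restrict_ptree_map_comp)
      (use emap_in[OF fe] mmap_in[OF fe] nmap_in[OF fe] assms(2,3) in \<open>auto simp: marks_over_def\<close>)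
qed

lemma Ident_cutsum: "Ident cutsum (T, C) = ((T, C), (T, C), ((T, T, ptree_id P T), C))"
  by (simp add: hsum_def hom_gpd_simps ptrees_simps fam_cut_family) (simp add: disc_gpd_def)

lemma Comp_cutsum:
  "((T', C'), (T'', C''), ((V', V'', g), c')) \<cdot>\<^bsub>cutsum\<^esub> ((T, C), U, ((V, W, f), c)) =
    ((T, C), (T'', C''), ((V, V'', ptree_comp P V g f), (\<lambda>(U, c). (U, ptree_comp P U g c)) ` c))"
  by (simp add: hsum_def hom_gpd_simps ptrees_simps fam_cut_family tra_cut_family) (simp add: disc_gpd_def)

lemma ideal_subset: "ideal_edges T l \<subseteq> edges T" "ideal_nodes T l \<subseteq> nodes T"
  by (auto simp: ideal_edges_def ideal_nodes_def)

lemma gfunctor_cut_proj: "gfunctor cutsum (pforests P \<times>\<^sub>G ptrees P) cut_proj"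
proof (rule gfunctorI[OF groupoid_cutsum groupoid_prod[OF groupoid_pforests groupoid_ptrees]], goal_cases)
  case (1 u)
  then obtain T N where u: "u = (T, cut_of T N)" "is_ptree P T" "closed_nodes T N"
    by (rule Obj_cutsumE)
  have "finite (leaves (subtree T N))"
    using ptree_tree[OF subtree_is_ptree[OF u(2,3)]] by (auto simp: is_tree_def leaves_def)
  then show ?case
    using u by (simp add: omap_cut_proj cut_forest_cut_of cut_tree_cut_of prod_gpd_simps ptrees_simps Obj_pforests
        subtree_is_ptree ideal_tree_is_ptree leaves_subtree_edges)
next
  case (2 d u v)
  then obtain T N T' N' f where u: "u = (T, cut_of T N)" "is_ptree P T" "closed_nodes T N"
    and v: "v = (T', cut_of T' N')" "is_ptree P T'" "closed_nodes T' N'"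
    and f: "d = (u, v, ((T, T', f), cut_of T' N'))" "ptree_iso P T T' f" "nmap f ` N = N'"
    by (rule Hom_cutsumE)
  note rS = restrict_iso_subtree[OF u(2) v(2) u(3) v(3) f(2,3)]
  note b = bij_betw_leaves[OF subtree_is_ptree[OF u(2,3)] rS]
  have b': "bij_betw (restrict (emap f) (leaves (subtree T N))) (leaves (subtree T N)) (leaves (subtree T' N'))"
    by (rule bij_betw_cong[THEN iffD1, OF _ b]) (simp add: leaves_subtree)
  have fl: "emap f l \<in> leaves (subtree T' N')" if "l \<in> leaves (subtree T N)" for l
    using bij_betwE[OF b'] that by simp
  have obj: "(leaves (subtree T N), \<lambda>l\<in>leaves (subtree T N). ideal_tree T l) \<in> Obj (pforests P)"
    if "is_ptree P T" "closed_nodes T N" for T :: "('c, 'i, 'ia, 'e, 'b, 'ba) ptree" and N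
  proof -
    have "finite (leaves (subtree T N))"
      using ptree_tree[OF subtree_is_ptree[OF that]] by (auto simp: is_tree_def leaves_def)
    then show ?thesis
      using that by (simp add: Obj_pforests ideal_tree_is_ptree leaves_subtree_edges)
  qed
  show ?case
    using rS b' fl obj[OF u(2,3)] obj[OF v(2,3)] restrict_iso_ideal[OF u(2) v(2) f(2)] leaves_subtree_edges[OF u(2,3)]
      subtree_is_ptree[OF u(2,3)] subtree_is_ptree[OF v(2,3)]
    by (simp add: f(1) u v amap_cut_proj omap_cut_proj cut_forest_cut_of cut_tree_cut_of Hom_prod Hom_ptrees Hom_pforests)
next
  case (3 u)
  then obtain T N where u: "u = (T, cut_of T N)" "is_ptree P T" "closed_nodes T N"
    by (rule Obj_cutsumE)
  have h: "edges_over T N \<subseteq> edges T" "N \<subseteq> nodes T" "marks_over T M \<subseteq> marks T" for M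
    using edges_over_subset[OF ptree_tree[OF u(2)] u(3)] u(3) by (auto simp: closed_nodes_def marks_over_def)
  have "restrict_ptree_map (subtree T N) (ptree_id P T) = ptree_id P (subtree T N)"
    by (rule restrict_ptree_map_id) (use h in simp_all)
  moreover have "restrict_ptree_map (ideal_tree T l) (ptree_id P T) = ptree_id P (ideal_tree T l)" for l
    by (rule restrict_ptree_map_id) (simp_all add: ideal_tree_eq h ideal_subset)
  ultimately show ?case
    using leaves_subtree_edges[OF u(2,3)]
    by (auto simp: u Ident_cutsum amap_cut_proj omap_cut_proj cut_forest_cut_of cut_tree_cut_of prod_gpd_simps
        ptrees_simps pforests_def Ident_tilde fun_eq_iff restrict_def)
next
  case (4 d e u v w)
  from 4(1) obtain T N T' N' f where u: "u = (T, cut_of T N)" "is_ptree P T" "closed_nodes T N"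
    and v: "v = (T', cut_of T' N')" "is_ptree P T'" "closed_nodes T' N'"
    and f: "d = (u, v, ((T, T', f), cut_of T' N'))" "ptree_iso P T T' f" "nmap f ` N = N'"
    by (rule Hom_cutsumE)
  from 4(2) obtain V' M' T'' N'' g where v': "v = (V', cut_of V' M')" "closed_nodes V' M'"
    and w: "w = (T'', cut_of T'' N'')" "is_ptree P T''" "closed_nodes T'' N''"
    and g': "e = (v, w, ((V', T'', g), cut_of T'' N''))" "ptree_iso P V' T'' g" "nmap g ` M' = N''"
    by (rule Hom_cutsumE)
  \<comment> \<open>The middle object has been decomposed once for each arrow. The two
    decompositions agree since a cut determines its node set.\<close>
  have "V' = T'" "M' = N'"
    using v v' inj_on_eq_iff[OF inj_on_cut_of[OF v(2)], of M' N'] by auto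
  note g = g'[unfolded this]
  note rS = restrict_iso_subtree[OF u(2) v(2) u(3) v(3) f(2,3)]
  have h: "edges_over T N \<subseteq> edges T" "N \<subseteq> nodes T"
    using edges_over_subset[OF ptree_tree[OF u(2)] u(3)] u(3) by (auto simp: closed_nodes_def)
  have fl: "emap f l \<in> leaves (subtree T' N')" if "l \<in> leaves (subtree T N)" for l
    using bspec[OF bij_betwE[OF bij_betw_leaves[OF subtree_is_ptree[OF u(2,3)] rS]] that] leaves_subset[OF that]
    by simp
  have id: "restrict_ptree_map (ideal_tree T l) (ptree_comp P T g f) = ptree_comp P (ideal_tree T l)
      (restrict_ptree_map (ideal_tree T' (emap f l)) g) (restrict_ptree_map (ideal_tree T l) f)"
    if "l \<in> leaves (subtree T N)" for l
    unfolding ideal_tree_eq[of T l]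
    by (rule restrict_comp_iso[OF restrict_iso_ideal[OF u(2) v(2) f(2) leaves_subtree_edges[OF u(2,3) that],
        unfolded ideal_tree_eq[of T l]] ideal_subset])
  show ?case
    using fl id leaves_subtree_edges[OF u(2,3)]
    by (simp add: f(1) g(1) u v w Comp_cutsum amap_cut_proj cut_forest_cut_of cut_tree_cut_of prod_gpd_simps
        ptrees_simps pforests_def Comp_tilde restrict_comp_iso[OF rS h] fun_eq_iff restrict_def)
qed

section \<open>The comparison of cuts with trees that carry forests on their leaves\<close>

definition leaf_colours :: "('u, 'i, 'ia, 'e, 'b, 'ba) ptree \<Rightarrow> ('u, 'i) tilde_obj" where
  "leaf_colours T = (leaves T, restrict (ecol T) (leaves T))"

text \<open>The ideal subtree at \<open>l\<close> has root \<open>l\<close> and inherits its colour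
  from \<open>T\<close>, as does the subtree of the cut. The two colourings are therefore equal, not
  merely isomorphic.\<close>

lemma cut_leaf_root:
  assumes "is_ptree P T" "closed_nodes T N"
  shows "omap root_fun (cut_forest T (cut_of T N)) = leaf_colours (subtree T N)"
  using root_ideal_tree[OF assms(1) leaves_subtree_edges[OF assms]] ideal_edges_self[OF leaves_subtree_edges[OF assms]]
    leaves_subset[of _ "subtree T N"]
  by (auto simp: cut_forest_cut_of assms omap_root_fun leaf_colours_def fun_eq_iff ideal_tree_eq restrict_def)

text \<open>An application of \<open>equivalent_over_tsum\<close>. Full faithfulness is gluing of
  isomorphisms along \<open>assembled_cut\<close>; essential surjectivity is
  \<open>separated_copy\<close> followed by \<open>assembled_ex\<close>.\<close>

lemma equivalent_cutsum_tsum: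
  "equivalent_over (pforests P \<times>\<^sub>G (ptrees P :: ('u::infinite, 'i, 'ia, 'e, 'ea, 'b, 'ba) ptree_gpd)) cutsum cut_proj
    (hsum (ptrees P) (pullback_family (fibre_family (pforests P) (tilde (gpdI P)) root_fun) leaf_fun)) fibre_sum_proj"
proof -
  let ?F = "pforests P :: ('u, 'i, 'ia, 'e, 'ea, 'b, 'ba) pforest_gpd"
  let ?T = "ptrees P :: ('u, 'i, 'ia, 'e, 'ea, 'b, 'ba) ptree_gpd"
  let ?I = "tilde (gpdI P)" and ?C = "hsum ?T (cut_family P)"
  have R0: "gfunctor ?F ?I root_fun" (is "gfunctor _ _ ?R") by (rule gfunctor_root_fun)
  have L0: "gfunctor ?T ?I leaf_fun" (is "gfunctor _ _ ?L") by (rule gfunctor_leaf_fun)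
  interpret R: gfunctor ?F ?I ?R by (rule R0)
  interpret L: gfunctor ?T ?I ?L by (rule L0)
  interpret cospan ?F ?I ?T ?R ?L ..
  define \<psi> where "\<psi> = (\<lambda>(T :: ('u, 'i, 'ia, 'e, 'b, 'ba) ptree, C :: ('u, 'i, 'ia, 'e, 'ea, 'b, 'ba) ptree_cut).
    Ident ?I (leaf_colours (cut_tree T C)))"
  have oL: "omap ?L S = leaf_colours S" for S
    by (simp add: omap_leaf_fun leaf_colours_def)
  \<comment> \<open>As \<open>\<psi>\<close> consists of identities, its compatibility square says
    that the two arrows of leaf colourings coincide: equal bijections and equal colour
    arrows.\<close>
  have tri: "\<psi> (T', cut_of T' N') \<cdot>\<^bsub>?I\<^esub> amap ?R a = amap ?L \<sigma> \<cdot>\<^bsub>?I\<^esub> \<psi> (T, cut_of T N) \<longleftrightarrow>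
      amap ?R a = amap ?L \<sigma>"
    if T: "is_ptree P T" "closed_nodes T N" "is_ptree P T'" "closed_nodes T' N'"
      and a: "a \<in> Hom ?F (cut_forest T (cut_of T N)) (cut_forest T' (cut_of T' N'))"
      and s: "\<sigma> \<in> Hom ?T (subtree T N) (subtree T' N')" for T N T' N' a \<sigma>
    using R.Y.Ident_left[OF R.amap_Hom[OF a], unfolded cut_leaf_root[OF T(3,4)]] R.Y.Ident_right[OF L.amap_Hom[OF s], unfolded oL]
    by (simp add: \<psi>_def cut_tree_cut_of T cut_leaf_root)
  show ?thesis
  proof (rule equivalent_over_tsum[OF gfunctor_cut_proj])
    fix c assume "c \<in> Obj ?C"
    then obtain T N where c: "c = (T, cut_of T N)" "is_ptree P T" "closed_nodes T N" by (rule Obj_cutsumE)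
    then show "\<psi> c \<in> Hom ?I (omap ?R (fst (omap cut_proj c))) (omap ?L (snd (omap cut_proj c)))"
      using L.omap_in[of "subtree T N", unfolded oL] subtree_is_ptree[OF c(2,3)]
      by (simp add: \<psi>_def omap_cut_proj cut_tree_cut_of cut_leaf_root oL ptrees_simps R.Y.Ident_Hom)
  next
    fix d c c' assume d: "d \<in> Hom ?C c c'"
    then obtain T N T' N' f where c: "c = (T, cut_of T N)" "is_ptree P T" "closed_nodes T N"
      and c': "c' = (T', cut_of T' N')" "is_ptree P T'" "closed_nodes T' N'"
      and f: "d = (c, c', ((T, T', f), cut_of T' N'))" "ptree_iso P T T' f" "nmap f ` N = N'"
      by (rule Hom_cutsumE)
    have aH: "amap cut_proj d \<in> Hom (?F \<times>\<^sub>G ?T) (omap cut_proj c) (omap cut_proj c')"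
      by (rule gfunctor.amap_Hom[OF gfunctor_cut_proj d])
    have "amap ?R (fst (amap cut_proj d)) = amap ?L (snd (amap cut_proj d))"
      using cut_leaf_root[OF c(2,3), unfolded leaf_colours_def] cut_leaf_root[OF c'(2,3), unfolded leaf_colours_def]
        root_ideal_tree[OF c(2) leaves_subtree_edges[OF c(2,3)]]
        ideal_edges_self[OF leaves_subtree_edges[OF c(2,3)]] leaves_subset[of _ "subtree T N"]
      by (simp add: f(1) c c' amap_cut_proj cut_tree_cut_of cut_forest_cut_of amap_root_fun amap_leaf_fun
          omap_root_fun omap_leaf_fun) (auto simp: fun_eq_iff restrict_def ideal_tree_eq)
    then show "\<psi> c' \<cdot>\<^bsub>?I\<^esub> amap ?R (fst (amap cut_proj d)) = amap ?L (snd (amap cut_proj d)) \<cdot>\<^bsub>?I\<^esub> \<psi> c"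
      using tri[OF c(2,3) c'(2,3), of "fst (amap cut_proj d)" "snd (amap cut_proj d)"] aH
      by (simp add: c c' Hom_prod omap_cut_proj cut_tree_cut_of mem_Times_iff)
  next
    fix c c' a \<sigma> assume cc: "c \<in> Obj ?C" "c' \<in> Obj ?C"
      and a: "a \<in> Hom ?F (fst (omap cut_proj c)) (fst (omap cut_proj c'))"
      and s: "\<sigma> \<in> Hom ?T (snd (omap cut_proj c)) (snd (omap cut_proj c'))"
      and comm: "\<psi> c' \<cdot>\<^bsub>?I\<^esub> amap ?R a = amap ?L \<sigma> \<cdot>\<^bsub>?I\<^esub> \<psi> c"
    obtain T N where c: "c = (T, cut_of T N)" "is_ptree P T" "closed_nodes T N"
      by (rule Obj_cutsumE[OF cc(1)])
    obtain T' N' where c': "c' = (T', cut_of T' N')" "is_ptree P T'" "closed_nodes T' N'"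
      by (rule Obj_cutsumE[OF cc(2)])
    let ?S = "subtree T N" and ?S' = "subtree T' N'"
    from s obtain g where g: "\<sigma> = (?S, ?S', g)" "ptree_iso P ?S ?S' g"
      by (auto simp: c c' omap_cut_proj cut_tree_cut_of Hom_ptrees)
    note gl = bij_betw_leaves[OF subtree_is_ptree[OF c(2,3)] g(2)]
    note aF = a[unfolded c(1) c'(1) omap_cut_proj fst_conv]
    from aF obtain b \<eta> where ab: "a = (cut_forest T (cut_of T N), cut_forest T' (cut_of T' N'), (b, \<eta>))"
      "b \<in> extensional (leaves ?S)" "\<eta> \<in> extensional (leaves ?S)"
      "\<And>l. l \<in> leaves ?S \<Longrightarrow> \<exists>h. \<eta> l = (ideal_tree T l, (\<lambda>l\<in>leaves ?S'. ideal_tree T' l) (b l), h) \<and>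
        ptree_iso P (ideal_tree T l) ((\<lambda>l\<in>leaves ?S'. ideal_tree T' l) (b l)) h"
      by (auto simp: cut_forest_cut_of c(2,3) c'(2,3) Hom_pforests)
    have sF: "\<sigma> \<in> Hom ?T ?S ?S'"
      using s by (simp add: c c' omap_cut_proj cut_tree_cut_of)
    have "amap ?R a = amap ?L \<sigma>"
      using comm[unfolded c(1) c'(1)] by (simp only: tri[OF c(2,3) c'(2,3) aF sF])
    \<comment> \<open>Comparing components, the bijection of the forests is \<open>g\<close> on the
      leaves, and the colour arrow at the root of each component is that of \<open>g\<close> at the
      leaf. This is the agreement that \<open>assembled_iso_ex\<close> asks for.\<close>
    then have b: "b = restrict (emap g) (leaves ?S)"
      and e: "(\<lambda>l\<in>leaves ?S. case \<eta> l of (_, _, h) \<Rightarrow> eiso h (root ((\<lambda>l\<in>leaves ?S. ideal_tree T l) l))) =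
        restrict (eiso g) (leaves ?S)"
      by (simp_all add: ab(1) g(1) cut_forest_cut_of c(2,3) c'(2,3) amap_root_fun amap_leaf_fun)
    have "\<exists>h. \<eta> l = (ideal_tree T l, ideal_tree T' (emap g l), h) \<and>
        ptree_iso P (ideal_tree T l) (ideal_tree T' (emap g l)) h" if l: "l \<in> leaves ?S" for l
      using ab(4)[OF l] bij_betwE[OF gl] l by (simp add: b)
    then obtain h where h: "\<And>l. l \<in> leaves ?S \<Longrightarrow> \<eta> l = (ideal_tree T l, ideal_tree T' (emap g l), h l)"
      "\<And>l. l \<in> leaves ?S \<Longrightarrow> ptree_iso P (ideal_tree T l) (ideal_tree T' (emap g l)) (h l)" by metis
    have eh: "eiso (h l) l = eiso g l" if l: "l \<in> leaves ?S" for l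
      using fun_cong[OF e, of l] l h(1)[OF l] root_ideal_tree[OF c(2) leaves_subtree_edges[OF c(2,3) l]] by simp
    note A = assembled_cut[OF c(2,3)] and A' = assembled_cut[OF c'(2,3)]
    obtain f where f: "ptree_iso P T T' f" "restrict_ptree_map ?S f = g"
      "\<And>l. l \<in> leaves ?S \<Longrightarrow> restrict_ptree_map (ideal_tree T l) f = h l"
      using assembled_iso_ex[OF A A' g(2) h(2) eh] by blast
    \<comment> \<open>The glued isomorphism extends \<open>g\<close>, so it carries the first cut to
      the second and is an arrow of the sum.\<close>
    have "nmap f ` N = nmap g ` N"
      unfolding f(2)[symmetric] by (rule image_cong) simp_all
    also have "\<dots> = N'"
      using bij_nmap[OF g(2)] by (simp add: bij_betw_def)
    finally have fN: "nmap f ` N = N'" .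
    have fl: "emap f l = emap g l" if "l \<in> leaves ?S" for l
      unfolding f(2)[symmetric] using leaves_subset[OF that] by simp
    let ?d = "(c, c', ((T, T', f), cut_of T' N'))"
    have pd: "amap cut_proj ?d = (a, \<sigma>)"
      using ab(2,3) f(3) h(1) fl
      by (simp add: c c' amap_cut_proj cut_tree_cut_of f(2) g(1) ab(1) b)
        (auto simp: fun_eq_iff restrict_def extensional_def)
    show "\<exists>!d. d \<in> Hom ?C c c' \<and> amap cut_proj d = (a, \<sigma>)"
    proof (rule ex1I[of _ ?d])
      show "?d \<in> Hom ?C c c' \<and> amap cut_proj ?d = (a, \<sigma>)"
        using pd f(1) fN cc c c' by (simp add: Hom_cutsum)
      fix d assume d: "d \<in> Hom ?C c c' \<and> amap cut_proj d = (a, \<sigma>)"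
      then obtain f' where f': "d = (c, c', ((T, T', f'), cut_of T' N'))" "ptree_iso P T T' f'"
        using cc c c' by (auto simp: Hom_cutsum)
      have eq: "amap cut_proj d = amap cut_proj ?d" using d pd by simp
      \<comment> \<open>The image under \<open>cut_proj\<close> records the restrictions of the
        isomorphism to all pieces.\<close>
      have "f' = f"
      proof (rule assembled_iso_unique[OF A iso_embedding[OF f'(2)] iso_embedding[OF f(1)]])
        show "restrict_ptree_map ?S f' = restrict_ptree_map ?S f"
          using eq by (simp add: f'(1) c c' amap_cut_proj cut_tree_cut_of)
        fix l assume l: "l \<in> leaves ?S"
        have "(\<lambda>l\<in>leaves ?S. (ideal_tree T l, ideal_tree T' (emap f' l), restrict_ptree_map (ideal_tree T l) f')) =
            (\<lambda>l\<in>leaves ?S. (ideal_tree T l, ideal_tree T' (emap f l), restrict_ptree_map (ideal_tree T l) f))"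
          using eq by (simp add: f'(1) c c' amap_cut_proj cut_tree_cut_of)
        from fun_cong[OF this, of l] l
        show "restrict_ptree_map (ideal_tree T l) f' = restrict_ptree_map (ideal_tree T l) f" by simp
      qed
      then show "d = ?d" using f'(1) by simp
    qed
  next
    fix x S \<phi> assume x: "x \<in> Obj ?F" and S: "S \<in> Obj ?T" and phi: "\<phi> \<in> Hom ?I (omap ?R x) (omap ?L S)"
    obtain X Q where xQ: "x = (X, Q)" by (cases x)
    have Q: "finite X" "\<And>x. x \<in> X \<Longrightarrow> is_ptree P (Q x)" and S': "is_ptree P S"
      using x S by (auto simp: xQ Obj_pforests ptrees_simps)
    from phi obtain b \<beta> where b: "\<phi> = (omap ?R x, omap ?L S, (b, \<beta>))" "b \<in> extensional X"
        "bij_betw b X (leaves S)" "\<beta> \<in> extensional X"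
        "\<And>x. x \<in> X \<Longrightarrow> \<beta> x \<in> Hom (gpdI P) (ecol (Q x) (root (Q x))) (restrict (ecol S) (leaves S) (b x))"
      by (auto simp: xQ omap_root_fun omap_leaf_fun Hom_tilde PiE_iff)
    have \<beta>: "\<beta> x \<in> Hom (gpdI P) (ecol (Q x) (root (Q x))) (ecol S (b x))" if "x \<in> X" for x
      using b(5)[OF that] bij_betwE[OF b(3)] that by simp
    obtain S1 Q1 i k where c: "separated P S1 Q1" "Q1 \<in> extensional (leaves S1)" "ptree_iso P S S1 (i :: ('u, 'ia, 'ea, 'ba) ptree_map)"
      "\<And>x. x \<in> X \<Longrightarrow> ptree_iso P (Q x) (Q1 (emap i (b x))) (k x)"
      "\<And>x. x \<in> X \<Longrightarrow> eiso (k x) (root (Q x)) = eiso i (b x) \<cdot>\<^bsub>gpdI P\<^esub> \<beta> x"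
      using separated_copy[OF S' Q b(3) \<beta>] by metis
    obtain T where A: "assembled P T S1 Q1" using assembled_ex[OF c(1)] by blast
    note T = asm_ptree[OF A] and u = assembled_unique[OF A]
    let ?N = "nodes S1" and ?c = "(T, cut_of T (nodes S1))"
    have ct: "cut_tree T (cut_of T ?N) = S1"
      by (simp add: cut_tree_cut_of[OF T u(1)] u(2))
    have "(\<lambda>l\<in>leaves S1. ideal_tree T l) = (\<lambda>l\<in>leaves S1. Q1 l)"
      by (rule restrict_ext) (rule u(3))
    \<comment> \<open>\<open>Q1\<close> is extensional on the leaves, so the forest of the cut is
      equal to the given copy as a pair.\<close>
    then have cf: "cut_forest T (cut_of T ?N) = (leaves S1, Q1)"
      by (simp add: cut_forest_def ct extensional_restrict[OF c(2)])
    have c_obj: "?c \<in> Obj ?C" using T u(1) by (auto simp: Obj_cutsum)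
    have proj: "omap cut_proj ?c = ((leaves S1, Q1), S1)" by (simp add: omap_cut_proj ct cf)
    have S1: "is_ptree P S1" using subtree_is_ptree[OF T u(1)] u(2) by simp
    have il: "bij_betw (emap i) (leaves S) (leaves S1)" by (rule bij_betw_leaves[OF S' c(3)])
    \<comment> \<open>The copying isomorphisms go from the given object to the copy. The required
      arrows go the other way, so the commuting square established for these is inverted at the
      end.\<close>
    let ?\<sigma> = "(S, S1, i)" and ?a = "(x, (leaves S1, Q1), (\<lambda>x\<in>X. emap i (b x), \<lambda>x\<in>X. (Q x, Q1 (emap i (b x)), k x)))"
    have \<sigma>: "?\<sigma> \<in> Hom ?T S S1" using S' S1 c(3) by (simp add: Hom_ptrees)
    have obj1: "(leaves S1, Q1) \<in> Obj ?F"
      using gfunctor.omap_in[OF gfunctor_cut_proj c_obj] by (simp add: proj prod_gpd_simps)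
    have bb: "bij_betw (\<lambda>x\<in>X. emap i (b x)) X (leaves S1)"
      using bij_betw_trans[OF b(3) il] by (simp add: comp_def)
    have a: "?a \<in> Hom ?F x (leaves S1, Q1)"
      using x obj1 bb c(4) by (simp add: xQ Hom_pforests)
    have "amap ?R ?a = amap ?L ?\<sigma> \<cdot>\<^bsub>?I\<^esub> \<phi>"
      using c(5) bij_betwE[OF b(3)] cut_leaf_root[OF T u(1), unfolded leaf_colours_def]
      by (simp add: b(1) xQ amap_root_fun amap_leaf_fun omap_root_fun omap_leaf_fun Comp_tilde cf u(2) fun_eq_iff restrict_def)
    moreover have "\<psi> ?c = Ident ?I (leaf_colours S1)" by (simp add: \<psi>_def ct)
    moreover have oeq: "omap ?R (leaves S1, Q1) = leaf_colours S1"
      using cut_leaf_root[OF T u(1)] by (simp add: cf u(2))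
    ultimately have "\<psi> ?c \<cdot>\<^bsub>?I\<^esub> amap ?R ?a = amap ?L ?\<sigma> \<cdot>\<^bsub>?I\<^esub> \<phi>"
      using R.Y.Ident_left[OF R.amap_Hom[OF a], unfolded oeq] by simp
    moreover have psi: "\<psi> ?c \<in> Hom ?I (omap ?R (leaves S1, Q1)) (omap ?L S1)"
      using L.omap_in[of S1, unfolded oL] S1 by (simp add: \<psi>_def ct oeq oL ptrees_simps R.Y.Ident_Hom)
    \<comment> \<open>\<open>ginv_square\<close> reverses the square; functors preserve inverses, so
      the sides are again images of arrows of forests and trees.\<close>
    ultimately have "\<phi> \<cdot>\<^bsub>?I\<^esub> ginv ?I (amap ?R ?a) = ginv ?I (amap ?L ?\<sigma>) \<cdot>\<^bsub>?I\<^esub> \<psi> ?c"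
      using R.Y.ginv_square[OF R.amap_Hom[OF a] psi phi L.amap_Hom[OF \<sigma>]] by simp
    then have "\<phi> \<cdot>\<^bsub>?I\<^esub> amap ?R (ginv ?F ?a) = amap ?L (ginv ?T ?\<sigma>) \<cdot>\<^bsub>?I\<^esub> \<psi> ?c"
      by (simp only: R.amap_ginv[OF a] L.amap_ginv[OF \<sigma>])
    then show "\<exists>c\<in>Obj ?C. \<exists>a\<in>Hom ?F (fst (omap cut_proj c)) x. \<exists>\<sigma>\<in>Hom ?T (snd (omap cut_proj c)) S.
        \<phi> \<cdot>\<^bsub>?I\<^esub> amap ?R a = amap ?L \<sigma> \<cdot>\<^bsub>?I\<^esub> \<psi> c"
      using c_obj R.X.ginv_Hom[OF a] L.X.ginv_Hom[OF \<sigma>] proj by (intro bexI[of _ ?c]) auto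
  qed
qed

end

theorem theorem5p7:
  fixes P :: "('i, 'ia, 'e, 'ea, 'b, 'ba) poly"
  assumes "is_poly P"
  shows "let T = (ptrees P :: ('u::infinite, 'i, 'ia, 'e, 'ea, 'b, 'ba) ptree_gpd);
             F = (pforests P :: ('u, 'i, 'ia, 'e, 'ea, 'b, 'ba) pforest_gpd);
             I' = tilde (gpdI P);
             cutsum = hsum T (cut_family P);
             treesum = hsum T (pullback_family (fibre_family F I' root_fun) leaf_fun);
             colsum = hsum I' (prod_family (fibre_family F I' root_fun) (fibre_family T I' leaf_fun))
         in equivalent_over (F \<times>\<^sub>G T) cutsum cut_proj treesum fibre_sum_proj \<and>
            equivalent_over (F \<times>\<^sub>G T) treesum fibre_sum_proj colsum fibre_prod_proj"
proof -
  interpret polynomial P by unfold_locales fact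
  interpret cospan "pforests P :: ('u, 'i, 'ia, 'e, 'ea, 'b, 'ba) pforest_gpd" "tilde (gpdI P)"
      "ptrees P :: ('u, 'i, 'ia, 'e, 'ea, 'b, 'ba) ptree_gpd" root_fun leaf_fun
    by (intro cospan.intro gfunctor_root_fun gfunctor_leaf_fun)
  show ?thesis
    unfolding Let_def using equivalent_cutsum_tsum equivalent_over_tsum_csum by blast
qed

end
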